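(* There exist Riemannian metrics on $\mathbb{RP}^3$ for which all equators are minimal and whose isometry group is discrete.
   Context: The equators of $S^3\subset\mathbb{R}^4$ are the sets $\{p\in S^3:\langle p,v\rangle=0\}$, $v\in S^3$ (intersections of $S^3$ with $3$-dimensional linear hyperplanes of $\mathbb{R}^4$). The equators of $\mathbb{RP}^3=S^3/\{\pm1\}$ are their images under the quotient map, i.e. the linear projective planes. "Minimal" means zero mean curvature with respect to the given metric. *)

theory Defs
  imports "HOL-Analysis.Analysis"
begin

subsection \<open>Smooth maps between Euclidean spaces\<close>

text \<open>Both notions are meant for open \<open>S\<close>.\<close>

fun differentiable_times_on ::
    "nat \<Rightarrow> ('a::real_normed_vector \<Rightarrow> 'b::real_normed_vector) \<Rightarrow> 'a set \<Rightarrow> bool" where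
  "differentiable_times_on 0 f S \<longleftrightarrow> continuous_on S f"
| "differentiable_times_on (Suc n) f S \<longleftrightarrow>
     (\<forall>x\<in>S. f differentiable (at x)) \<and>
     (\<forall>v. differentiable_times_on n (\<lambda>x. frechet_derivative f (at x) v) S)"

definition smooth_on ::
    "('a::real_normed_vector \<Rightarrow> 'b::real_normed_vector) \<Rightarrow> 'a set \<Rightarrow> bool" where
  "smooth_on f S \<longleftrightarrow> (\<forall>n. differentiable_times_on n f S)"

definition partial :: "'n \<Rightarrow> (real^'n \<Rightarrow> 'b::real_normed_vector) \<Rightarrow> real^'n \<Rightarrow> 'b" where
  "partial i f x = frechet_derivative f (at x) (axis i 1)"


subsection \<open>Mean curvature in local coordinates\<close>

text \<open>
  Here \<open>G\<close> is the coefficient matrix of a Riemannian metric on (an open subset of) \<open>real^'n\<close>,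
  and \<open>Y\<close> is a regular parametrization of a hypersurface.
\<close>

definition metric_prod :: "(real^'n \<Rightarrow> real^'n^'n) \<Rightarrow> real^'n \<Rightarrow> real^'n \<Rightarrow> real^'n \<Rightarrow> real" where
  "metric_prod G x v w = v \<bullet> (G x *v w)"

definition christoffel :: "(real^'n \<Rightarrow> real^'n^'n) \<Rightarrow> real^'n \<Rightarrow> 'n \<Rightarrow> 'n \<Rightarrow> 'n \<Rightarrow> real" where
  "christoffel G x k i j =
     (1/2) * (\<Sum>l\<in>UNIV. matrix_inv (G x) $ k $ l *
       (partial i (\<lambda>y. G y $ j $ l) x + partial j (\<lambda>y. G y $ i $ l) x
        - partial l (\<lambda>y. G y $ i $ j) x))"

text \<open>
  The covariant derivative, for the Levi-Civita connection of \<open>G\<close>, of the coordinate field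
  \<open>partial b Y\<close> along \<open>Y\<close> in the direction \<open>a\<close>.
\<close>

definition cov_deriv ::
    "(real^'n \<Rightarrow> real^'n^'n) \<Rightarrow> (real^'m \<Rightarrow> real^'n) \<Rightarrow> real^'m \<Rightarrow> 'm \<Rightarrow> 'm \<Rightarrow> real^'n" where
  "cov_deriv G Y u a b =
     (\<chi> k. partial a (partial b Y) u $ k +
           (\<Sum>i\<in>UNIV. \<Sum>j\<in>UNIV.
              christoffel G (Y u) k i j * partial a Y u $ i * partial b Y u $ j))"

definition unit_normal ::
    "(real^'n \<Rightarrow> real^'n^'n) \<Rightarrow> (real^'m \<Rightarrow> real^'n) \<Rightarrow> real^'m \<Rightarrow> real^'n \<Rightarrow> bool" where
  "unit_normal G Y u \<nu> \<longleftrightarrow>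
     metric_prod G (Y u) \<nu> \<nu> = 1 \<and> (\<forall>a. metric_prod G (Y u) (partial a Y u) \<nu> = 0)"

definition first_fundamental_form ::
    "(real^'n \<Rightarrow> real^'n^'n) \<Rightarrow> (real^'m \<Rightarrow> real^'n) \<Rightarrow> real^'m \<Rightarrow> real^'m^'m" where
  "first_fundamental_form G Y u =
     (\<chi> a b. metric_prod G (Y u) (partial a Y u) (partial b Y u))"

definition second_fundamental_form ::
    "(real^'n \<Rightarrow> real^'n^'n) \<Rightarrow> (real^'m \<Rightarrow> real^'n) \<Rightarrow> real^'m \<Rightarrow> real^'n \<Rightarrow> real^'m^'m" where
  "second_fundamental_form G Y u \<nu> =
     (\<chi> a b. metric_prod G (Y u) (cov_deriv G Y u a b) \<nu>)"

definition mean_curvature ::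
    "(real^'n \<Rightarrow> real^'n^'n) \<Rightarrow> (real^'m \<Rightarrow> real^'n) \<Rightarrow> real^'m \<Rightarrow> real^'n \<Rightarrow> real" where
  "mean_curvature G Y u \<nu> =
     (\<Sum>a\<in>UNIV. \<Sum>b\<in>UNIV.
        matrix_inv (first_fundamental_form G Y u) $ a $ b * second_fundamental_form G Y u \<nu> $ a $ b)"


subsection \<open>Real projective space as the antipodal quotient of the 3-sphere\<close>

quotient_type rp3 = "real^4" /
  partial: "\<lambda>p q. norm p = 1 \<and> norm q = 1 \<and> (p = q \<or> p = - q)"
  morphisms rep_rp3 antipodal_class
proof (rule part_equivpI)
  show "\<exists>p::real^4. norm p = 1 \<and> norm p = 1 \<and> (p = p \<or> p = - p)"
    by (rule exI[of _ "axis 1 1"]) simp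
qed (auto simp: symp_def transp_def)

instantiation rp3 :: topological_space
begin

definition open_rp3 :: "rp3 set \<Rightarrow> bool" where
  "open_rp3 U \<longleftrightarrow>
     openin (top_of_set (sphere 0 1)) {p \<in> sphere 0 1. antipodal_class p \<in> U}"

instance
proof
  show "open (UNIV :: rp3 set)"
  proof -
    have "{p \<in> sphere 0 1. antipodal_class p \<in> UNIV} = sphere (0::real^4) 1"
      by auto
    then show ?thesis
      unfolding open_rp3_def by (simp only: openin_subtopology_self)
  qed
next
  fix U V :: "rp3 set"
  assume "open U" "open V"
  moreover have "{p \<in> sphere 0 1. antipodal_class p \<in> U \<inter> V} =
      {p \<in> sphere 0 1. antipodal_class p \<in> U} \<inter> {p \<in> sphere 0 1. antipodal_class p \<in> V}"
    by auto
  ultimately show "open (U \<inter> V)"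
    unfolding open_rp3_def by (simp only: openin_Int)
next
  fix K :: "rp3 set set"
  assume "\<forall>U\<in>K. open U"
  moreover have "{p \<in> sphere 0 1. antipodal_class p \<in> \<Union>K} =
      \<Union>((\<lambda>U. {p \<in> sphere 0 1. antipodal_class p \<in> U}) ` K)"
    by auto
  ultimately show "open (\<Union>K)"
    unfolding open_rp3_def by (auto intro!: openin_Union simp only:)
qed

end

text \<open>
  The smooth structure is given by the affine charts: a frame, that is a linear isomorphism
  \<open>A\<close> onto \<open>real^4\<close>, yields the injective parametrization sending \<open>x\<close> to the line through
  \<open>A (1, x)\<close>.  The coordinate permutations alone give the usual atlas with four charts; the
  transition maps between any two frames are linear fractional.  The map \<open>affine_lift A\<close> is the
  lift of this parametrization to the sphere.
\<close>

type_synonym frame = "real \<times> (real^3) \<Rightarrow> real^4"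

definition affine_frame :: "frame \<Rightarrow> bool" where
  "affine_frame A \<longleftrightarrow> linear A \<and> bij A"

definition affine_lift :: "frame \<Rightarrow> real^3 \<Rightarrow> real^4" where
  "affine_lift A x = sgn (A (1, x))"

definition affine_param :: "frame \<Rightarrow> real^3 \<Rightarrow> rp3" where
  "affine_param A x = antipodal_class (affine_lift A x)"

definition coord_rep ::
    "frame \<Rightarrow> frame \<Rightarrow> (rp3 \<Rightarrow> rp3) \<Rightarrow> real^3 \<Rightarrow> real^3" where
  "coord_rep A B F x = inv (affine_param B) (F (affine_param A x))"

definition smooth_rp3 :: "(rp3 \<Rightarrow> rp3) \<Rightarrow> bool" where
  "smooth_rp3 F \<longleftrightarrow> continuous_on UNIV F \<and>
     (\<forall>A B. affine_frame A \<longrightarrow> affine_frame B \<longrightarrow>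
        smooth_on (coord_rep A B F) {x. F (affine_param A x) \<in> range (affine_param B)})"


subsection \<open>Riemannian metrics, isometries and minimal surfaces\<close>

text \<open>
  The tangent bundle of the quotient is that of the sphere with \<open>(p, v)\<close> and \<open>(-p, -v)\<close>
  identified, so a metric is a function \<open>g p v w\<close> of \<open>p\<close> in the sphere and \<open>v\<close>, \<open>w\<close>
  orthogonal to \<open>p\<close> that respects this identification.  Other values of \<open>g\<close> are irrelevant.
\<close>

type_synonym metric_tensor = "real^4 \<Rightarrow> real^4 \<Rightarrow> real^4 \<Rightarrow> real"

definition tangent_sphere :: "real^4 \<Rightarrow> (real^4) set" where
  "tangent_sphere p = {v. v \<bullet> p = 0}"

definition coord_metric ::
    "metric_tensor \<Rightarrow> frame \<Rightarrow> real^3 \<Rightarrow> real^3^3" where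
  "coord_metric g A x =
     (\<chi> i j. g (affine_lift A x) (partial i (affine_lift A) x) (partial j (affine_lift A) x))"

definition riemannian_metric :: "metric_tensor \<Rightarrow> bool" where
  "riemannian_metric g \<longleftrightarrow>
     (\<forall>p\<in>sphere 0 1.
        (\<forall>u\<in>tangent_sphere p. \<forall>v\<in>tangent_sphere p. \<forall>w\<in>tangent_sphere p. \<forall>a b.
           g p (a *\<^sub>R u + b *\<^sub>R v) w = a * g p u w + b * g p v w) \<and>
        (\<forall>v\<in>tangent_sphere p. \<forall>w\<in>tangent_sphere p. g p v w = g p w v) \<and>
        (\<forall>v\<in>tangent_sphere p. v \<noteq> 0 \<longrightarrow> g p v v > 0) \<and>
        (\<forall>v\<in>tangent_sphere p. \<forall>w\<in>tangent_sphere p. g (- p) (- v) (- w) = g p v w)) \<and>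
     (\<forall>A. affine_frame A \<longrightarrow> smooth_on (coord_metric g A) UNIV)"

definition isometry :: "metric_tensor \<Rightarrow> (rp3 \<Rightarrow> rp3) \<Rightarrow> bool" where
  "isometry g F \<longleftrightarrow> bij F \<and> smooth_rp3 F \<and> smooth_rp3 (inv F) \<and>
     (\<forall>A B x v w. affine_frame A \<longrightarrow> affine_frame B \<longrightarrow>
        F (affine_param A x) \<in> range (affine_param B) \<longrightarrow>
        metric_prod (coord_metric g B) (coord_rep A B F x)
          (frechet_derivative (coord_rep A B F) (at x) v)
          (frechet_derivative (coord_rep A B F) (at x) w)
        = metric_prod (coord_metric g A) x v w)"

definition compact_open_topology ::
    "('a::topological_space \<Rightarrow> 'b::topological_space) topology" where
  "compact_open_topology =
     topology_generated_by {{F. F ` K \<subseteq> U} | K U. compact K \<and> open U}"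

definition isometry_group_topology :: "metric_tensor \<Rightarrow> (rp3 \<Rightarrow> rp3) topology" where
  "isometry_group_topology g = subtopology compact_open_topology {F. isometry g F}"

text \<open>A regular parametrization, in the affine chart of \<open>A\<close>, of a piece of the surface \<open>\<Sigma>\<close>.\<close>

definition surface_patch ::
    "rp3 set \<Rightarrow> frame \<Rightarrow> (real^2) set \<Rightarrow> (real^2 \<Rightarrow> real^3) \<Rightarrow> bool" where
  "surface_patch \<Sigma> A V Y \<longleftrightarrow>
     affine_frame A \<and> open V \<and> smooth_on Y V \<and>
     (\<forall>u\<in>V. inj (frechet_derivative Y (at u))) \<and>
     affine_param A ` Y ` V \<subseteq> \<Sigma>"

text \<open>The first conjunct keeps the condition from being vacuous for sets that are not surfaces.\<close>

definition minimal_surface :: "metric_tensor \<Rightarrow> rp3 set \<Rightarrow> bool" where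
  "minimal_surface g \<Sigma> \<longleftrightarrow>
     (\<forall>P\<in>\<Sigma>. \<exists>A V Y. surface_patch \<Sigma> A V Y \<and> P \<in> affine_param A ` Y ` V) \<and>
     (\<forall>A V Y. surface_patch \<Sigma> A V Y \<longrightarrow>
        (\<forall>u\<in>V. \<forall>\<nu>. unit_normal (coord_metric g A) Y u \<nu> \<longrightarrow>
           mean_curvature (coord_metric g A) Y u \<nu> = 0))"

definition equator :: "real^4 \<Rightarrow> rp3 set" where
  "equator v = antipodal_class ` {p \<in> sphere 0 1. p \<bullet> v = 0}"

end

theory Submission
  imports Defs
begin

text \<open>
  Lines are geodesics of the flat connection of every affine chart, and a metric \<open>h\<close> on a chart is a
  Killing tensor for that connection (\<open>h v v\<close> is constant along each line with direction \<open>v\<close>) when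
  it comes from an algebraic curvature tensor \<open>R\<close> on \<open>real^4\<close> by \<open>h p v w = R p v w p\<close>.  For such
  an \<open>h\<close> in dimension 3, all planes are minimal for the conformal metric \<open>h / det h\<close>: differentiating
  \<open>det h\<close> in the normal direction of a plane gives exactly the trace of the second fundamental form.
  We take \<open>R\<close> diagonal with generic weights.

  To see that isometries are isolated, use curvature.  In the standard chart the scalar curvature
  attains the value 12 only at the origin, and there the Ricci tensor has distinct eigenvalues
  6, 4, 2.  So if \<open>F\<close> and \<open>H\<close> are isometries and \<open>F\<close> maps the origin into the \<open>H\<close>-image of the chart, then
  \<open>F\<close> and \<open>H\<close> agree at the origin and their differentials there differ by sign changes of the
  coordinates, which are isometries of the chart.  An isometry is determined by its 1-jet at a point, hence
  \<open>F\<close> is \<open>H\<close> composed with a sign change \<open>s\<close>; if moreover \<open>F\<close> maps \<open>(1,1,1)\<close> into the \<open>H\<close>-image of the positive octant,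
  then \<open>s\<close> is trivial and \<open>F = H\<close>.
\<close>

section \<open>Smooth functions\<close>

text \<open>Homogeneity carries the construction. Scaling \<open>p\<close>, \<open>v\<close> and
  \<open>w\<close> by c multiplies h and its determinant both by c^4, and \<open>p\<close> is in the
  kernel of h at \<open>p\<close>. So the quotient lives on lines through the origin, and in every
  affine chart it has the same formula at the unnormalized point \<open>A (1, x)\<close>. Minimality
  and isometry quantify over all frames, and this uniform formula serves them all at once.

  The power of det h is forced by the dimension. A factor (det h)^(-k) contributes k/2 times the
  normal derivative of log det h for each tangent direction of a surface, while the Killing equation
  makes h itself contribute minus one such derivative in total. Two tangent directions give k = 1.

  Isolation has to be conditional on chart images: the scalar curvature of the standard chart also
  tends to 12 along each coordinate axis, so the value 12 singles out the origin only inside the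
  chart.

  The 1-jet argument uses no geodesics. The second derivative of an isometry is a function of its
  1-jet, so the difference of two isometries obeys a linear differential inequality.\<close>

abbreviation dirderiv :: "('a::real_normed_vector \<Rightarrow> 'b::real_normed_vector) \<Rightarrow> 'a \<Rightarrow> 'a \<Rightarrow> 'b"
  where "dirderiv f x v \<equiv> frechet_derivative f (at x) v"

lemma has_derivative_dirderiv:
  "f differentiable (at x) \<Longrightarrow> (f has_derivative dirderiv f x) (at x)"
  by (simp add: frechet_derivative_works)

lemma dirderivI: "(f has_derivative f') (at x) \<Longrightarrow> dirderiv f x v = f' v"
  by (metis frechet_derivative_at)

lemma dirderiv_linear: "f differentiable (at x) \<Longrightarrow> linear (dirderiv f x)"
  by (rule linear_frechet_derivative)

lemma dirderiv_cong_open: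
  assumes "open S" "x \<in> S" "\<And>y. y \<in> S \<Longrightarrow> f y = g y" "f differentiable (at x)"
  shows "g differentiable (at x)" "dirderiv g x = dirderiv f x"
proof -
  have "(g has_derivative dirderiv f x) (at x)"
    using has_derivative_transform_within_open[OF has_derivative_dirderiv[OF assms(4)] assms(1,2)]
      assms(3) by blast
  then show "g differentiable (at x)" "dirderiv g x = dirderiv f x"
    using frechet_derivative_at[of g] by (auto simp: differentiable_def)
qed

text \<open>Derivatives are taken in the ambient space, so agreement on \<open>S\<close> passes to
  derivatives because \<open>S\<close> is open. This lets the inductions below replace a derivative
  by a formula valid on \<open>S\<close> alone.\<close>

lemma differentiable_times_on_cong:
  assumes "open S" "\<And>x. x \<in> S \<Longrightarrow> f x = g x" "differentiable_times_on n f S"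
  shows "differentiable_times_on n g S"
  using assms(2,3)
proof (induction n arbitrary: f g)
  case 0
  then show ?case by (simp cong: continuous_on_cong)
next
  case (Suc n)
  have 1: "g differentiable (at x)" "dirderiv g x = dirderiv f x" if "x \<in> S" for x
    using dirderiv_cong_open[OF assms(1) that, of f g] Suc.prems that by auto
  show ?case
    using 1 Suc.IH[of "\<lambda>x. dirderiv f x v" "\<lambda>x. dirderiv g x v" for v] Suc.prems(2)
    by simp
qed

lemma differentiable_times_on_subset:
  "differentiable_times_on n f S \<Longrightarrow> T \<subseteq> S \<Longrightarrow> differentiable_times_on n f T"
  by (induction n arbitrary: f) (auto intro: continuous_on_subset)

lemma smooth_on_subset: "smooth_on f S \<Longrightarrow> T \<subseteq> S \<Longrightarrow> smooth_on f T"
  unfolding smooth_on_def using differentiable_times_on_subset by blast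

lemma smooth_on_differentiable: "smooth_on f S \<Longrightarrow> x \<in> S \<Longrightarrow> f differentiable (at x)"
  unfolding smooth_on_def by (metis differentiable_times_on.simps(2))

lemma smooth_on_continuous_on: "smooth_on f S \<Longrightarrow> continuous_on S f"
  unfolding smooth_on_def by (metis differentiable_times_on.simps(1))

lemma smooth_on_dirderiv: "smooth_on f S \<Longrightarrow> smooth_on (\<lambda>x. dirderiv f x v) S"
  unfolding smooth_on_def by (metis differentiable_times_on.simps(2))

lemma smooth_on_has_derivative:
  "smooth_on f S \<Longrightarrow> x \<in> S \<Longrightarrow> (f has_derivative dirderiv f x) (at x)"
  by (simp add: smooth_on_differentiable has_derivative_dirderiv)

lemma smooth_onI:
  assumes "\<And>x. x \<in> S \<Longrightarrow> f differentiable (at x)"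
    and "\<And>v. smooth_on (\<lambda>x. dirderiv f x v) S"
  shows "smooth_on f S"
  unfolding smooth_on_def
proof
  fix n show "differentiable_times_on n f S"
    using assms by (cases n) (auto simp: smooth_on_def
      intro!: continuous_at_imp_continuous_on differentiable_imp_continuous_within)
qed

lemma smooth_on_const [simp]: "smooth_on (\<lambda>x. c) S"
proof -
  have "differentiable_times_on n (\<lambda>x. c) S" for n and c :: 'b
    by (induction n arbitrary: c) auto
  then show ?thesis by (simp add: smooth_on_def)
qed

lemma smooth_on_bounded_linear:
  assumes "bounded_linear f" shows "smooth_on f S"
proof (rule smooth_onI)
  have d: "(f has_derivative f) (at x)" for x
    by (rule bounded_linear_imp_has_derivative[OF assms])
  show "f differentiable (at x)" for x using d by (auto simp: differentiable_def)
  show "smooth_on (\<lambda>x. dirderiv f x v) S" for v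
    by (simp add: frechet_derivative_at[OF d, symmetric])
qed

lemma smooth_on_compose_bounded_linear:
  assumes L: "bounded_linear L" and S: "open S" and f: "smooth_on f S"
  shows "smooth_on (\<lambda>x. L (f x)) S"
proof -
  \<comment> \<open>Full smoothness of \<open>f\<close> stays the hypothesis and only the order of
    the conclusion is inducted on: directional derivatives of \<open>f\<close> are again smooth, so
    the induction hypothesis applies to them.\<close>
  have "differentiable_times_on n (\<lambda>x. L (f x)) S" if "smooth_on f S" for n and f :: "'c \<Rightarrow> 'a"
    using that
  proof (induction n arbitrary: f)
    case 0
    then show ?case
      by (simp add: bounded_linear.continuous_on[OF L] smooth_on_continuous_on)
  next
    case (Suc n)
    have d: "((\<lambda>x. L (f x)) has_derivative (\<lambda>v. L (dirderiv f x v))) (at x)" if "x \<in> S" for x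
      by (rule bounded_linear.has_derivative[OF L smooth_on_has_derivative[OF Suc.prems that]])
    have "differentiable_times_on n (\<lambda>x. dirderiv (\<lambda>x. L (f x)) x v) S" for v
      by (rule differentiable_times_on_cong[OF S _ Suc.IH[OF smooth_on_dirderiv[OF Suc.prems, of v]]])
        (simp add: dirderivI[OF d])
    with d show ?case by (auto simp: differentiable_def)
  qed
  with f show ?thesis by (simp add: smooth_on_def)
qed

lemma smooth_on_precompose_linear:
  assumes L: "bounded_linear L" and S: "open S" and f: "smooth_on f S"
  shows "smooth_on (\<lambda>x. f (L x)) (L -` S)"
proof -
  have opn: "open (L -` S)"
    by (rule open_vimage[OF S linear_continuous_on[OF L]])
  have "differentiable_times_on n (\<lambda>x. f (L x)) (L -` S)" if "smooth_on f S" for n and f :: "'b \<Rightarrow> 'c"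
    using that
  proof (induction n arbitrary: f)
    case 0
    then show ?case
      using continuous_on_compose2[OF smooth_on_continuous_on[OF 0] linear_continuous_on[OF L], of "L -` S"]
      by auto
  next
    case (Suc n)
    have d: "((\<lambda>x. f (L x)) has_derivative (\<lambda>v. dirderiv f (L x) (L v))) (at x)" if "x \<in> L -` S" for x
      using diff_chain_at[OF bounded_linear_imp_has_derivative[OF L] smooth_on_has_derivative[OF Suc.prems]] that
      by (simp add: o_def)
    have "differentiable_times_on n (\<lambda>x. dirderiv (\<lambda>x. f (L x)) x v) (L -` S)" for v
      by (rule differentiable_times_on_cong[OF opn _ Suc.IH[OF smooth_on_dirderiv[OF Suc.prems, of "L v"]]])
        (simp add: dirderivI[OF d])
    with d show ?case by (auto simp: differentiable_def)
  qed
  with f show ?thesis by (simp add: smooth_on_def)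
qed

lemma smooth_on_add:
  assumes S: "open S" and f: "smooth_on f S" "smooth_on g S"
  shows "smooth_on (\<lambda>x. f x + g x) S"
proof -
  have "differentiable_times_on n (\<lambda>x. f x + g x) S" if "smooth_on f S" "smooth_on g S"
    for n and f g :: "'a \<Rightarrow> 'b"
    using that
  proof (induction n arbitrary: f g)
    case 0
    then show ?case by (simp add: continuous_on_add smooth_on_continuous_on)
  next
    case (Suc n)
    have d: "((\<lambda>x. f x + g x) has_derivative (\<lambda>v. dirderiv f x v + dirderiv g x v)) (at x)" if "x \<in> S" for x
      using Suc.prems that by (intro has_derivative_add smooth_on_has_derivative)
    have "differentiable_times_on n (\<lambda>x. dirderiv (\<lambda>x. f x + g x) x v) S" for v
      by (rule differentiable_times_on_cong[OF S _ Suc.IH[OF Suc.prems[THEN smooth_on_dirderiv, of v]]])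
        (simp add: dirderivI[OF d])
    with d show ?case by (auto simp: differentiable_def)
  qed
  with f show ?thesis by (simp add: smooth_on_def)
qed

lemma smooth_on_mult:
  fixes f g :: "'a::real_normed_vector \<Rightarrow> real"
  assumes S: "open S" and f: "smooth_on f S" "smooth_on g S"
  shows "smooth_on (\<lambda>x. f x * g x) S"
proof -
  \<comment> \<open>Inside the induction the two summands of the product rule are known only to
    order \<open>n\<close>, so additivity is needed order by order.\<close>
  have add: "differentiable_times_on n (\<lambda>x. f x + g x) S"
    if "differentiable_times_on n f S" "differentiable_times_on n g S"
    for n and f g :: "'a \<Rightarrow> real"
    using that
  proof (induction n arbitrary: f g)
    case 0
    then show ?case by (simp add: continuous_on_add)
  next
    case (Suc n)
    have d: "((\<lambda>x. f x + g x) has_derivative (\<lambda>v. dirderiv f x v + dirderiv g x v)) (at x)" if "x \<in> S" for x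
      using Suc.prems that by (intro has_derivative_add has_derivative_dirderiv) auto
    have "differentiable_times_on n (\<lambda>x. dirderiv (\<lambda>x. f x + g x) x v) S" for v
      by (rule differentiable_times_on_cong[OF S _ Suc.IH[of "\<lambda>x. dirderiv f x v" "\<lambda>x. dirderiv g x v"]])
        (use Suc.prems in \<open>auto simp: dirderivI[OF d]\<close>)
    with d show ?case by (auto simp: differentiable_def)
  qed
  have "differentiable_times_on n (\<lambda>x. f x * g x) S" if "smooth_on f S" "smooth_on g S"
    for n and f g :: "'a \<Rightarrow> real"
    using that
  proof (induction n arbitrary: f g)
    case 0
    then show ?case by (simp add: continuous_on_mult smooth_on_continuous_on)
  next
    case (Suc n)
    have d: "((\<lambda>x. f x * g x) has_derivative (\<lambda>v. f x * dirderiv g x v + dirderiv f x v * g x)) (at x)"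
      if "x \<in> S" for x
      using Suc.prems that by (intro has_derivative_mult smooth_on_has_derivative)
    have "differentiable_times_on n (\<lambda>x. dirderiv (\<lambda>x. f x * g x) x v) S" for v
      by (rule differentiable_times_on_cong[OF S _ add[OF
            Suc.IH[OF Suc.prems(1) smooth_on_dirderiv[OF Suc.prems(2), of v]]
            Suc.IH[OF smooth_on_dirderiv[OF Suc.prems(1), of v] Suc.prems(2)]]])
        (simp add: dirderivI[OF d])
    with d show ?case by (auto simp: differentiable_def)
  qed
  with f show ?thesis by (simp add: smooth_on_def)
qed

lemma smooth_on_inverse:
  fixes f :: "'a::real_normed_vector \<Rightarrow> real"
  assumes S: "open S" and f: "smooth_on f S" and nz: "\<And>x. x \<in> S \<Longrightarrow> f x \<noteq> 0"
  shows "smooth_on (\<lambda>x. inverse (f x)) S"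
proof -
  \<comment> \<open>The functions h / f^k form a class closed under differentiation, with derivative
    (h' f - k h f') / f^(k+1); the single function 1 / f does not.\<close>
  define G where "G n \<longleftrightarrow> (\<forall>h. smooth_on h S \<longrightarrow> (\<forall>k. differentiable_times_on n (\<lambda>x. h x * inverse (f x) ^ k) S))" for n
  have "G n" for n
  proof (induction n)
    case 0
    show ?case unfolding G_def using nz
      by (auto intro!: continuous_on_mult continuous_on_power continuous_on_inverse
          intro: smooth_on_continuous_on f)
  next
    case (Suc n)
    show ?case unfolding G_def
    proof (intro allI impI)
      fix h :: "'a \<Rightarrow> real" and k :: nat
      assume h: "smooth_on h S"
      have d: "((\<lambda>x. h x * inverse (f x) ^ k) has_derivative
          (\<lambda>v. (dirderiv h x v * f x + h x * - (real k * dirderiv f x v)) * inverse (f x) ^ Suc k)) (at x)"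
        if x: "x \<in> S" for x
      proof -
        have "((\<lambda>x. h x * inverse (f x) ^ k) has_derivative
          (\<lambda>v. h x * (real k * (- (inverse (f x) * dirderiv f x v * inverse (f x))) * inverse (f x) ^ (k - 1))
            + dirderiv h x v * inverse (f x) ^ k)) (at x)"
          by (intro has_derivative_mult has_derivative_power smooth_on_has_derivative[OF h x]
              Deriv.has_derivative_inverse[where f=f, OF nz[OF x]] smooth_on_has_derivative[OF f x])
        then show ?thesis
          \<comment> \<open>For \<open>k = 0\<close> the truncated exponent \<open>k - 1\<close> is
            multiplied by \<open>real k = 0\<close>.\<close>
          by (rule has_derivative_eq_rhs) (use nz[OF x] in \<open>cases k; simp add: fun_eq_iff field_simps\<close>)
      qed
      have sm: "smooth_on (\<lambda>x. dirderiv h x v * f x + h x * - (real k * dirderiv f x v)) S" for v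
        using smooth_on_add[OF S smooth_on_mult[OF S smooth_on_dirderiv[OF h, of v] f]
            smooth_on_mult[OF S h smooth_on_mult[OF S smooth_on_const[of "- real k"] smooth_on_dirderiv[OF f, of v]]]]
        by simp
      have "differentiable_times_on n (\<lambda>x. dirderiv (\<lambda>x. h x * inverse (f x) ^ k) x v) S" for v
        by (rule differentiable_times_on_cong[OF S _ Suc.IH[unfolded G_def, rule_format, OF sm[of v], of "Suc k"]])
          (simp add: dirderivI[OF d])
      with d show "differentiable_times_on (Suc n) (\<lambda>x. h x * inverse (f x) ^ k) S"
        by (auto simp: differentiable_def)
    qed
  qed
  from this[unfolded G_def, rule_format, of "\<lambda>_. 1" _ 1] show ?thesis
    by (simp add: smooth_on_def)
qed

lemma smooth_on_divide:
  fixes f g :: "'a::real_normed_vector \<Rightarrow> real"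
  assumes "open S" "smooth_on f S" "smooth_on g S" "\<And>x. x \<in> S \<Longrightarrow> g x \<noteq> 0"
  shows "smooth_on (\<lambda>x. f x / g x) S"
  using smooth_on_mult[OF assms(1,2) smooth_on_inverse[OF assms(1,3,4)]]
  by (simp add: divide_inverse)

lemma smooth_on_minus:
  fixes f :: "'a::real_normed_vector \<Rightarrow> 'b::real_normed_vector"
  assumes "open S" "smooth_on f S" shows "smooth_on (\<lambda>x. - f x) S"
  by (rule smooth_on_compose_bounded_linear[OF bounded_linear_minus[OF bounded_linear_ident] assms])

lemma smooth_on_diff:
  assumes "open S" "smooth_on f S" "smooth_on g S" shows "smooth_on (\<lambda>x. f x - g x) S"
  using smooth_on_add[OF assms(1,2) smooth_on_minus[OF assms(1,3)]] by simp

lemma smooth_on_power: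
  fixes f :: "'a::real_normed_vector \<Rightarrow> real"
  assumes "open S" "smooth_on f S" shows "smooth_on (\<lambda>x. f x ^ n) S"
  by (induction n) (auto intro!: smooth_on_mult assms)

lemma smooth_on_sum:
  assumes "open S" "\<And>i. i \<in> I \<Longrightarrow> smooth_on (f i) S"
  shows "smooth_on (\<lambda>x. \<Sum>i\<in>I. f i x) S"
  using assms(2) by (induction I rule: infinite_finite_induct) (auto intro!: smooth_on_add assms(1))

lemma smooth_on_prod:
  fixes f :: "'i \<Rightarrow> 'a::real_normed_vector \<Rightarrow> real"
  assumes "open S" "\<And>i. i \<in> I \<Longrightarrow> smooth_on (f i) S"
  shows "smooth_on (\<lambda>x. \<Prod>i\<in>I. f i x) S"
  using assms(2) by (induction I rule: infinite_finite_induct) (auto intro!: smooth_on_mult assms(1))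

lemma smooth_on_vec:
  fixes f :: "'n::finite \<Rightarrow> 'a::real_normed_vector \<Rightarrow> 'b::euclidean_space"
  assumes S: "open S" and f: "\<And>i. smooth_on (f i) S"
  shows "smooth_on (\<lambda>x. \<chi> i. f i x) S"
proof -
  have "bounded_linear (axis i :: 'b \<Rightarrow> 'b^'n)" for i
    by (intro linear_conv_bounded_linear[THEN iffD1] linearI) (auto simp: axis_def vec_eq_iff)
  then have "smooth_on (\<lambda>x. \<Sum>i\<in>UNIV. axis i (f i x)) S"
    using smooth_on_sum[OF S, of UNIV "\<lambda>i x. axis i (f i x)"]
      smooth_on_compose_bounded_linear[OF _ S f] by blast
  moreover have "(\<Sum>i\<in>UNIV. axis i (f i x)) = (\<chi> i. f i x)" for x
    by (simp add: vec_eq_iff axis_def if_distrib cong: if_cong)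
  ultimately show ?thesis by simp
qed

lemma smooth_on_nth:
  "open S \<Longrightarrow> smooth_on f S \<Longrightarrow> smooth_on (\<lambda>x. f x $ i) S"
  by (rule smooth_on_compose_bounded_linear[OF bounded_linear_vec_nth])

lemma dirderiv_nth:
  assumes "f differentiable (at x)"
  shows "dirderiv (\<lambda>y. f y $ i) x v = dirderiv f x v $ i"
  by (rule dirderivI[OF bounded_linear.has_derivative[OF bounded_linear_vec_nth has_derivative_dirderiv[OF assms]]])

text \<open>Schwarz: a second difference, divided by \<open>s\<^sup>2\<close>, tends to either mixed derivative.\<close>

lemma second_difference_mean_value:
  fixes f :: "'a::real_normed_vector \<Rightarrow> real"
  assumes ball: "ball x r \<subseteq> S"
    and f: "\<And>y. y \<in> S \<Longrightarrow> f differentiable (at y)"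
    and fu: "\<And>y. y \<in> S \<Longrightarrow> (\<lambda>z. dirderiv f z u) differentiable (at y)"
    and s: "0 < s" "s * (norm u + norm v) < r"
  shows "\<exists>y. dist x y \<le> s * (norm u + norm v) \<and>
    f (x + s *\<^sub>R u + s *\<^sub>R v) - f (x + s *\<^sub>R u) - f (x + s *\<^sub>R v) + f x
      = s\<^sup>2 * dirderiv (\<lambda>z. dirderiv f z u) y v"
proof -
  have nrm: "dist x (x + a *\<^sub>R u + b *\<^sub>R v) \<le> s * (norm u + norm v)"
    if "0 \<le> a" "a \<le> s" "0 \<le> b" "b \<le> s" for a b
  proof -
    have "norm (a *\<^sub>R u + b *\<^sub>R v) \<le> a * norm u + b * norm v"
      using norm_triangle_ineq[of "a *\<^sub>R u" "b *\<^sub>R v"] that by simp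
    also have "\<dots> \<le> s * norm u + s * norm v"
      using that by (intro add_mono mult_right_mono) auto
    finally show ?thesis
      by (simp add: dist_commute[of x] dist_norm add.assoc distrib_left del: diff_diff_eq2 minus_add_distrib)
  qed
  then have inS: "x + a *\<^sub>R u + b *\<^sub>R v \<in> S" if "0 \<le> a" "a \<le> s" "0 \<le> b" "b \<le> s" for a b
    using le_less_trans[OF nrm[OF that] s(2)] ball by auto
  \<comment> \<open>The increment of \<open>p\<close> over [0, s] is the second difference. A mean
    value for \<open>p\<close> in direction \<open>u\<close>, then one for \<open>q\<close> in
    direction \<open>v\<close>, each contribute a factor \<open>s\<close>.\<close>
  define p where "p t = f (x + t *\<^sub>R u + s *\<^sub>R v) - f (x + t *\<^sub>R u)" for t
  have dp: "(p has_real_derivative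
      (dirderiv f (x + t *\<^sub>R u + s *\<^sub>R v) u - dirderiv f (x + t *\<^sub>R u) u)) (at t)"
    if t: "0 \<le> t" "t \<le> s" for t
  proof -
    have 1: "x + t *\<^sub>R u + s *\<^sub>R v \<in> S" "x + t *\<^sub>R u \<in> S"
      using inS[of t s] inS[of t 0] t s by auto
    have 2: "((\<lambda>t. x + t *\<^sub>R u + s *\<^sub>R v) has_derivative (\<lambda>h. h *\<^sub>R u)) (at t)"
      "((\<lambda>t. x + t *\<^sub>R u) has_derivative (\<lambda>h. h *\<^sub>R u)) (at t)"
      by (auto intro!: derivative_eq_intros)
    from diff_chain_at[OF 2(1) has_derivative_dirderiv[OF f[OF 1(1)]]]
      diff_chain_at[OF 2(2) has_derivative_dirderiv[OF f[OF 1(2)]]]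
    have "(p has_derivative (\<lambda>h. dirderiv f (x + t *\<^sub>R u + s *\<^sub>R v) (h *\<^sub>R u) -
        dirderiv f (x + t *\<^sub>R u) (h *\<^sub>R u))) (at t)"
      unfolding p_def by (auto simp: o_def intro!: has_derivative_diff)
    moreover have "dirderiv f y (h *\<^sub>R u) = h * dirderiv f y u" if "y \<in> S" for y h
      using linear_scale[OF dirderiv_linear[OF f[OF that]]] by simp
    ultimately show ?thesis
      unfolding has_field_derivative_def
      using 1 by (elim has_derivative_eq_rhs) (simp add: fun_eq_iff algebra_simps)
  qed
  obtain t where t: "0 < t" "t < s" and
    eq1: "p s - p 0 = s * (dirderiv f (x + t *\<^sub>R u + s *\<^sub>R v) u - dirderiv f (x + t *\<^sub>R u) u)"
    using MVT2[OF s(1) dp] by auto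
  define q where "q b = dirderiv f (x + t *\<^sub>R u + b *\<^sub>R v) u" for b
  have dq: "(q has_real_derivative dirderiv (\<lambda>z. dirderiv f z u) (x + t *\<^sub>R u + b *\<^sub>R v) v) (at b)"
    if b: "0 \<le> b" "b \<le> s" for b
  proof -
    have 1: "x + t *\<^sub>R u + b *\<^sub>R v \<in> S" using inS[of t b] t b by auto
    have "((\<lambda>b. x + t *\<^sub>R u + b *\<^sub>R v) has_derivative (\<lambda>h. h *\<^sub>R v)) (at b)"
      by (auto intro!: derivative_eq_intros)
    from diff_chain_at[OF this has_derivative_dirderiv[OF fu[OF 1]]]
    have "(q has_derivative (\<lambda>h. dirderiv (\<lambda>z. dirderiv f z u) (x + t *\<^sub>R u + b *\<^sub>R v) (h *\<^sub>R v))) (at b)"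
      unfolding q_def by (simp add: o_def)
    then show ?thesis
      unfolding has_field_derivative_def
      by (rule has_derivative_eq_rhs)
        (use linear_scale[OF dirderiv_linear[OF fu[OF 1]]] in \<open>simp add: fun_eq_iff mult.commute\<close>)
  qed
  obtain b where b: "0 < b" "b < s" and
    eq2: "q s - q 0 = s * dirderiv (\<lambda>z. dirderiv f z u) (x + t *\<^sub>R u + b *\<^sub>R v) v"
    using MVT2[OF s(1) dq] by auto
  have "p s - p 0 = s\<^sup>2 * dirderiv (\<lambda>z. dirderiv f z u) (x + t *\<^sub>R u + b *\<^sub>R v) v"
    using eq1 eq2 by (simp add: q_def power2_eq_square)
  then show ?thesis
    using nrm[of t b] t b unfolding p_def
    by (intro exI[of _ "x + t *\<^sub>R u + b *\<^sub>R v"]) (auto simp: algebra_simps)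
qed

lemma dirderiv_commute_real:
  fixes f :: "'a::real_normed_vector \<Rightarrow> real"
  assumes S: "open S" "x \<in> S" and f: "smooth_on f S"
  shows "dirderiv (\<lambda>y. dirderiv f y u) x v = dirderiv (\<lambda>y. dirderiv f y v) x u"
proof (rule ccontr)
  let ?P = "\<lambda>y. dirderiv (\<lambda>y. dirderiv f y u) y v"
  let ?Q = "\<lambda>y. dirderiv (\<lambda>y. dirderiv f y v) y u"
  assume ne: "?P x \<noteq> ?Q x"
  define e where "e = \<bar>?P x - ?Q x\<bar> / 2"
  have e: "e > 0" using ne by (simp add: e_def)
  have "continuous_on S ?P" "continuous_on S ?Q"
    by (intro smooth_on_continuous_on smooth_on_dirderiv f)+
  then have "isCont ?P x" "isCont ?Q x"
    using S by (simp_all add: continuous_on_eq_continuous_at)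
  then obtain d1 d2 where d: "d1 > 0" "d2 > 0"
    "\<And>y. dist y x < d1 \<Longrightarrow> \<bar>?P y - ?P x\<bar> < e" "\<And>y. dist y x < d2 \<Longrightarrow> \<bar>?Q y - ?Q x\<bar> < e"
    using e unfolding continuous_at_eps_delta by (metis dist_real_def)
  obtain r where r: "r > 0" "ball x r \<subseteq> S" using S open_contains_ball by blast
  define m where "m = min r (min d1 d2)"
  have m: "m > 0" "m \<le> r" "m \<le> d1" "m \<le> d2" using d r by (auto simp: m_def)
  \<comment> \<open>This scale puts both mean value points within distance \<open>m\<close> of
    \<open>x\<close>; the added 1 keeps the denominator positive when \<open>u\<close> and
    \<open>v\<close> vanish.\<close>
  define s where "s = m / (2 * (norm u + norm v + 1))"
  have s: "s > 0" unfolding s_def using m by (intro divide_pos_pos) (auto simp: add_nonneg_pos)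
  have "norm u + norm v + 1 > 0" by (simp add: add_nonneg_pos)
  then have "s * (norm u + norm v + 1) = m / 2"
    unfolding s_def by (simp add: field_simps)
  moreover have "s * (norm u + norm v) \<le> s * (norm u + norm v + 1)" using s by simp
  ultimately have sm: "s * (norm u + norm v) < m" using m by linarith
  have df: "\<And>y. y \<in> S \<Longrightarrow> f differentiable (at y)"
    "\<And>y u. y \<in> S \<Longrightarrow> (\<lambda>z. dirderiv f z u) differentiable (at y)"
    using f smooth_on_dirderiv smooth_on_differentiable by blast+
  obtain y where y: "dist x y \<le> s * (norm u + norm v)"
    "f (x + s *\<^sub>R u + s *\<^sub>R v) - f (x + s *\<^sub>R u) - f (x + s *\<^sub>R v) + f x = s\<^sup>2 * ?P y"
    using second_difference_mean_value[OF r(2) df s, of u v] sm m by auto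
  obtain z where z: "dist x z \<le> s * (norm v + norm u)"
    "f (x + s *\<^sub>R v + s *\<^sub>R u) - f (x + s *\<^sub>R v) - f (x + s *\<^sub>R u) + f x = s\<^sup>2 * ?Q z"
    using second_difference_mean_value[OF r(2) df s, of v u] sm m by (auto simp: add.commute)
  \<comment> \<open>The second difference is symmetric in \<open>u\<close> and \<open>v\<close>, so
    the two mixed derivatives agree at two nearby points; continuity brings this to
    \<open>x\<close>.\<close>
  have "s\<^sup>2 * ?P y = s\<^sup>2 * ?Q z" using y z by (simp add: algebra_simps)
  then have "?P y = ?Q z" using s by simp
  moreover have "dist y x < d1" "dist z x < d2"
    using y z sm m by (auto simp: dist_commute add.commute)
  ultimately have "\<bar>?P x - ?Q x\<bar> < e + e"
    using d(3)[of y] d(4)[of z] by (intro abs_diff_less_iff[THEN iffD2]) (auto simp: abs_less_iff)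
  then show False unfolding e_def by simp
qed

lemma dirderiv_commute:
  fixes f :: "'a::real_normed_vector \<Rightarrow> real^'n"
  assumes S: "open S" "x \<in> S" and f: "smooth_on f S"
  shows "dirderiv (\<lambda>y. dirderiv f y u) x v = dirderiv (\<lambda>y. dirderiv f y v) x u"
proof -
  have "dirderiv (\<lambda>y. dirderiv f y u) x v $ i = dirderiv (\<lambda>y. dirderiv (\<lambda>z. f z $ i) y u) x v" for i u v
  proof -
    have "dirderiv (\<lambda>y. dirderiv (\<lambda>z. f z $ i) y u) x = dirderiv (\<lambda>y. dirderiv f y u $ i) x"
    proof (rule dirderiv_cong_open(2)[OF S])
      show "dirderiv f y u $ i = dirderiv (\<lambda>z. f z $ i) y u" if "y \<in> S" for y
        using dirderiv_nth[OF smooth_on_differentiable[OF f that]] by simp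
      show "(\<lambda>y. dirderiv f y u $ i) differentiable (at x)"
        by (intro smooth_on_differentiable[OF smooth_on_nth[OF S(1) smooth_on_dirderiv[OF f]] S(2)])
    qed
    then show ?thesis
      using dirderiv_nth[OF smooth_on_differentiable[OF smooth_on_dirderiv[OF f] S(2)]] by simp
  qed
  then show ?thesis
    using dirderiv_commute_real[OF S smooth_on_nth[OF S(1) f]] by (simp add: vec_eq_iff)
qed

section \<open>Levi-Civita connection, curvature and local isometries\<close>

text \<open>Metrics live on the whole space because every affine chart has all of
  \<open>real^3\<close> as its domain; only isometries need a smaller one.\<close>

definition smooth_metric :: "(real^'n \<Rightarrow> real^'n^'n) \<Rightarrow> bool" where
  "smooth_metric G \<longleftrightarrow> smooth_on G UNIV \<and> (\<forall>x i j. G x $ i $ j = G x $ j $ i) \<and>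
     (\<forall>x v. v \<noteq> 0 \<longrightarrow> metric_prod G x v v > 0)"

text \<open>The Christoffel symbols as a vector-valued bilinear map, so that later identities can be
  stated without indices.\<close>

definition connection :: "(real^'n \<Rightarrow> real^'n^'n) \<Rightarrow> real^'n \<Rightarrow> real^'n \<Rightarrow> real^'n \<Rightarrow> real^'n" where
  "connection G x u v = (\<chi> k. \<Sum>i\<in>UNIV. \<Sum>j\<in>UNIV. christoffel G x k i j * u $ i * v $ j)"

definition connection_deriv ::
    "(real^'n \<Rightarrow> real^'n^'n) \<Rightarrow> real^'n \<Rightarrow> real^'n \<Rightarrow> real^'n \<Rightarrow> real^'n \<Rightarrow> real^'n" where
  "connection_deriv G x w u v = dirderiv (\<lambda>y. connection G y u v) x w"

definition metric_deriv ::
    "(real^'n \<Rightarrow> real^'n^'n) \<Rightarrow> real^'n \<Rightarrow> real^'n \<Rightarrow> real^'n \<Rightarrow> real^'n \<Rightarrow> real" where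
  "metric_deriv G x u v w = v \<bullet> (dirderiv G x u *v w)"

text \<open>For constant coordinate fields this is R(w, v) u = D_w D_v u - D_v D_w u, with D the
  covariant derivative. The trace over \<open>w\<close> is then the Ricci tensor with the sign that
  is positive on round spheres.\<close>

definition riemann ::
    "(real^'n \<Rightarrow> real^'n^'n) \<Rightarrow> real^'n \<Rightarrow> real^'n \<Rightarrow> real^'n \<Rightarrow> real^'n \<Rightarrow> real^'n" where
  "riemann G x u v w = connection_deriv G x w u v - connection_deriv G x v u w +
     connection G x w (connection G x u v) - connection G x v (connection G x u w)"

definition ricci :: "(real^'n \<Rightarrow> real^'n^'n) \<Rightarrow> real^'n \<Rightarrow> real^'n \<Rightarrow> real^'n \<Rightarrow> real" where
  "ricci G x u v = trace (matrix (riemann G x u v))"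

definition ricci_matrix :: "(real^'n \<Rightarrow> real^'n^'n) \<Rightarrow> real^'n \<Rightarrow> real^'n^'n" where
  "ricci_matrix G x = (\<chi> i j. ricci G x (axis i 1) (axis j 1))"

definition scalar_curvature :: "(real^'n \<Rightarrow> real^'n^'n) \<Rightarrow> real^'n \<Rightarrow> real" where
  "scalar_curvature G x = trace (matrix_inv (G x) ** ricci_matrix G x)"

lemma matrix_inv_right_inverse:
  "invertible (A :: real^'n^'n) \<Longrightarrow> A ** matrix_inv A = mat 1"
  "invertible A \<Longrightarrow> matrix_inv A ** A = mat 1"
  unfolding invertible_def matrix_inv_def by (metis (mono_tags, lifting) someI_ex)+

lemma matrix_inv_unique:
  assumes "(A :: real^'n^'n) ** B = mat 1" shows "matrix_inv A = B"
proof -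
  have "invertible A" using assms by (meson invertible_right_inverse)
  then have "matrix_inv A ** (A ** B) = B"
    by (simp add: matrix_mul_assoc matrix_inv_right_inverse)
  then show ?thesis by (simp add: assms)
qed

lemma vec_sum_axis: "(x :: real^'n) = (\<Sum>i\<in>UNIV. x $ i *\<^sub>R axis i 1)"
  by (simp add: vec_eq_iff axis_def if_distrib cong: if_cong)

lemma bilinear_sum_axis:
  assumes "bilinear f"
  shows "f u v = (\<Sum>i\<in>UNIV. \<Sum>j\<in>UNIV. (u $ i * v $ j) *\<^sub>R f (axis i 1) (axis j (1::real)))"
proof -
  have "f u v = f (\<Sum>i\<in>UNIV. u $ i *\<^sub>R axis i 1) (\<Sum>j\<in>UNIV. v $ j *\<^sub>R axis j 1)"
    by (simp flip: vec_sum_axis)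
  also have "\<dots> = (\<Sum>i\<in>UNIV. \<Sum>j\<in>UNIV. (u $ i * v $ j) *\<^sub>R f (axis i 1) (axis j 1))"
    by (simp add: bilinear_sum[OF assms] bilinear_lmul[OF assms] bilinear_rmul[OF assms] sum.cartesian_product mult.commute)
  finally show ?thesis .
qed

lemma linear_sum_axis:
  assumes "linear f"
  shows "f u = (\<Sum>i\<in>UNIV. u $ i *\<^sub>R f (axis i (1::real)))"
  by (subst vec_sum_axis[of u], simp add: linear_sum[OF assms] linear_scale[OF assms])

lemma bounded_bilinear_matrix_vector_mult:
  "bounded_bilinear ((*v) :: real^'n^'m \<Rightarrow> real^'n \<Rightarrow> real^'m)"
  unfolding bilinear_conv_bounded_bilinear[symmetric] bilinear_def
  by (auto intro!: linearI simp: matrix_vector_mult_add_rdistrib matrix_vector_right_distrib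
      scaleR_matrix_vector_assoc matrix_vector_mult_scaleR)

section \<open>Koszul formula and curvature of a single metric\<close>

context
  fixes G :: "real^'n \<Rightarrow> real^'n^'n"
  assumes G: "smooth_metric G"
begin

lemma metric_smooth: "smooth_on G UNIV" using G by (simp add: smooth_metric_def)

lemma metric_entry_commute: "G x $ i $ j = G x $ j $ i"
  using G by (simp add: smooth_metric_def)

lemma metric_pos: "v \<noteq> 0 \<Longrightarrow> metric_prod G x v v > 0"
  using G by (simp add: smooth_metric_def)

lemma metric_transpose: "transpose (G x) = G x"
  by (simp add: vec_eq_iff transpose_def metric_entry_commute)

lemma metric_prod_commute: "metric_prod G x v w = metric_prod G x w v"
  unfolding metric_prod_def
  by (metis dot_lmul_matrix inner_commute metric_transpose transpose_matrix_vector)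

lemma metric_nondegenerate:
  assumes "\<And>w. metric_prod G x v w = metric_prod G x v' w" shows "v = v'"
proof -
  have "metric_prod G x (v - v') (v - v') = 0"
    using assms[of "v - v'"] by (simp add: metric_prod_def inner_diff_left)
  then show ?thesis using metric_pos[of "v - v'" x] by force
qed

lemma metric_invertible: "invertible (G x)"
proof -
  have "v = 0" if "G x *v v = 0" for v
    using metric_pos[of v x] that by (force simp: metric_prod_def)
  then show ?thesis
    by (simp add: invertible_left_inverse matrix_left_invertible_ker)
qed

text \<open>Cramer's rule: the entries of the inverse are quotients of determinants of smooth
  entries.\<close>

lemma smooth_matrix_inv: "smooth_on (\<lambda>x. matrix_inv (G x) $ k $ l) UNIV"
proof -
  have entry: "smooth_on (\<lambda>x. G x $ i $ j) UNIV" for i j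
    by (intro smooth_on_nth open_UNIV metric_smooth)
  have det: "smooth_on (\<lambda>x. det (A x)) UNIV" if "\<And>i j. smooth_on (\<lambda>x. A x $ i $ j) UNIV"
    for A :: "real^'n \<Rightarrow> real^'n^'n"
    unfolding det_def
    by (rule smooth_on_sum[OF open_UNIV], rule smooth_on_mult[OF open_UNIV smooth_on_const],
        rule smooth_on_prod[OF open_UNIV that])
  have nz: "det (G x) \<noteq> 0" for x using metric_invertible invertible_det_nz by blast
  have "matrix_inv (G x) $ k $ l = det (\<chi> i j. if j = k then axis l 1 $ i else G x $ i $ j) / det (G x)" for x
  proof -
    have "G x *v (matrix_inv (G x) *v axis l 1) = axis l 1"
      by (simp add: matrix_vector_mul_assoc matrix_inv_right_inverse metric_invertible)
    from this[unfolded cramer[OF nz]]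
    have "(matrix_inv (G x) *v axis l 1) $ k = det (\<chi> i j. if j = k then axis l 1 $ i else G x $ i $ j) / det (G x)"
      by simp
    then show ?thesis by (simp add: matrix_vector_mult_basis column_def)
  qed
  moreover have "smooth_on (\<lambda>x. if j = k then axis l 1 $ i else G x $ i $ j) UNIV" for i j
    by (cases "j = k") (simp_all add: entry)
  ultimately show ?thesis
    by (simp only:) (intro smooth_on_divide open_UNIV det nz; simp add: entry)
qed

lemma partial_metric_entry: "partial i (\<lambda>y. G y $ j $ l) x = dirderiv G x (axis i 1) $ j $ l"
proof -
  have 1: "(\<lambda>y. G y $ j) differentiable (at x)" "G differentiable (at x)"
    using smooth_on_differentiable[OF smooth_on_nth[OF open_UNIV metric_smooth] UNIV_I]
      smooth_on_differentiable[OF metric_smooth UNIV_I] by auto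
  show ?thesis
    unfolding partial_def dirderiv_nth[OF 1(1)] dirderiv_nth[OF 1(2)] ..
qed

lemma christoffel_commute: "christoffel G x k i j = christoffel G x k j i"
  unfolding christoffel_def by (simp add: metric_entry_commute[of _ i j] algebra_simps)

lemma smooth_christoffel: "smooth_on (\<lambda>x. christoffel G x k i j) UNIV"
  unfolding christoffel_def partial_def
  by (intro smooth_on_sum smooth_on_mult smooth_on_add smooth_on_diff smooth_on_const smooth_matrix_inv
      smooth_on_dirderiv smooth_on_nth open_UNIV metric_smooth)

lemma smooth_connection: "smooth_on (\<lambda>x. connection G x u v) UNIV"
  unfolding connection_def
  by (intro smooth_on_vec smooth_on_sum smooth_on_mult smooth_on_const smooth_christoffel open_UNIV)

lemma connection_commute: "connection G x u v = connection G x v u"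
  unfolding connection_def vec_eq_iff
  by (subst sum.swap) (simp add: christoffel_commute mult_ac)

lemma bilinear_connection: "bilinear (connection G x)"
  unfolding bilinear_def
  by (intro conjI allI linearI; simp add: connection_def vec_eq_iff algebra_simps sum.distrib sum_distrib_left)

lemma connection_deriv_sum_axis:
  "connection_deriv G x w u v =
    (\<Sum>i\<in>UNIV. \<Sum>j\<in>UNIV. (u $ i * v $ j) *\<^sub>R connection_deriv G x w (axis i 1) (axis j 1))"
  unfolding connection_deriv_def
proof (rule dirderivI)
  have "((\<lambda>y. \<Sum>i\<in>UNIV. \<Sum>j\<in>UNIV. (u $ i * v $ j) *\<^sub>R connection G y (axis i 1) (axis j 1)) has_derivative
     (\<lambda>w. \<Sum>i\<in>UNIV. \<Sum>j\<in>UNIV. (u $ i * v $ j) *\<^sub>R dirderiv (\<lambda>y. connection G y (axis i 1) (axis j 1)) x w)) (at x)"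
    by (intro has_derivative_sum has_derivative_scaleR_right smooth_on_has_derivative[OF smooth_connection UNIV_I])
  then show "((\<lambda>y. connection G y u v) has_derivative (\<lambda>w. \<Sum>i\<in>UNIV. \<Sum>j\<in>UNIV.
      (u $ i * v $ j) *\<^sub>R dirderiv (\<lambda>y. connection G y (axis i 1) (axis j 1)) x w)) (at x)"
    by (simp flip: bilinear_sum_axis[OF bilinear_connection])
qed

lemma bilinear_connection_deriv: "bilinear (connection_deriv G x w)"
proof -
  define f where "f i j = connection_deriv G x w (axis i 1) (axis j 1)" for i j
  have "connection_deriv G x w = (\<lambda>u v. \<Sum>i\<in>UNIV. \<Sum>j\<in>UNIV. (u $ i * v $ j) *\<^sub>R f i j)"
    unfolding f_def by (intro ext connection_deriv_sum_axis)
  then show ?thesis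
    unfolding bilinear_def by (auto intro!: linearI simp: algebra_simps sum.distrib scaleR_sum_right)
qed

lemma linear_connection_deriv: "linear (\<lambda>w. connection_deriv G x w u v)"
  unfolding connection_deriv_def
  by (rule dirderiv_linear[OF smooth_on_differentiable[OF smooth_connection UNIV_I]])

text \<open>Base point and both arguments move; expansion in the standard basis reduces this to
  scalar product rules. It is applied to \<open>f\<close> and its differentials when the Hessian
  relation of an isometry is differentiated.\<close>

lemma has_derivative_connection:
  assumes p: "(p has_derivative p') (at x)" and a: "(a has_derivative a') (at x)"
    and b: "(b has_derivative b') (at x)"
  shows "((\<lambda>y. connection G (p y) (a y) (b y)) has_derivative
    (\<lambda>w. connection_deriv G (p x) (p' w) (a x) (b x) + connection G (p x) (a' w) (b x)
      + connection G (p x) (a x) (b' w))) (at x)"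
proof -
  note nth = bounded_linear.has_derivative[OF bounded_linear_vec_nth]
  have c: "((\<lambda>y. connection G (p y) (axis i 1) (axis j 1)) has_derivative
      (\<lambda>w. connection_deriv G (p x) (p' w) (axis i 1) (axis j 1))) (at x)" for i j
    using diff_chain_at[OF p smooth_on_has_derivative[OF smooth_connection UNIV_I]]
    by (simp add: o_def connection_deriv_def)
  have "((\<lambda>y. \<Sum>i\<in>UNIV. \<Sum>j\<in>UNIV. (a y $ i * b y $ j) *\<^sub>R connection G (p y) (axis i 1) (axis j 1))
     has_derivative (\<lambda>w. \<Sum>i\<in>UNIV. \<Sum>j\<in>UNIV.
       (a x $ i * b x $ j) *\<^sub>R connection_deriv G (p x) (p' w) (axis i 1) (axis j 1) +
       (a x $ i * b' w $ j + a' w $ i * b x $ j) *\<^sub>R connection G (p x) (axis i 1) (axis j 1))) (at x)"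
    by (intro has_derivative_sum has_derivative_scaleR has_derivative_mult nth a b c)
  also have "(\<lambda>y. \<Sum>i\<in>UNIV. \<Sum>j\<in>UNIV. (a y $ i * b y $ j) *\<^sub>R connection G (p y) (axis i 1) (axis j 1))
    = (\<lambda>y. connection G (p y) (a y) (b y))"
    by (intro ext bilinear_sum_axis[OF bilinear_connection, symmetric])
  finally show ?thesis
  proof (rule has_derivative_eq_rhs, intro ext)
    fix w
    let ?c = "\<lambda>i j. connection G (p x) (axis i 1) (axis j 1)"
    show "(\<Sum>i\<in>UNIV. \<Sum>j\<in>UNIV.
       (a x $ i * b x $ j) *\<^sub>R connection_deriv G (p x) (p' w) (axis i 1) (axis j 1) +
       (a x $ i * b' w $ j + a' w $ i * b x $ j) *\<^sub>R ?c i j) =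
     connection_deriv G (p x) (p' w) (a x) (b x) + connection G (p x) (a' w) (b x)
      + connection G (p x) (a x) (b' w)"
      unfolding connection_deriv_sum_axis[of _ _ "a x" "b x"]
        bilinear_sum_axis[OF bilinear_connection, of _ "a' w" "b x"]
        bilinear_sum_axis[OF bilinear_connection, of _ "a x" "b' w"]
      by (simp add: sum.distrib scaleR_add_left)
  qed
qed

lemma connection_koszul:
  "2 * metric_prod G x (connection G x u v) w =
     metric_deriv G x u v w + metric_deriv G x v u w - metric_deriv G x w u v"
proof -
  let ?D = "\<lambda>i j l. dirderiv G x (axis i 1) $ j $ l"
  have lin: "linear (dirderiv G x)"
    by (rule dirderiv_linear[OF smooth_on_differentiable[OF metric_smooth UNIV_I]])
  have dirent: "dirderiv G x u $ j $ l = (\<Sum>i\<in>UNIV. u $ i * ?D i j l)" for u j l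
    by (subst linear_sum_axis[OF lin]) simp
  \<comment> \<open>The Christoffel symbols of the first kind, contracted with \<open>u\<close> and
    \<open>v\<close>: lowering the index of the connection removes the inverse matrix.\<close>
  define c where "c = (\<chi> l. \<Sum>i\<in>UNIV. \<Sum>j\<in>UNIV. (?D i j l + ?D j i l - ?D l i j) * u $ i * v $ j / 2)"
  have "connection G x u v = matrix_inv (G x) *v c"
  proof -
    define T where "T k i j l = matrix_inv (G x) $ k $ l * ((?D i j l + ?D j i l - ?D l i j) * u $ i * v $ j / 2)"
      for k i j l
    have "connection G x u v $ k = (\<Sum>i\<in>UNIV. \<Sum>j\<in>UNIV. \<Sum>l\<in>UNIV. T k i j l)" for k
      unfolding connection_def christoffel_def partial_metric_entry T_def
      by (simp add: sum_distrib_left sum_distrib_right algebra_simps add_divide_distrib diff_divide_distrib)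
    also have "(\<Sum>i\<in>UNIV. \<Sum>j\<in>UNIV. \<Sum>l\<in>UNIV. T k i j l) = (\<Sum>i\<in>UNIV. \<Sum>l\<in>UNIV. \<Sum>j\<in>UNIV. T k i j l)" for k
      by (rule sum.cong[OF refl], rule sum.swap)
    also have "\<And>k. (\<Sum>i\<in>UNIV. \<Sum>l\<in>UNIV. \<Sum>j\<in>UNIV. T k i j l) = (\<Sum>l\<in>UNIV. \<Sum>i\<in>UNIV. \<Sum>j\<in>UNIV. T k i j l)"
      by (rule sum.swap)
    finally show ?thesis
      unfolding vec_eq_iff by (simp add: matrix_vector_mult_def c_def T_def sum_distrib_left)
  qed
  then have "G x *v connection G x u v = c"
    by (simp add: matrix_vector_mul_assoc matrix_inv_right_inverse metric_invertible)
  then have "metric_prod G x w (connection G x u v) = w \<bullet> c" by (simp add: metric_prod_def)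
  then have 1: "2 * metric_prod G x (connection G x u v) w = 2 * (w \<bullet> c)"
    using metric_prod_commute by metis
  have "2 * (w \<bullet> c) = (\<Sum>l\<in>UNIV. \<Sum>i\<in>UNIV. \<Sum>j\<in>UNIV. ?D i j l * u $ i * v $ j * w $ l) +
      (\<Sum>l\<in>UNIV. \<Sum>i\<in>UNIV. \<Sum>j\<in>UNIV. ?D j i l * u $ i * v $ j * w $ l) -
      (\<Sum>l\<in>UNIV. \<Sum>i\<in>UNIV. \<Sum>j\<in>UNIV. ?D l i j * u $ i * v $ j * w $ l)"
    unfolding c_def inner_vec_def
    by (simp add: sum_distrib_left flip: sum.distrib sum_subtractf) (simp add: algebra_simps)
  moreover have "metric_deriv G x u v w = (\<Sum>l\<in>UNIV. \<Sum>i\<in>UNIV. \<Sum>j\<in>UNIV. ?D i j l * u $ i * v $ j * w $ l)"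
    for u v w
  proof -
    have "metric_deriv G x u v w = (\<Sum>j\<in>UNIV. \<Sum>l\<in>UNIV. \<Sum>i\<in>UNIV. ?D i j l * u $ i * v $ j * w $ l)"
      unfolding metric_deriv_def inner_vec_def matrix_vector_mult_def dirent[of u]
      by (simp add: sum_distrib_left sum_distrib_right mult_ac)
    also have "\<dots> = (\<Sum>l\<in>UNIV. \<Sum>j\<in>UNIV. \<Sum>i\<in>UNIV. ?D i j l * u $ i * v $ j * w $ l)"
      by (rule sum.swap)
    also have "\<dots> = (\<Sum>l\<in>UNIV. \<Sum>i\<in>UNIV. \<Sum>j\<in>UNIV. ?D i j l * u $ i * v $ j * w $ l)"
      by (rule sum.cong[OF refl], rule sum.swap)
    finally show ?thesis .
  qed
  note md = this
  moreover have "(\<Sum>l\<in>UNIV. \<Sum>i\<in>UNIV. \<Sum>j\<in>UNIV. ?D j i l * u $ i * v $ j * w $ l) = metric_deriv G x v u w"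
    unfolding md by (rule sum.cong[OF refl], subst sum.swap) (simp add: mult_ac)
  moreover have "(\<Sum>l\<in>UNIV. \<Sum>i\<in>UNIV. \<Sum>j\<in>UNIV. ?D l i j * u $ i * v $ j * w $ l) = metric_deriv G x w u v"
  proof -
    have "metric_deriv G x w u v = (\<Sum>i\<in>UNIV. \<Sum>j\<in>UNIV. \<Sum>l\<in>UNIV. ?D l i j * u $ i * v $ j * w $ l)"
      unfolding metric_deriv_def inner_vec_def matrix_vector_mult_def dirent[of w]
      by (simp add: sum_distrib_left sum_distrib_right mult_ac)
    also have "\<dots> = (\<Sum>i\<in>UNIV. \<Sum>l\<in>UNIV. \<Sum>j\<in>UNIV. ?D l i j * u $ i * v $ j * w $ l)"
      by (rule sum.cong[OF refl], rule sum.swap)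
    also have "\<dots> = (\<Sum>l\<in>UNIV. \<Sum>i\<in>UNIV. \<Sum>j\<in>UNIV. ?D l i j * u $ i * v $ j * w $ l)"
      by (rule sum.swap)
    finally show ?thesis ..
  qed
  ultimately show ?thesis using 1 by simp
qed

text \<open>Koszul's formula and nondegeneracy determine the connection, so a guessed expression can
  be verified without inverting the metric.\<close>

lemma connection_unique:
  assumes "\<And>w. 2 * metric_prod G x z w =
     metric_deriv G x u v w + metric_deriv G x v u w - metric_deriv G x w u v"
  shows "connection G x u v = z"
proof (rule metric_nondegenerate)
  show "metric_prod G x (connection G x u v) w = metric_prod G x z w" for w
    using connection_koszul[of x u v w] assms[of w] by simp
qed

lemma has_derivative_metric_prod:
  assumes p: "(p has_derivative p') (at x)" and a: "(a has_derivative a') (at x)"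
    and b: "(b has_derivative b') (at x)"
  shows "((\<lambda>y. metric_prod G (p y) (a y) (b y)) has_derivative
    (\<lambda>w. metric_deriv G (p x) (p' w) (a x) (b x) + metric_prod G (p x) (a' w) (b x)
      + metric_prod G (p x) (a x) (b' w))) (at x)"
proof -
  have "((\<lambda>y. G (p y)) has_derivative (\<lambda>w. dirderiv G (p x) (p' w))) (at x)"
    using diff_chain_at[OF p smooth_on_has_derivative[OF metric_smooth UNIV_I]] by (simp add: o_def)
  from has_derivative_inner[OF a bounded_bilinear.FDERIV[OF bounded_bilinear_matrix_vector_mult this b]]
  show ?thesis
    unfolding metric_prod_def metric_deriv_def
    by (rule has_derivative_eq_rhs) (simp add: fun_eq_iff inner_add_right)
qed

lemma linear_riemann: "linear (riemann G x u v)"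
  by (rule linearI) (simp_all add: riemann_def
      linear_add[OF linear_connection_deriv] linear_scale[OF linear_connection_deriv]
      bilinear_radd[OF bilinear_connection_deriv] bilinear_rmul[OF bilinear_connection_deriv]
      bilinear_radd[OF bilinear_connection] bilinear_rmul[OF bilinear_connection]
      bilinear_ladd[OF bilinear_connection] bilinear_lmul[OF bilinear_connection] algebra_simps)

lemma bilinear_ricci: "bilinear (ricci G x)"
proof -
  have 1: "bilinear (\<lambda>u v. riemann G x u v w)" for w
    unfolding bilinear_def
    by (intro conjI allI linearI; simp add: riemann_def
      linear_add[OF linear_connection_deriv] linear_scale[OF linear_connection_deriv]
      bilinear_radd[OF bilinear_connection_deriv] bilinear_rmul[OF bilinear_connection_deriv]
      bilinear_ladd[OF bilinear_connection_deriv] bilinear_lmul[OF bilinear_connection_deriv]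
      bilinear_radd[OF bilinear_connection] bilinear_rmul[OF bilinear_connection]
      bilinear_ladd[OF bilinear_connection] bilinear_lmul[OF bilinear_connection] algebra_simps)
  show ?thesis unfolding bilinear_def
    by (intro conjI allI linearI; simp add: ricci_def trace_def matrix_def
        bilinear_ladd[OF 1] bilinear_radd[OF 1] bilinear_lmul[OF 1] bilinear_rmul[OF 1]
        sum.distrib sum_distrib_left)
qed

end

section \<open>Local isometries transport the connection, the curvature and the Ricci tensor\<close>

definition local_isometry ::
    "(real^'n \<Rightarrow> real^'n^'n) \<Rightarrow> (real^'n \<Rightarrow> real^'n^'n) \<Rightarrow> (real^'n \<Rightarrow> real^'n) \<Rightarrow> (real^'n) set \<Rightarrow> bool" where
  "local_isometry G H f U \<longleftrightarrow> open U \<and> smooth_on f U \<and>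
     (\<forall>x\<in>U. \<forall>v w. metric_prod H (f x) (dirderiv f x v) (dirderiv f x w) = metric_prod G x v w)"

lemma local_isometry_subset:
  "local_isometry G H f U \<Longrightarrow> V \<subseteq> U \<Longrightarrow> open V \<Longrightarrow> local_isometry G H f V"
  unfolding local_isometry_def using smooth_on_subset by blast

context
  fixes G H :: "real^'n \<Rightarrow> real^'n^'n" and f :: "real^'n \<Rightarrow> real^'n" and U :: "(real^'n) set"
  assumes G: "smooth_metric G" and H: "smooth_metric H" and f: "local_isometry G H f U"
begin

lemma isom_open: "open U" and isom_smooth: "smooth_on f U"
  and isom_metric: "x \<in> U \<Longrightarrow> metric_prod H (f x) (dirderiv f x v) (dirderiv f x w) = metric_prod G x v w"
  using f by (auto simp: local_isometry_def)

lemma isom_linear: "x \<in> U \<Longrightarrow> linear (dirderiv f x)"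
  by (intro dirderiv_linear smooth_on_differentiable[OF isom_smooth])

lemma isom_inj: assumes x: "x \<in> U" shows "inj (dirderiv f x)"
proof -
  have "v = 0" if "dirderiv f x v = 0" for v
    using isom_metric[OF x, of v v] metric_pos[OF G, of v x] that by (force simp: metric_prod_def)
  then show ?thesis using isom_linear[OF x] by (simp add: linear_injective_0)
qed

lemma isom_surj: "x \<in> U \<Longrightarrow> surj (dirderiv f x)"
  by (intro linear_inj_imp_surj isom_linear isom_inj)

lemma isom_dirderiv_commute:
  "x \<in> U \<Longrightarrow> dirderiv (\<lambda>y. dirderiv f y u) x v = dirderiv (\<lambda>y. dirderiv f y v) x u"
  by (rule dirderiv_commute[OF isom_open _ isom_smooth])

lemma isom_has_derivative_dirderiv:
  "x \<in> U \<Longrightarrow> ((\<lambda>y. dirderiv f y v) has_derivative dirderiv (\<lambda>y. dirderiv f y v) x) (at x)"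
  by (rule smooth_on_has_derivative[OF smooth_on_dirderiv[OF isom_smooth]])

text \<open>Differentiating the isometry relation and comparing Koszul formulas.\<close>

lemma isom_hessian:
  assumes x: "x \<in> U"
  shows "dirderiv (\<lambda>y. dirderiv f y u) x v =
    dirderiv f x (connection G x u v) - connection H (f x) (dirderiv f x u) (dirderiv f x v)"
proof -
  let ?d = "dirderiv f x" and ?Q = "\<lambda>u v. dirderiv (\<lambda>y. dirderiv f y v) x u"
  have eq: "metric_deriv H (f x) (?d u) (?d v) (?d w) + metric_prod H (f x) (?Q u v) (?d w)
      + metric_prod H (f x) (?d v) (?Q u w) = metric_deriv G x u v w" for u v w
  proof -
    have 1: "((\<lambda>y. metric_prod G y v w) has_derivative (\<lambda>u. metric_deriv G x u v w)) (at x)"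
      using has_derivative_metric_prod[OF G has_derivative_ident has_derivative_const[of v] has_derivative_const[of w]]
      by (simp add: metric_prod_def)
    have "((\<lambda>y. metric_prod H (f y) (dirderiv f y v) (dirderiv f y w)) has_derivative
        (\<lambda>u. metric_deriv H (f x) (?d u) (?d v) (?d w) + metric_prod H (f x) (?Q u v) (?d w)
        + metric_prod H (f x) (?d v) (?Q u w))) (at x)"
      by (rule has_derivative_metric_prod[OF H smooth_on_has_derivative[OF isom_smooth x]
            isom_has_derivative_dirderiv[OF x] isom_has_derivative_dirderiv[OF x]])
    then have "((\<lambda>y. metric_prod G y v w) has_derivative
        (\<lambda>u. metric_deriv H (f x) (?d u) (?d v) (?d w) + metric_prod H (f x) (?Q u v) (?d w)
        + metric_prod H (f x) (?d v) (?Q u w))) (at x)"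
      by (rule has_derivative_transform_within_open[OF _ isom_open x]) (simp add: isom_metric)
    from has_derivative_unique[OF this 1] show ?thesis by metis
  qed
  have "?Q v u = ?d (connection G x u v) - connection H (f x) (?d u) (?d v)"
  proof (rule metric_nondegenerate[OF H])
    fix w'
    obtain w where w: "w' = ?d w" using isom_surj[OF x] by (metis surjD)
    have "metric_prod G x (connection G x u v) w = metric_prod H (f x) (?d (connection G x u v)) w'"
      by (simp add: isom_metric[OF x] w)
    \<comment> \<open>In \<open>eq\<close> for (u, v, w) plus (v, u, w) minus (w, u, v), symmetry of
      the Hessian cancels four of the six Hessian terms and leaves two equal ones.\<close>
    moreover have "2 * metric_prod H (f x) (?Q v u) w'
        = 2 * metric_prod G x (connection G x u v) w - 2 * metric_prod H (f x) (connection H (f x) (?d u) (?d v)) w'"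
      using eq[of u v w] eq[of v u w] eq[of w u v]
      unfolding connection_koszul[OF G] connection_koszul[OF H] w
      by (simp add: isom_dirderiv_commute[OF x, of u v] isom_dirderiv_commute[OF x, of w v]
          isom_dirderiv_commute[OF x, of w u] metric_prod_commute[OF H])
    ultimately show "metric_prod H (f x) (?Q v u) w' =
        metric_prod H (f x) (?d (connection G x u v) - connection H (f x) (?d u) (?d v)) w'"
      by (simp add: metric_prod_def inner_diff_left)
  qed
  then show ?thesis .
qed

lemma isom_has_derivative_app:
  assumes x: "x \<in> U" and c: "(c has_derivative c') (at x)"
  shows "((\<lambda>y. dirderiv f y (c y)) has_derivative
     (\<lambda>w. dirderiv (\<lambda>y. dirderiv f y (c x)) x w + dirderiv f x (c' w))) (at x)"
proof -
  note nth = bounded_linear.has_derivative[OF bounded_linear_vec_nth]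
  let ?Q = "\<lambda>c w. dirderiv (\<lambda>y. dirderiv f y c) x w"
  \<comment> \<open>Symmetry of second derivatives turns the dependence on \<open>c\<close> into
    that of a derivative on its direction, which is linear.\<close>
  have lin: "linear (\<lambda>c. ?Q c w)" for w
    using isom_dirderiv_commute[OF x, of _ w]
      dirderiv_linear[OF smooth_on_differentiable[OF smooth_on_dirderiv[OF isom_smooth] x]] by simp
  have 1: "?Q (c x) w = (\<Sum>k\<in>UNIV. c x $ k *\<^sub>R ?Q (axis k 1) w)" for w
    by (rule linear_sum_axis[OF lin])
  have "((\<lambda>y. \<Sum>k\<in>UNIV. c y $ k *\<^sub>R dirderiv f y (axis k 1)) has_derivative
     (\<lambda>w. \<Sum>k\<in>UNIV. c x $ k *\<^sub>R ?Q (axis k 1) w + c' w $ k *\<^sub>R dirderiv f x (axis k 1))) (at x)"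
    by (intro has_derivative_sum has_derivative_scaleR nth c isom_has_derivative_dirderiv[OF x])
  then have "((\<lambda>y. \<Sum>k\<in>UNIV. c y $ k *\<^sub>R dirderiv f y (axis k 1)) has_derivative
     (\<lambda>w. ?Q (c x) w + dirderiv f x (c' w))) (at x)"
    by (rule has_derivative_eq_rhs)
      (simp add: fun_eq_iff sum.distrib 1 linear_sum_axis[OF isom_linear[OF x], of "c' _"])
  then show ?thesis
    by (rule has_derivative_transform_within_open[OF _ isom_open x])
      (rule linear_sum_axis[OF isom_linear, symmetric])
qed

text \<open>The Ricci identity: antisymmetrize the derivative of the Hessian relation.\<close>

lemma isom_riemann:
  assumes x: "x \<in> U"
  shows "riemann H (f x) (dirderiv f x u) (dirderiv f x v) (dirderiv f x w) = dirderiv f x (riemann G x u v w)"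
proof -
  let ?d = "dirderiv f x" and ?C = "connection H (f x)" and ?E = "connection_deriv H (f x)"
  let ?S = "\<lambda>u v. ?d (connection G x u v) - ?C (?d u) (?d v)"
  note rad = bilinear_radd[OF bilinear_connection[OF H]] and lad = bilinear_ladd[OF bilinear_connection[OF H]]
    and rsub = bilinear_rsub[OF bilinear_connection[OF H]] and lsub = bilinear_lsub[OF bilinear_connection[OF H]]
    and cc = connection_commute[OF H]
  have third: "dirderiv (\<lambda>y. dirderiv (\<lambda>z. dirderiv f z u) y v) x w =
      ?S (connection G x u v) w + ?d (connection_deriv G x w u v)
      - (?E (?d w) (?d u) (?d v) + ?C (?S u w) (?d v) + ?C (?d u) (?S v w))" for u v w
  proof (rule dirderivI)
    have cG: "((\<lambda>y. connection G y u v) has_derivative (\<lambda>w. connection_deriv G x w u v)) (at x)"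
      unfolding connection_deriv_def by (rule smooth_on_has_derivative[OF smooth_connection[OF G] UNIV_I])
    have "((\<lambda>y. dirderiv f y (connection G y u v) - connection H (f y) (dirderiv f y u) (dirderiv f y v))
      has_derivative (\<lambda>w. (?S (connection G x u v) w + ?d (connection_deriv G x w u v))
        - (?E (?d w) (?d u) (?d v) + ?C (?S u w) (?d v) + ?C (?d u) (?S v w)))) (at x)"
      using has_derivative_diff[OF isom_has_derivative_app[OF x cG]
        has_derivative_connection[OF H smooth_on_has_derivative[OF isom_smooth x]
         isom_has_derivative_dirderiv[OF x, of u] isom_has_derivative_dirderiv[OF x, of v]]]
      unfolding isom_hessian[OF x] .
    then show "((\<lambda>y. dirderiv (\<lambda>z. dirderiv f z u) y v)
      has_derivative (\<lambda>w. ?S (connection G x u v) w + ?d (connection_deriv G x w u v)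
        - (?E (?d w) (?d u) (?d v) + ?C (?S u w) (?d v) + ?C (?d u) (?S v w)))) (at x)"
      by (rule has_derivative_transform_within_open[OF _ isom_open x]) (simp add: isom_hessian)
  qed
  \<comment> \<open>The third derivative is symmetric in \<open>v\<close> and \<open>w\<close> by
    the Schwarz theorem for the first derivative of \<open>f\<close>. Equating the two forms of
    \<open>third\<close> cancels everything symmetric and leaves one curvature on each side.\<close>
  have "dirderiv (\<lambda>y. dirderiv (\<lambda>z. dirderiv f z u) y v) x w = dirderiv (\<lambda>y. dirderiv (\<lambda>z. dirderiv f z u) y w) x v"
    by (rule dirderiv_commute[OF isom_open x smooth_on_dirderiv[OF isom_smooth]])
  then have "?d (connection_deriv G x w u v - connection_deriv G x v u w +
      connection G x w (connection G x u v) - connection G x v (connection G x u w)) =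
     ?E (?d w) (?d u) (?d v) - ?E (?d v) (?d u) (?d w)
     + ?C (?d w) (?C (?d u) (?d v)) - ?C (?d v) (?C (?d u) (?d w))"
    unfolding third
    by (simp add: linear_add[OF isom_linear[OF x]] linear_diff[OF isom_linear[OF x]] rsub lsub
        connection_commute[OF G] cc algebra_simps)
  then show ?thesis unfolding riemann_def by simp
qed

lemma isom_matrix_inverse:
  assumes x: "x \<in> U"
  obtains N where "matrix (dirderiv f x) ** N = mat 1" "N ** matrix (dirderiv f x) = mat 1"
proof -
  have "invertible (matrix (dirderiv f x))"
    unfolding matrix_invertible[OF isom_linear[OF x]]
    using linear_injective_isomorphism[OF isom_linear[OF x] isom_inj[OF x]] by (auto simp: fun_eq_iff)
  then show ?thesis using that by (auto simp: invertible_def)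
qed

text \<open>The two curvature endomorphisms are conjugate by the differential, and the trace is
  invariant under conjugation.\<close>

lemma isom_ricci:
  assumes x: "x \<in> U"
  shows "ricci H (f x) (dirderiv f x u) (dirderiv f x v) = ricci G x u v"
proof -
  let ?M = "matrix (dirderiv f x)"
  obtain N where N: "?M ** N = mat 1" "N ** ?M = mat 1" using isom_matrix_inverse[OF x] .
  let ?A = "matrix (riemann G x u v)" and ?B = "matrix (riemann H (f x) (dirderiv f x u) (dirderiv f x v))"
  have "?B ** ?M = matrix (riemann H (f x) (dirderiv f x u) (dirderiv f x v) \<circ> dirderiv f x)"
    by (rule matrix_compose[OF isom_linear[OF x] linear_riemann[OF H], symmetric])
  also have "\<dots> = matrix (dirderiv f x \<circ> riemann G x u v)"
    by (rule arg_cong[of _ _ matrix]) (simp add: fun_eq_iff isom_riemann[OF x])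
  also have "\<dots> = ?M ** ?A"
    by (rule matrix_compose[OF linear_riemann[OF G] isom_linear[OF x]])
  finally have BM: "?B ** ?M = ?M ** ?A" .
  have "trace ?B = trace (?B ** (?M ** N))" by (simp add: N)
  also have "\<dots> = trace (?M ** (?A ** N))" by (simp add: matrix_mul_assoc BM)
  also have "\<dots> = trace ((?A ** N) ** ?M)" by (rule trace_mul_sym)
  also have "\<dots> = trace ?A" by (simp add: N flip: matrix_mul_assoc)
  finally show ?thesis by (simp add: ricci_def)
qed

text \<open>Metric and Ricci tensor are pulled back by one and the same matrix, so the eigenvalues
  of Ricci relative to the metric are invariants.\<close>

lemma isom_pullback:
  assumes x: "x \<in> U"
  shows "transpose (matrix (dirderiv f x)) ** H (f x) ** matrix (dirderiv f x) = G x"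
    "transpose (matrix (dirderiv f x)) ** ricci_matrix H (f x) ** matrix (dirderiv f x) = ricci_matrix G x"
proof -
  let ?M = "matrix (dirderiv f x)"
  have bil: "(transpose ?M ** A ** ?M) $ i $ j = dirderiv f x (axis i 1) \<bullet> (A *v dirderiv f x (axis j 1))" for A i j
  proof -
    have "B $ i $ j = axis i 1 \<bullet> (B *v axis j 1)" for B :: "real^'n^'n"
      by (simp add: inner_axis' matrix_vector_mult_basis column_def)
    then have "(transpose ?M ** A ** ?M) $ i $ j = axis i 1 \<bullet> (transpose ?M *v (A *v (?M *v axis j 1)))"
      by (simp add: matrix_mul_assoc flip: matrix_vector_mul_assoc)
    also have "\<dots> = (?M *v axis i 1) \<bullet> (A *v (?M *v axis j 1))"
      by (metis dot_lmul_matrix inner_commute transpose_matrix_vector transpose_transpose)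
    finally show ?thesis by (simp add: matrix_vector_mul(2)[OF isom_linear[OF x]])
  qed
  show "transpose ?M ** H (f x) ** ?M = G x"
    using isom_metric[OF x]
    by (simp add: vec_eq_iff bil metric_prod_def inner_axis' matrix_vector_mult_basis column_def)
  have "u \<bullet> (ricci_matrix H (f x) *v v) = ricci H (f x) u v" for u v
    by (subst bilinear_sum_axis[OF bilinear_ricci[OF H]])
      (simp add: ricci_matrix_def inner_vec_def matrix_vector_mult_def sum_distrib_left algebra_simps)
  then show "transpose ?M ** ricci_matrix H (f x) ** ?M = ricci_matrix G x"
    by (simp add: vec_eq_iff bil isom_ricci[OF x] ricci_matrix_def)
qed

text \<open>The inverse metric transforms with the inverse of the differential, hence inverse metric
  times Ricci changes by conjugation and keeps its trace.\<close>

lemma isom_scalar_curvature: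
  assumes x: "x \<in> U"
  shows "scalar_curvature H (f x) = scalar_curvature G x"
proof -
  let ?M = "matrix (dirderiv f x)" and ?I = "matrix_inv (H (f x))" and ?R = "ricci_matrix H (f x)"
  obtain N where N: "?M ** N = mat 1" "N ** ?M = mat 1" using isom_matrix_inverse[OF x] .
  have tN: "transpose ?M ** transpose N = mat 1" "transpose N ** transpose ?M = mat 1"
    by (simp_all add: N flip: matrix_transpose_mul)
  have "G x ** (N ** ?I ** transpose N) = transpose ?M ** H (f x) ** (?M ** N) ** ?I ** transpose N"
    by (simp add: matrix_mul_assoc flip: isom_pullback(1)[OF x])
  also have "\<dots> = transpose ?M ** (H (f x) ** ?I) ** transpose N"
    by (simp add: N matrix_mul_assoc)
  also have "\<dots> = mat 1"
    by (simp add: matrix_inv_right_inverse metric_invertible[OF H] tN)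
  finally have "matrix_inv (G x) = N ** ?I ** transpose N" by (rule matrix_inv_unique)
  then have "matrix_inv (G x) ** ricci_matrix G x = N ** ?I ** (transpose N ** transpose ?M) ** ?R ** ?M"
    by (simp add: matrix_mul_assoc flip: isom_pullback(2)[OF x])
  then have "scalar_curvature G x = trace (N ** (?I ** ?R ** ?M))"
    by (simp add: scalar_curvature_def tN matrix_mul_assoc)
  also have "\<dots> = trace (?I ** ?R ** (?M ** N))"
    by (subst trace_mul_sym) (simp add: matrix_mul_assoc)
  finally show ?thesis by (simp add: N scalar_curvature_def)
qed

end

section \<open>Rigidity\<close>

text \<open>Gronwall on a small ball: at a maximum point m of the norm of \<open>w\<close>, the mean
  value inequality bounds that maximum by \<open>C * r\<close> times itself, and
  \<open>C * r < 1\<close> makes it 0.\<close>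

lemma derivative_bound_imp_zero:
  fixes w :: "'a::euclidean_space \<Rightarrow> 'b::real_normed_vector"
  assumes r: "r > 0" "C * r < 1" and C: "C \<ge> 0"
    and w: "\<And>x. x \<in> cball a r \<Longrightarrow> (w has_derivative w' x) (at x)"
    and bound: "\<And>x v. x \<in> cball a r \<Longrightarrow> norm (w' x v) \<le> C * norm (w x) * norm v"
    and a: "w a = 0" and x: "x \<in> cball a r"
  shows "w x = 0"
proof -
  have "continuous_on (cball a r) w"
    using w by (auto intro!: continuous_at_imp_continuous_on has_derivative_continuous)
  then have "continuous_on (cball a r) (\<lambda>x. norm (w x))" by (rule continuous_on_norm)
  then obtain m where m: "m \<in> cball a r" "\<And>y. y \<in> cball a r \<Longrightarrow> norm (w y) \<le> norm (w m)"
    using continuous_attains_sup[of "cball a r" "\<lambda>x. norm (w x)"] r by auto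
  have on: "onorm (w' y) \<le> C * norm (w m)" if y: "y \<in> cball a r" for y
  proof (rule onorm_le)
    fix v
    have "norm (w' y v) \<le> C * norm (w y) * norm v" by (rule bound[OF y])
    also have "\<dots> \<le> C * norm (w m) * norm v"
      by (intro mult_right_mono mult_left_mono m y C) auto
    finally show "norm (w' y v) \<le> C * norm (w m) * norm v" .
  qed
  have "norm (w m - w a) \<le> C * norm (w m) * norm (m - a)"
  proof (rule differentiable_bound[OF convex_cball _ _ m(1)])
    show "(w has_derivative w' y) (at y within cball a r)" if "y \<in> cball a r" for y
      using w[OF that] by (rule has_derivative_at_withinI)
  qed (use on r in auto)
  also have "\<dots> \<le> C * norm (w m) * r"
    using m(1) C by (intro mult_left_mono) (auto simp: dist_norm norm_minus_commute)
  finally have "norm (w m) * (1 - C * r) \<le> 0" by (simp add: a algebra_simps)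
  then have "norm (w m) \<le> 0" using r by (simp add: mult_le_0_iff)
  then show ?thesis using m(2)[OF x] by simp
qed

lemma norm_linear_sum_axis_le:
  fixes f :: "real^'n \<Rightarrow> 'b::real_normed_vector"
  assumes "linear f" shows "norm (f v) \<le> (\<Sum>k\<in>UNIV. norm (f (axis k 1))) * norm v"
proof -
  have "norm (f v) \<le> (\<Sum>k\<in>UNIV. norm (v $ k *\<^sub>R f (axis k 1)))"
    unfolding linear_sum_axis[OF assms, of v] by (rule norm_sum)
  also have "\<dots> \<le> (\<Sum>k\<in>UNIV. norm v * norm (f (axis k 1)))"
    by (intro sum_mono) (simp add: mult_right_mono component_le_norm_cart)
  finally show ?thesis by (simp add: sum_distrib_left mult.commute)
qed

lemma norm_bilinear_sum_axis_le:
  fixes f :: "real^'n \<Rightarrow> real^'m \<Rightarrow> 'b::real_normed_vector"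
  assumes "bilinear f"
  shows "norm (f u v) \<le> (\<Sum>i\<in>UNIV. \<Sum>j\<in>UNIV. norm (f (axis i 1) (axis j 1))) * norm u * norm v"
proof -
  have "norm (f u v) \<le> (\<Sum>i\<in>UNIV. \<Sum>j\<in>UNIV. norm ((u $ i * v $ j) *\<^sub>R f (axis i 1) (axis j 1)))"
    unfolding bilinear_sum_axis[OF assms, of u v]
    by (rule order_trans[OF norm_sum sum_mono]) (rule norm_sum)
  also have "\<dots> \<le> (\<Sum>i\<in>UNIV. \<Sum>j\<in>UNIV. norm u * norm v * norm (f (axis i 1) (axis j 1)))"
    by (intro sum_mono) (simp add: abs_mult mult_right_mono mult_mono component_le_norm_cart)
  finally show ?thesis by (simp add: sum_distrib_left mult_ac)
qed

lemma compact_bound: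
  fixes f :: "'a::topological_space \<Rightarrow> real"
  assumes "compact K" "continuous_on K f"
  obtains A where "A \<ge> 0" "\<And>x. x \<in> K \<Longrightarrow> f x \<le> A"
proof -
  have "bounded (f ` K)" by (intro compact_imp_bounded compact_continuous_image assms)
  then obtain A where "\<And>x. x \<in> K \<Longrightarrow> \<bar>f x\<bar> \<le> A" by (auto simp: bounded_iff)
  then show ?thesis using that[of "\<bar>A\<bar>"] by fastforce
qed

lemma dirderiv_bound:
  fixes f :: "real^'n \<Rightarrow> 'b::real_normed_vector"
  assumes f: "smooth_on f U" and K: "compact K" "K \<subseteq> U"
  obtains B where "B \<ge> 0" "\<And>x v. x \<in> K \<Longrightarrow> norm (dirderiv f x v) \<le> B * norm v"
proof -
  have "continuous_on K (\<lambda>x. \<Sum>k\<in>UNIV. norm (dirderiv f x (axis k 1)))"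
    by (intro continuous_on_sum continuous_on_norm smooth_on_continuous_on[OF smooth_on_dirderiv]
        smooth_on_subset[OF f K(2)])
  then obtain B where B: "B \<ge> 0" "\<And>x. x \<in> K \<Longrightarrow> (\<Sum>k\<in>UNIV. norm (dirderiv f x (axis k 1))) \<le> B"
    using compact_bound[OF K(1)] by blast
  have "norm (dirderiv f x v) \<le> B * norm v" if x: "x \<in> K" for x v
  proof -
    have "f differentiable (at x)" using smooth_on_differentiable[OF f] x K by auto
    from norm_linear_sum_axis_le[OF dirderiv_linear[OF this]] show ?thesis
      by (rule order_trans) (simp add: mult_right_mono B(2)[OF x])
  qed
  then show ?thesis using that B by blast
qed

lemma smooth_on_lipschitz:
  fixes f :: "real^'n \<Rightarrow> 'b::real_normed_vector"
  assumes f: "smooth_on f UNIV" and K: "compact K" "convex K"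
  obtains L where "L \<ge> 0" "\<And>x y. x \<in> K \<Longrightarrow> y \<in> K \<Longrightarrow> norm (f x - f y) \<le> L * norm (x - y)"
proof -
  obtain L where L: "L \<ge> 0" "\<And>x v. x \<in> K \<Longrightarrow> norm (dirderiv f x v) \<le> L * norm v"
    using dirderiv_bound[OF f K(1)] by blast
  have "norm (f x - f y) \<le> L * norm (x - y)" if "x \<in> K" "y \<in> K" for x y
  proof (rule differentiable_bound[OF K(2) _ _ that])
    show "(f has_derivative dirderiv f z) (at z within K)" for z
      by (rule has_derivative_at_withinI[OF smooth_on_has_derivative[OF f UNIV_I]])
    show "onorm (dirderiv f z) \<le> L" if "z \<in> K" for z
      using L that by (intro onorm_le) auto
  qed
  then show ?thesis using that L by blast
qed

lemma connection_bound:
  assumes G: "smooth_metric G" and K: "compact K"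
  obtains A where "A \<ge> 0" "\<And>x u v. x \<in> K \<Longrightarrow> norm (connection G x u v) \<le> A * norm u * norm v"
proof -
  have "continuous_on K (\<lambda>x. \<Sum>i\<in>UNIV. \<Sum>j\<in>UNIV. norm (connection G x (axis i 1) (axis j 1)))"
    by (intro continuous_on_sum continuous_on_norm smooth_on_continuous_on
        smooth_on_subset[OF smooth_connection[OF G] subset_UNIV])
  then obtain A where A: "A \<ge> 0"
    "\<And>x. x \<in> K \<Longrightarrow> (\<Sum>i\<in>UNIV. \<Sum>j\<in>UNIV. norm (connection G x (axis i 1) (axis j 1))) \<le> A"
    using compact_bound[OF K] by blast
  have "norm (connection G x u v) \<le> A * norm u * norm v" if x: "x \<in> K" for x u v
    using norm_bilinear_sum_axis_le[OF bilinear_connection[OF G]]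
    by (rule order_trans) (simp add: mult_right_mono A(2)[OF x])
  then show ?thesis using that A by blast
qed

lemma connection_lipschitz:
  assumes G: "smooth_metric G" and K: "compact K" "convex K"
  obtains L where "L \<ge> 0" "\<And>x y u v. x \<in> K \<Longrightarrow> y \<in> K \<Longrightarrow>
    norm (connection G x u v - connection G y u v) \<le> L * norm (x - y) * norm u * norm v"
proof -
  have "\<exists>L\<ge>0. \<forall>x\<in>K. \<forall>y\<in>K. norm (connection G x u v - connection G y u v) \<le> L * norm (x - y)" for u v
    using smooth_on_lipschitz[OF smooth_connection[OF G] K] by metis
  then obtain L where L: "\<And>u v. L u v \<ge> 0"
    "\<And>u v x y. x \<in> K \<Longrightarrow> y \<in> K \<Longrightarrow> norm (connection G x u v - connection G y u v) \<le> L u v * norm (x - y)"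
    by metis
  define M where "M = (\<Sum>i\<in>UNIV. \<Sum>j\<in>UNIV. L (axis i 1) (axis j 1))"
  have "norm (connection G x u v - connection G y u v) \<le> M * norm (x - y) * norm u * norm v"
    if "x \<in> K" "y \<in> K" for x y u v
  proof -
    have "bilinear (\<lambda>u v. connection G x u v - connection G y u v)"
      using bilinear_connection[OF G] unfolding bilinear_def by (auto intro: linear_compose_sub)
    from norm_bilinear_sum_axis_le[OF this]
    have "norm (connection G x u v - connection G y u v) \<le> (\<Sum>i\<in>UNIV. \<Sum>j\<in>UNIV.
       norm (connection G x (axis i 1) (axis j 1) - connection G y (axis i 1) (axis j 1))) * norm u * norm v" .
    also have "\<dots> \<le> (\<Sum>i\<in>UNIV. \<Sum>j\<in>UNIV. L (axis i 1) (axis j 1) * norm (x - y)) * norm u * norm v"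
      by (intro mult_right_mono sum_mono L that) auto
    finally show ?thesis by (simp add: M_def sum_distrib_right)
  qed
  moreover have "M \<ge> 0" unfolding M_def by (intro sum_nonneg L)
  ultimately show ?thesis using that by blast
qed

text \<open>\<open>isom_hessian\<close> expresses second derivatives through the 1-jet. So the pair
  \<open>w\<close> of \<open>f - h\<close> and the difference of the differentials satisfies a bound
  of its derivative by a constant times itself, and it vanishes at \<open>a\<close>.\<close>

lemma isom_eq_near:
  fixes G H :: "real^'n \<Rightarrow> real^'n^'n"
  assumes G: "smooth_metric G" and H: "smooth_metric H"
    and f: "local_isometry G H f U" and h: "local_isometry G H h U"
    and a: "a \<in> U" "f a = h a" "dirderiv f a = dirderiv h a"
  obtains r where "r > 0" "ball a r \<subseteq> U" "\<And>y. y \<in> ball a r \<Longrightarrow> f y = h y"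
proof -
  have U: "open U" and sf: "smooth_on f U" and sh: "smooth_on h U"
    using f h by (auto simp: local_isometry_def)
  have "isCont f a" "isCont h a"
    using smooth_on_continuous_on[OF sf] smooth_on_continuous_on[OF sh] U a
    by (auto simp: continuous_on_eq_continuous_at)
  then have "\<forall>\<^sub>F y in nhds a. dist (f y) (f a) < 1" "\<forall>\<^sub>F y in nhds a. dist (h y) (h a) < 1"
    by (auto simp: continuous_at_eps_delta eventually_nhds_metric)
  moreover have "\<forall>\<^sub>F y in nhds a. y \<in> U" using U a by (simp add: eventually_nhds_in_open)
  ultimately have "\<forall>\<^sub>F y in nhds a. y \<in> U \<and> dist (f y) (f a) < 1 \<and> dist (h y) (h a) < 1"
    by eventually_elim simp
  then obtain e where e: "e > 0" "\<And>y. dist y a < e \<Longrightarrow> y \<in> U \<and> dist (f y) (f a) < 1 \<and> dist (h y) (h a) < 1"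
    unfolding eventually_nhds_metric by blast
  define R where "R = cball a (e / 2)"
  \<comment> \<open>A ball containing the values of both maps on \<open>R\<close>; its convexity is
    what the Lipschitz bound between \<open>f y\<close> and \<open>h y\<close> requires.\<close>
  define K where "K = cball (f a) 1"
  have R: "compact R" "R \<subseteq> U" using e by (auto simp: R_def dist_commute)
  have K: "compact K" "convex K" by (auto simp: K_def)
  have inK: "f y \<in> K" "h y \<in> K" if "y \<in> R" for y
    using e(2)[of y] that e(1) a by (auto simp: R_def K_def dist_commute)
  obtain A1 where A1: "A1 \<ge> 0" "\<And>x u v. x \<in> R \<Longrightarrow> norm (connection G x u v) \<le> A1 * norm u * norm v"
    using connection_bound[OF G R(1)] by blast
  obtain A2 where A2: "A2 \<ge> 0" "\<And>x u v. x \<in> K \<Longrightarrow> norm (connection H x u v) \<le> A2 * norm u * norm v"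
    using connection_bound[OF H K(1)] by blast
  obtain L where L: "L \<ge> 0" "\<And>x y u v. x \<in> K \<Longrightarrow> y \<in> K \<Longrightarrow>
      norm (connection H x u v - connection H y u v) \<le> L * norm (x - y) * norm u * norm v"
    using connection_lipschitz[OF H K] by blast
  obtain B1 where B1: "B1 \<ge> 0" "\<And>x v. x \<in> R \<Longrightarrow> norm (dirderiv f x v) \<le> B1 * norm v"
    using dirderiv_bound[OF sf R] by blast
  obtain B2 where B2: "B2 \<ge> 0" "\<And>x v. x \<in> R \<Longrightarrow> norm (dirderiv h x v) \<le> B2 * norm v"
    using dirderiv_bound[OF sh R] by blast
  define E where "E y c = dirderiv f y c - dirderiv h y c" for y c
  define w where "w y = (f y - h y, \<chi> k. E y (axis k 1))" for y
  define Q where "Q y k v = dirderiv (\<lambda>z. dirderiv f z (axis k 1)) y v - dirderiv (\<lambda>z. dirderiv h z (axis k 1)) y v"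
    for y and k :: 'n and v
  define w' where "w' y v = (E y v, \<chi> k. Q y k v)" for y v
  define n where "n = real CARD('n)"
  \<comment> \<open>The leading \<open>n\<close> bounds the derivative \<open>E\<close> of
    \<open>f - h\<close>; in the second term \<open>n\<close> counts the columns of the differential
    and the bracket bounds one column derivative \<open>Q\<close>.\<close>
  define C where "C = n + n * (n * A1 + L * B1 * B1 + A2 * B1 + A2 * B2 * n)"
  have n: "n \<ge> 0" by (simp add: n_def)
  have C: "C \<ge> 0" unfolding C_def using n A1(1) A2(1) L(1) B1(1) B2(1) by simp
  have w1: "norm (f y - h y) \<le> norm (w y)" "norm (E y (axis k 1)) \<le> norm (w y)" for y k
  proof -
    show "norm (f y - h y) \<le> norm (w y)" unfolding w_def by (metis norm_fst_le fst_conv)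
    have "norm (E y (axis k 1)) \<le> norm (\<chi> k. E y (axis k 1))"
      using Finite_Cartesian_Product.norm_nth_le[of "\<chi> k. E y (axis k 1)" k] by simp
    also have "\<dots> \<le> norm (w y)" unfolding w_def by (metis norm_snd_le snd_conv)
    finally show "norm (E y (axis k 1)) \<le> norm (w y)" .
  qed
  have linE: "linear (E y)" if "y \<in> R" for y
    unfolding E_def using that R
    by (intro linear_compose_sub dirderiv_linear smooth_on_differentiable[OF sf] smooth_on_differentiable[OF sh]) auto
  have E: "norm (E y c) \<le> n * norm (w y) * norm c" if "y \<in> R" for y c
  proof -
    have "(\<Sum>k\<in>UNIV. norm (E y (axis k 1))) \<le> n * norm (w y)"
      unfolding n_def using sum_bounded_above[of UNIV "\<lambda>k. norm (E y (axis k 1))" "norm (w y)"] w1 by simp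
    with norm_linear_sum_axis_le[OF linE[OF that], of c] show ?thesis
      by (meson mult_right_mono norm_ge_zero order_trans)
  qed
  have Q: "norm (Q y k v) \<le> (n * A1 + L * B1 * B1 + A2 * B1 + A2 * B2 * n) * norm (w y) * norm v"
    if y: "y \<in> R" for y k v
  proof -
    have yU: "y \<in> U" using y R by auto
    let ?e = "axis k 1 :: real^'n"
    have norm_diff4: "norm (a - b - c - d) \<le> norm a + norm b + norm c + norm d" for a b c d :: "real^'n"
      by (intro order_trans[OF norm_triangle_ineq4] add_right_mono norm_triangle_ineq4)
    \<comment> \<open>Telescoping: the base point of the connection of \<open>H\<close> is changed
      first, then its first argument, then its second, so each summand contains exactly one
      difference controlled by \<open>w\<close>.\<close>
    have "Q y k v = E y (connection G y ?e v)
      - (connection H (f y) (dirderiv f y ?e) (dirderiv f y v) - connection H (h y) (dirderiv f y ?e) (dirderiv f y v))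
      - connection H (h y) (E y ?e) (dirderiv f y v) - connection H (h y) (dirderiv h y ?e) (E y v)"
      unfolding Q_def isom_hessian[OF G H f yU] isom_hessian[OF G H h yU] E_def
      by (simp add: bilinear_lsub[OF bilinear_connection[OF H]] bilinear_rsub[OF bilinear_connection[OF H]])
    also have "norm \<dots> \<le> n * norm (w y) * (A1 * norm ?e * norm v)
       + L * norm (w y) * (B1 * norm ?e) * (B1 * norm v)
       + A2 * norm (w y) * (B1 * norm v) + A2 * (B2 * norm ?e) * (n * norm (w y) * norm v)"
    proof (rule order_trans[OF norm_diff4], intro add_mono)
      show "norm (E y (connection G y ?e v)) \<le> n * norm (w y) * (A1 * norm ?e * norm v)"
        by (rule order_trans[OF E[OF y]]) (intro mult_left_mono A1 y mult_nonneg_nonneg n norm_ge_zero)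
      show "norm (connection H (f y) (dirderiv f y ?e) (dirderiv f y v) - connection H (h y) (dirderiv f y ?e) (dirderiv f y v))
         \<le> L * norm (w y) * (B1 * norm ?e) * (B1 * norm v)"
        by (rule order_trans[OF L(2)[OF inK[OF y]]])
          (intro mult_mono mult_nonneg_nonneg L B1 y w1 order_refl norm_ge_zero)
      show "norm (connection H (h y) (E y ?e) (dirderiv f y v)) \<le> A2 * norm (w y) * (B1 * norm v)"
        by (rule order_trans[OF A2(2)[OF inK(2)[OF y]]])
          (intro mult_mono mult_nonneg_nonneg A2 B1 y w1 order_refl norm_ge_zero)
      show "norm (connection H (h y) (dirderiv h y ?e) (E y v)) \<le> A2 * (B2 * norm ?e) * (n * norm (w y) * norm v)"
        by (rule order_trans[OF A2(2)[OF inK(2)[OF y]]])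
          (intro mult_mono mult_nonneg_nonneg A2 B2 y E order_refl norm_ge_zero)
    qed
    finally show ?thesis by (simp add: algebra_simps)
  qed
  have dw: "(w has_derivative w' y) (at y)" if y: "y \<in> R" for y
  proof -
    have yU: "y \<in> U" using y R by auto
    have "((\<lambda>y. \<chi> k. E y (axis k 1)) has_derivative (\<lambda>v. \<chi> k. Q y k v)) (at y)"
      unfolding has_derivative_componentwise_within[of "\<lambda>y. \<chi> k. E y (axis k 1)"]
    proof
      fix b :: "real^'n^'n" assume "b \<in> Basis"
      then obtain k c where b: "b = axis k c" by (auto simp: Basis_vec_def)
      have "((\<lambda>x. E x (axis k 1)) has_derivative Q y k) (at y)"
        unfolding E_def Q_def
        by (intro has_derivative_diff isom_has_derivative_dirderiv[OF G H f yU] isom_has_derivative_dirderiv[OF G H h yU])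
      from has_derivative_inner_left[OF this, of c]
      show "((\<lambda>x. (\<chi> k. E x (axis k 1)) \<bullet> b) has_derivative (\<lambda>x. (\<chi> k. Q y k x) \<bullet> b)) (at y)"
        by (simp add: b inner_axis)
    qed
    moreover have "((\<lambda>y. f y - h y) has_derivative E y) (at y)"
      unfolding E_def by (intro has_derivative_diff smooth_on_has_derivative[OF sf yU] smooth_on_has_derivative[OF sh yU])
    ultimately show ?thesis
      unfolding w_def w'_def by (intro has_derivative_Pair)
  qed
  have bound: "norm (w' y v) \<le> C * norm (w y) * norm v" if y: "y \<in> R" for y v
  proof -
    let ?q = "n * A1 + L * B1 * B1 + A2 * B1 + A2 * B2 * n"
    have "norm (\<chi> k. Q y k v) \<le> (\<Sum>k\<in>UNIV. norm (Q y k v))"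
      using L2_set_le_sum[of UNIV "\<lambda>k. norm (Q y k v)"] by (simp add: norm_vec_def)
    also have "\<dots> \<le> n * (?q * norm (w y) * norm v)"
      unfolding n_def[symmetric] using sum_bounded_above[of UNIV "\<lambda>k. norm (Q y k v)", OF Q[OF y]] by (simp add: n_def)
    finally have "norm (\<chi> k. Q y k v) \<le> n * (?q * norm (w y) * norm v)" .
    then have "norm (w' y v) \<le> n * norm (w y) * norm v + n * (?q * norm (w y) * norm v)"
      unfolding w'_def using norm_Pair_le[of "E y v" "\<chi> k. Q y k v"] E[OF y, of v] by linarith
    then show ?thesis by (simp add: C_def algebra_simps)
  qed
  \<comment> \<open>Taking 1 / (C + 1) instead of 1 / C gives \<open>C * r < 1\<close> also when
    \<open>C\<close> is 0.\<close>
  define r where "r = min (e / 2) (1 / (C + 1))"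
  have r: "r > 0" "r \<le> e / 2" using e C by (auto simp: r_def)
  have "C * r \<le> C * (1 / (C + 1))" using C by (intro mult_left_mono) (auto simp: r_def)
  also have "\<dots> < 1" using C by (simp add: field_simps)
  finally have Cr: "C * r < 1" .
  have rR: "cball a r \<subseteq> R" using r by (auto simp: R_def)
  have w0: "w a = 0" using a by (simp add: w_def E_def zero_prod_def vec_eq_iff)
  have "w y = 0" if "y \<in> cball a r" for y
    by (rule derivative_bound_imp_zero[where w=w and w'=w' and a=a and C=C and r=r, OF r(1) Cr C _ _ w0 that]) (use dw bound rR in auto)
  then have "f y = h y" if "y \<in> ball a r" for y
    using that ball_subset_cball[of a r] by (auto simp: w_def zero_prod_def)
  moreover have "ball a r \<subseteq> U" using rR R ball_subset_cball[of a r] by blast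
  ultimately show ?thesis using that r by blast
qed

section \<open>The metric\<close>

text \<open>A Pluecker coordinate of the bivector spanned by \<open>p\<close> and \<open>v\<close>;
  a form built from these depends on \<open>v\<close> only modulo \<open>p\<close>.\<close>

definition minor2 :: "4 \<Rightarrow> 4 \<Rightarrow> real^4 \<Rightarrow> real^4 \<Rightarrow> real" where
  "minor2 i j p v = p $ i * v $ j - p $ j * v $ i"

text \<open>
  \<open>R p v w p\<close> for a diagonal curvature tensor \<open>R\<close>.  The weights 1, 2, 3 are distinct to rule out
  rotational symmetry.
\<close>

definition killing_form :: "real^4 \<Rightarrow> real^4 \<Rightarrow> real^4 \<Rightarrow> real" where
  "killing_form p v w =
     minor2 1 2 p v * minor2 1 2 p w + minor2 1 3 p v * minor2 1 3 p w + minor2 1 4 p v * minor2 1 4 p w +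
     minor2 2 3 p v * minor2 2 3 p w + 2 * (minor2 2 4 p v * minor2 2 4 p w) + 3 * (minor2 3 4 p v * minor2 3 4 p w)"

text \<open>\<open>killing_form\<close> is quadratic in the base point, so its polarization is its
  derivative at \<open>p\<close> in direction \<open>q\<close>.\<close>

definition killing_polar :: "real^4 \<Rightarrow> real^4 \<Rightarrow> real^4 \<Rightarrow> real^4 \<Rightarrow> real" where
  "killing_polar p q v w = killing_form (p + q) v w - killing_form p v w - killing_form q v w"

text \<open>For a unit vector \<open>p\<close>, the determinant of \<open>killing_form p\<close> on the orthogonal complement of \<open>p\<close>.\<close>

definition killing_disc :: "real^4 \<Rightarrow> real" where
  "killing_disc p = (p$1)^4 + (p$1)^2 * (3 * (p$2)^2 + 4 * (p$3)^2 + 5 * (p$4)^2)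
     + 2 * (p$2)^4 + 3 * (p$3)^4 + 6 * (p$4)^4
     + 5 * (p$2)^2 * (p$3)^2 + 8 * (p$2)^2 * (p$4)^2 + 9 * (p$3)^2 * (p$4)^2"

text \<open>Numerator and denominator both acquire the factor c^4 when \<open>p\<close>,
  \<open>v\<close> and \<open>w\<close> are scaled by c, so the quotient is a metric on the space of
  lines.\<close>

definition equator_metric :: metric_tensor where
  "equator_metric p v w = killing_form p v w / killing_disc p"

lemma killing_disc_pos: "p \<noteq> 0 \<Longrightarrow> killing_disc p > 0"
proof -
  assume "p \<noteq> 0"
  then have "p$1 \<noteq> 0 \<or> p$2 \<noteq> 0 \<or> p$3 \<noteq> 0 \<or> p$4 \<noteq> 0" by (simp add: vec_eq_iff forall_4)
  moreover have "killing_disc p \<ge> (p$1)^4 + 2 * (p$2)^4 + 3 * (p$3)^4 + 6 * (p$4)^4"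
    by (simp add: killing_disc_def add_nonneg_nonneg)
  moreover have "(p$k)^4 \<ge> 0" "p $ k \<noteq> 0 \<Longrightarrow> (p$k)^4 > 0" for k by (auto simp: zero_less_power_eq)
  ultimately show ?thesis by (smt (verit))
qed

lemma minor2_linear: "minor2 i j p (v + w) = minor2 i j p v + minor2 i j p w"
  "minor2 i j p (c *\<^sub>R v) = c * minor2 i j p v"
  "minor2 i j (p + q) v = minor2 i j p v + minor2 i j q v"
  "minor2 i j (c *\<^sub>R p) v = c * minor2 i j p v"
  "minor2 i j p p = 0"
  by (simp_all add: minor2_def algebra_simps)

lemma bilinear_killing_form: "bilinear (killing_form p)"
  unfolding bilinear_def
  by (intro conjI allI linearI; simp add: killing_form_def minor2_linear algebra_simps)

lemma killing_form_commute: "killing_form p v w = killing_form p w v"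
  by (simp add: killing_form_def mult.commute)

lemma killing_form_scale: "killing_form (c *\<^sub>R p) v w = c\<^sup>2 * killing_form p v w"
  by (simp add: killing_form_def minor2_linear power2_eq_square algebra_simps)

text \<open>Multiples of \<open>p\<close> have vanishing minors. This discards the radial part that
  appears when a chart is normalized to the sphere, and allows vectors to be moved along
  \<open>p\<close> at will.\<close>

lemma killing_form_shift:
  "killing_form p (c *\<^sub>R v + s *\<^sub>R p) (c *\<^sub>R w + t *\<^sub>R p) = c\<^sup>2 * killing_form p v w"
  by (simp add: killing_form_def minor2_linear power2_eq_square algebra_simps)

lemma killing_disc_scale: "killing_disc (c *\<^sub>R p) = c^4 * killing_disc p"
  by (simp add: killing_disc_def power_mult_distrib algebra_simps)

text \<open>The form is a positive combination of the squared 2 by 2 minors of \<open>p\<close> and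
  \<open>v\<close>, and these all vanish only for parallel vectors.\<close>

lemma killing_form_pos:
  assumes p: "p \<noteq> 0" and v: "\<And>c. v \<noteq> c *\<^sub>R p" shows "killing_form p v v > 0"
proof (rule ccontr)
  assume "\<not> ?thesis"
  then have "minor2 1 2 p v ^ 2 + minor2 1 3 p v ^ 2 + minor2 1 4 p v ^ 2 +
     minor2 2 3 p v ^ 2 + 2 * minor2 2 4 p v ^ 2 + 3 * minor2 3 4 p v ^ 2 \<le> 0"
    by (simp add: killing_form_def power2_eq_square)
  then have m: "minor2 1 2 p v = 0" "minor2 1 3 p v = 0" "minor2 1 4 p v = 0"
     "minor2 2 3 p v = 0" "minor2 2 4 p v = 0" "minor2 3 4 p v = 0"
    by (smt (verit) zero_le_power2 power2_eq_iff_nonneg zero_eq_power2)+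
  have "minor2 i j p v = 0" for i j
    using exhaust_4[of i] exhaust_4[of j] m by (auto simp: minor2_def)
  moreover obtain k where k: "p $ k \<noteq> 0" using p by (auto simp: vec_eq_iff)
  ultimately have "v = (v $ k / p $ k) *\<^sub>R p"
    by (simp add: vec_eq_iff minor2_def field_simps)
  then show False using v by blast
qed

lemma killing_form_add:
  "killing_form (p + t *\<^sub>R q) v w = killing_form p v w + t * killing_polar p q v w + t\<^sup>2 * killing_form q v w"
  by (simp add: killing_polar_def killing_form_def minor2_linear power2_eq_square algebra_simps)

text \<open>This is the Killing equation: \<open>killing_form p v v\<close> is constant when \<open>p\<close> moves in the direction \<open>v\<close>.\<close>

lemma killing_polar_cyclic:
  "killing_polar p u v w + killing_polar p v w u + killing_polar p w u v = 0"
  by (simp add: killing_polar_def killing_form_def minor2_def) algebra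

lemma killing_polar_diagonal: "killing_polar p v v v = 0"
  by (simp add: killing_polar_def killing_form_def minor2_linear)

lemma killing_polar_commute: "killing_polar p u v w = killing_polar p u w v"
  by (simp add: killing_polar_def killing_form_commute[of _ v w])

section \<open>The Gram determinant of the Killing form\<close>

definition vol3 :: "real^4 \<Rightarrow> real^4 \<Rightarrow> real^4 \<Rightarrow> real" where
  "vol3 a b c = a$2 * (b$3 * c$4 - b$4 * c$3) - a$3 * (b$2 * c$4 - b$4 * c$2) + a$4 * (b$2 * c$3 - b$3 * c$2)"

text \<open>The determinant with rows \<open>p\<close>, \<open>a\<close>, \<open>b\<close>,
  \<open>c\<close>, expanded along \<open>p\<close>.\<close>

definition vol4 :: "real^4 \<Rightarrow> real^4 \<Rightarrow> real^4 \<Rightarrow> real^4 \<Rightarrow> real" where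
  "vol4 p a b c = p$1 * vol3 a b c
    - p$2 * (a$1 * (b$3 * c$4 - b$4 * c$3) - a$3 * (b$1 * c$4 - b$4 * c$1) + a$4 * (b$1 * c$3 - b$3 * c$1))
    + p$3 * (a$1 * (b$2 * c$4 - b$4 * c$2) - a$2 * (b$1 * c$4 - b$4 * c$1) + a$4 * (b$1 * c$2 - b$2 * c$1))
    - p$4 * (a$1 * (b$2 * c$3 - b$3 * c$2) - a$2 * (b$1 * c$3 - b$3 * c$1) + a$3 * (b$1 * c$2 - b$2 * c$1))"

lemma vol4_shift: "vol4 (p + t *\<^sub>R c) a b c = vol4 p a b c"
  by (simp add: vol4_def vol3_def algebra_simps)

text \<open>The determinant of the symmetric 3 by 3 matrix with diagonal \<open>a\<close>,
  \<open>b\<close>, \<open>c\<close> and off-diagonal entries \<open>d\<close>, \<open>e\<close>,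
  \<open>f\<close> at positions 12, 13, 23.\<close>

definition sdet3 :: "real \<Rightarrow> real \<Rightarrow> real \<Rightarrow> real \<Rightarrow> real \<Rightarrow> real \<Rightarrow> real" where
  "sdet3 a b c d e f = a * b * c + 2 * d * e * f - a * f^2 - b * e^2 - c * d^2"

abbreviation gram_det :: "real^4 \<Rightarrow> real^4 \<Rightarrow> real^4 \<Rightarrow> real^4 \<Rightarrow> real" where
  "gram_det p a b c \<equiv> sdet3 (killing_form p a a) (killing_form p b b) (killing_form p c c)
     (killing_form p a b) (killing_form p a c) (killing_form p b c)"

lemma sdet3_scale: "sdet3 (s*a) (s*b) (s*c) (s*d) (s*e) (s*f) = s^3 * sdet3 a b c d e f"
  by (simp add: sdet3_def power2_eq_square power3_eq_cube algebra_simps)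

text \<open>This is det(M K M^T) = det K * (det M)^2 for a symmetric matrix K, with the rows of M
  being the three coefficient vectors.\<close>

lemma sdet3_quadratic_form:
  fixes k11 k22 k33 k12 k13 k23 :: real
  defines "Q \<equiv> \<lambda>a1 a2 a3 b1 b2 b3. k11*a1*b1 + k22*a2*b2 + k33*a3*b3 + k12*(a1*b2+a2*b1) + k13*(a1*b3+a3*b1) + k23*(a2*b3+a3*b2)"
  shows "sdet3 (Q a1 a2 a3 a1 a2 a3) (Q b1 b2 b3 b1 b2 b3) (Q c1 c2 c3 c1 c2 c3)
     (Q a1 a2 a3 b1 b2 b3) (Q a1 a2 a3 c1 c2 c3) (Q b1 b2 b3 c1 c2 c3)
    = sdet3 k11 k22 k33 k12 k13 k23 *
      (a1 * (b2 * c3 - b3 * c2) - a2 * (b1 * c3 - b3 * c1) + a3 * (b1 * c2 - b2 * c1))^2"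
  unfolding Q_def sdet3_def by algebra

text \<open>If \<open>p$1 = 0\<close>, perturb \<open>p\<close>; otherwise vectors can be made to have first entry 0 by adding multiples of \<open>p\<close>.\<close>

lemma gram_det_eq: "gram_det p a b c = killing_disc p * (vol4 p a b c)^2"
proof -
  define e1 :: "real^4" where "e1 = axis 1 1"
  have 1: "gram_det p a b c = killing_disc p * (vol4 p a b c)^2" if p: "p $ 1 \<noteq> 0" for p
  proof -
    \<comment> \<open>\<open>v\<close> is pushed along \<open>p\<close> into the hyperplane of
      vanishing first coordinate; the factor \<open>p$1\<close> avoids a division.\<close>
    define s where "s v = p$1 *\<^sub>R v + (- v$1) *\<^sub>R p" for v :: "real^4"
    define k where "k i j = killing_form p (axis i 1) (axis j 1)" for i j
    have s1: "s v $ 1 = 0" for v by (simp add: s_def)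
    have K: "killing_form p (s v) (s w) = (p$1)^2 * killing_form p v w" for v w
      unfolding s_def by (rule killing_form_shift)
    have Q: "killing_form p (s v) (s w) = k 2 2 * s v$2 * s w$2 + k 3 3 * s v$3 * s w$3 + k 4 4 * s v$4 * s w$4
        + k 2 3 * (s v$2 * s w$3 + s v$3 * s w$2) + k 2 4 * (s v$2 * s w$4 + s v$4 * s w$2)
        + k 3 4 * (s v$3 * s w$4 + s v$4 * s w$3)" for v w
      unfolding bilinear_sum_axis[OF bilinear_killing_form, of p "s v" "s w"]
      by (simp add: sum_4 s1 k_def killing_form_commute[of p "axis 3 1" "axis 2 1"]
          killing_form_commute[of p "axis 4 1" "axis 2 1"] killing_form_commute[of p "axis 4 1" "axis 3 1"] algebra_simps)
    have v: "vol3 (s a) (s b) (s c) = (p$1)^2 * vol4 p a b c"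
      by (simp add: vol3_def vol4_def s_def) algebra
    have "((p$1)^2)^3 * gram_det p a b c = gram_det p (s a) (s b) (s c)"
      by (simp add: K sdet3_scale)
    also have "\<dots> = sdet3 (k 2 2) (k 3 3) (k 4 4) (k 2 3) (k 2 4) (k 3 4) * (vol3 (s a) (s b) (s c))^2"
      unfolding Q sdet3_quadratic_form vol3_def ..
    \<comment> \<open>The origin of \<open>killing_disc\<close>: it is the Gram determinant of the
      last three basis vectors divided by the square of their volume together with \<open>p\<close>,
      which is (p$1)^2.\<close>
    also have "sdet3 (k 2 2) (k 3 3) (k 4 4) (k 2 3) (k 2 4) (k 3 4) = (p$1)^2 * killing_disc p"
      by (simp add: k_def killing_form_def minor2_def sdet3_def killing_disc_def axis_def) algebra
    also have "(p$1)^2 * killing_disc p * (vol3 (s a) (s b) (s c))^2 = ((p$1)^2)^3 * (killing_disc p * (vol4 p a b c)^2)"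
      unfolding v by algebra
    finally show ?thesis using p by simp
  qed
  show ?thesis
  proof (cases "p $ 1 = 0")
    case True
    \<comment> \<open>Both sides are continuous in \<open>t\<close> and agree for nonzero
      \<open>t\<close>, where the first coordinate of the base point is \<open>t\<close>; hence they
      agree at 0.\<close>
    let ?L = "\<lambda>t. gram_det (p + t *\<^sub>R e1) a b c" and ?R = "\<lambda>t. killing_disc (p + t *\<^sub>R e1) * (vol4 (p + t *\<^sub>R e1) a b c)^2"
    have "isCont ?L 0" "isCont ?R 0"
      unfolding sdet3_def killing_form_def minor2_def killing_disc_def vol4_def vol3_def
      by (intro continuous_intros)+
    then have lim: "(?L \<longlongrightarrow> ?L 0) (at 0)" "(?R \<longlongrightarrow> ?R 0) (at 0)" by (simp_all add: isCont_def)
    have "\<forall>\<^sub>F t in at 0. ?L t = ?R t"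
      unfolding eventually_at using True by (intro exI[of _ 1]) (auto simp: e1_def intro!: 1)
    then have "(?L \<longlongrightarrow> ?R 0) (at 0)" using lim(2) by (rule tendsto_cong[THEN iffD2])
    then have "?L 0 = ?R 0" by (rule tendsto_unique[OF at_neq_bot lim(1)])
    then show ?thesis by simp
  qed (rule 1)
qed

subsection \<open>The metric in a projective chart\<close>

lemma frame_linear: "affine_frame A \<Longrightarrow> linear A" and frame_bij: "affine_frame A \<Longrightarrow> bij A"
  by (auto simp: affine_frame_def)

lemma frame_split: "affine_frame A \<Longrightarrow> A (t, x) = t *\<^sub>R A (1, 0) + A (0, x)"
  using linear_add[OF frame_linear, of A "(t, 0)" "(0, x)"] linear_scale[OF frame_linear, of A t "(1, 0)"]
  by simp

lemma frame_affine: "affine_frame A \<Longrightarrow> A (1, x) = A (1, 0) + A (0, x)"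
  using frame_split[of A 1 x] by simp

lemma frame_linear_part: "affine_frame A \<Longrightarrow> linear (\<lambda>x. A (0, x))"
  using linear_add[OF frame_linear, of A "(0, _)" "(0, _)"] linear_scale[OF frame_linear, of A _ "(0, _)"]
  by (intro linearI) simp_all

lemma frame_eq_iff: "affine_frame A \<Longrightarrow> A a = A b \<longleftrightarrow> a = b"
  by (meson bij_is_inj frame_bij inj_eq)

lemma frame_zero_iff: "affine_frame A \<Longrightarrow> A a = 0 \<longleftrightarrow> a = 0"
  by (metis frame_eq_iff frame_linear linear_0)

lemma frame_point_nonzero: "affine_frame A \<Longrightarrow> A (1, x) \<noteq> 0"
  by (simp add: frame_zero_iff zero_prod_def)

lemma frame_has_derivative:
  assumes A: "affine_frame A" shows "((\<lambda>x. A (1, x)) has_derivative (\<lambda>v. A (0, v))) (at x)"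
proof -
  have "((\<lambda>x. A (1, 0) + A (0, x)) has_derivative (\<lambda>v. 0 + A (0, v))) (at x)"
    by (intro has_derivative_add has_derivative_const linear_imp_has_derivative[OF frame_linear_part[OF A]])
  then show ?thesis by (simp flip: frame_affine[OF A])
qed

lemma affine_lift_eq: "affine_lift A x = inverse (norm (A (1, x))) *\<^sub>R A (1, x)"
  by (simp add: affine_lift_def sgn_div_norm)

text \<open>Normalization only rescales the tangent vector and adds a radial multiple
  \<open>s v\<close>. That multiple stays implicit because the Killing form does not see it.\<close>

lemma affine_lift_partial:
  assumes A: "affine_frame A"
  obtains s where "\<And>v. frechet_derivative (affine_lift A) (at x) v
     = inverse (norm (A (1, x))) *\<^sub>R A (0, v) + s v *\<^sub>R A (1, x)" "affine_lift A differentiable (at x)"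
proof -
  have nz: "A (1, x) \<noteq> 0" by (rule frame_point_nonzero[OF A])
  obtain s where s: "((\<lambda>x. inverse (norm (A (1, x)))) has_derivative s) (at x)"
    using Deriv.has_derivative_inverse[OF _ diff_chain_at[OF frame_has_derivative[OF A] has_derivative_norm[OF nz]]] nz
    by (auto simp: o_def)
  have "(affine_lift A has_derivative (\<lambda>v. inverse (norm (A (1, x))) *\<^sub>R A (0, v) + s v *\<^sub>R A (1, x))) (at x)"
    unfolding affine_lift_eq[abs_def] by (rule has_derivative_scaleR[OF s frame_has_derivative[OF A]])
  then show ?thesis using that[of s] dirderivI by (auto simp: differentiable_def)
qed

text \<open>The radial parts drop out by \<open>killing_form_shift\<close>, and the powers of the
  norm cancel between numerator and denominator.\<close>

lemma coord_metric_entry: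
  assumes A: "affine_frame A"
  shows "coord_metric equator_metric A x $ i $ j =
    killing_form (A (1, x)) (A (0, axis i 1)) (A (0, axis j 1)) / killing_disc (A (1, x))"
proof -
  let ?p = "A (1, x)" and ?r = "inverse (norm (A (1, x)))"
  obtain s where s: "\<And>v. frechet_derivative (affine_lift A) (at x) v = ?r *\<^sub>R A (0, v) + s v *\<^sub>R ?p"
    using affine_lift_partial[OF A] by blast
  have r: "?r \<noteq> 0" using frame_point_nonzero[OF A] by simp
  show ?thesis
    unfolding coord_metric_def partial_def s affine_lift_eq equator_metric_def
    using r by (simp add: killing_form_scale killing_form_shift killing_disc_scale power2_eq_square power4_eq_xxxx)
qed

lemma coord_metric_prod:
  assumes A: "affine_frame A"
  shows "metric_prod (coord_metric equator_metric A) x v w =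
    killing_form (A (1, x)) (A (0, v)) (A (0, w)) / killing_disc (A (1, x))"
proof -
  let ?K = "\<lambda>v w. killing_form (A (1, x)) (A (0, v)) (A (0, w))"
  have "bilinear ?K"
    using bilinear_killing_form[of "A (1, x)"] frame_linear_part[OF A] unfolding bilinear_def
    by (auto intro: linear_compose[unfolded o_def])
  from bilinear_sum_axis[OF this, of v w] show ?thesis
    by (simp add: metric_prod_def inner_vec_def matrix_vector_mult_def coord_metric_entry[OF A]
        sum_distrib_left sum_divide_distrib mult_ac)
qed

lemma smooth_on_frame_nth:
  assumes A: "affine_frame A" shows "smooth_on (\<lambda>x. A (1, x) $ k) UNIV"
proof -
  have "smooth_on (\<lambda>x. A (1, 0) + A (0, x)) UNIV"
    by (intro smooth_on_add smooth_on_const smooth_on_bounded_linear open_UNIV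
      linear_conv_bounded_linear[THEN iffD1] frame_linear_part[OF A])
  then show ?thesis
    unfolding frame_affine[OF A, symmetric] by (rule smooth_on_nth[OF open_UNIV])
qed

lemma smooth_coord_metric:
  assumes A: "affine_frame A" shows "smooth_on (coord_metric equator_metric A) UNIV"
proof -
  have nz: "killing_disc (A (1, x)) \<noteq> 0" for x
    using killing_disc_pos[OF frame_point_nonzero[OF A]] by (metis less_irrefl)
  have "smooth_on (\<lambda>x. \<chi> i j. killing_form (A (1, x)) (A (0, axis i 1)) (A (0, axis j 1)) / killing_disc (A (1, x))) UNIV"
    using nz unfolding killing_form_def killing_disc_def minor2_def
    by (intro smooth_on_vec smooth_on_divide smooth_on_add smooth_on_diff smooth_on_mult smooth_on_power
        smooth_on_const smooth_on_frame_nth A open_UNIV)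
  moreover have "coord_metric equator_metric A =
     (\<lambda>x. \<chi> i j. killing_form (A (1, x)) (A (0, axis i 1)) (A (0, axis j 1)) / killing_disc (A (1, x)))"
    by (simp add: fun_eq_iff vec_eq_iff coord_metric_entry[OF A])
  ultimately show ?thesis by simp
qed

lemma frame_independent:
  assumes A: "affine_frame A" and v: "v \<noteq> 0" shows "A (0, v) \<noteq> c *\<^sub>R A (1, x)"
proof
  assume "A (0, v) = c *\<^sub>R A (1, x)"
  then have "A (0, v) = A (c *\<^sub>R (1, x))" by (simp only: linear_scale[OF frame_linear[OF A]])
  then show False using v unfolding frame_eq_iff[OF A] by auto
qed

lemma smooth_metric_coord_metric:
  assumes A: "affine_frame A" shows "smooth_metric (coord_metric equator_metric A)"
  unfolding smooth_metric_def
proof (intro conjI allI impI smooth_coord_metric[OF A])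
  show "coord_metric equator_metric A x $ i $ j = coord_metric equator_metric A x $ j $ i" for x i j
    by (simp add: coord_metric_entry[OF A] killing_form_commute)
  show "metric_prod (coord_metric equator_metric A) x v v > 0" if "v \<noteq> 0" for x v
    unfolding coord_metric_prod[OF A]
    by (intro divide_pos_pos killing_form_pos killing_disc_pos frame_point_nonzero frame_independent A that)
qed

lemma riemannian_metric_equator_metric: "riemannian_metric equator_metric"
  unfolding riemannian_metric_def
proof (intro conjI ballI allI impI smooth_coord_metric)
  fix p v w :: "real^4" assume p: "p \<in> sphere 0 1"
  show "equator_metric p (a *\<^sub>R u + b *\<^sub>R v) w = a * equator_metric p u w + b * equator_metric p v w" for u a b
    by (simp add: equator_metric_def bilinear_ladd[OF bilinear_killing_form]
        bilinear_lmul[OF bilinear_killing_form] add_divide_distrib)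
  show "equator_metric p v w = equator_metric p w v"
    by (simp add: equator_metric_def killing_form_commute)
  show "equator_metric p v v > 0" if "v \<in> tangent_sphere p" "v \<noteq> 0"
  proof -
    have "v \<noteq> c *\<^sub>R p" for c using that p by (auto simp: tangent_sphere_def)
    moreover have "p \<noteq> 0" using p by auto
    ultimately show ?thesis
      unfolding equator_metric_def by (intro divide_pos_pos killing_form_pos killing_disc_pos)
  qed
  show "equator_metric (- p) (- v) (- w) = equator_metric p v w"
    by (simp add: equator_metric_def killing_form_def minor2_def killing_disc_def)
qed

section \<open>Equators are minimal\<close>

abbreviation chart_metric :: "frame \<Rightarrow> real^3 \<Rightarrow> real^3^3" where
  "chart_metric A \<equiv> coord_metric equator_metric A"

definition disc_deriv :: "real^4 \<Rightarrow> real^4 \<Rightarrow> real" where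
  "disc_deriv p q = dirderiv killing_disc p q"

lemma killing_disc_has_derivative: "(killing_disc has_derivative disc_deriv p) (at p)"
proof -
  have "killing_disc differentiable (at p)"
    unfolding killing_disc_def[abs_def]
    by (rule smooth_on_differentiable[OF _ UNIV_I])
      (intro smooth_on_add smooth_on_mult smooth_on_power smooth_on_const smooth_on_bounded_linear
        bounded_linear_vec_nth open_UNIV)
  then show ?thesis unfolding disc_deriv_def[abs_def] by (rule has_derivative_dirderiv)
qed

lemma killing_polar_has_derivative:
  "((\<lambda>t. killing_form (p + t *\<^sub>R q) v w) has_real_derivative killing_polar p q v w) (at 0)"
  unfolding killing_form_add by (auto intro!: derivative_eq_intros)

lemma killing_form_frame_has_derivative:
  assumes A: "affine_frame A"
  shows "((\<lambda>x. killing_form (A (1, x)) v w) has_derivative (\<lambda>u. killing_polar (A (1, x)) (A (0, u)) v w)) (at x)"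
proof -
  have nth: "((\<lambda>x. A (1, x) $ k) has_derivative (\<lambda>u. A (0, u) $ k)) (at x)" for k
    by (rule bounded_linear.has_derivative[OF bounded_linear_vec_nth frame_has_derivative[OF A]])
  show ?thesis
    unfolding killing_form_def minor2_def
    by (rule has_derivative_eq_rhs, (rule derivative_intros nth)+)
      (simp add: fun_eq_iff killing_polar_def killing_form_def minor2_def algebra_simps)
qed

lemma chart_metric_deriv:
  assumes A: "affine_frame A"
  shows "metric_deriv (chart_metric A) x u v w =
    killing_polar (A (1, x)) (A (0, u)) (A (0, v)) (A (0, w)) / killing_disc (A (1, x))
    - killing_form (A (1, x)) (A (0, v)) (A (0, w)) * disc_deriv (A (1, x)) (A (0, u)) / (killing_disc (A (1, x)))\<^sup>2"
proof -
  let ?P = "A (1, x)"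
  have nz: "killing_disc ?P \<noteq> 0" using killing_disc_pos[OF frame_point_nonzero[OF A]] by (metis less_irrefl)
  have d: "((\<lambda>x. killing_disc (A (1, x))) has_derivative (\<lambda>u. disc_deriv ?P (A (0, u)))) (at x)"
    using diff_chain_at[OF frame_has_derivative[OF A] killing_disc_has_derivative] by (simp add: o_def)
  have 1: "((\<lambda>x. metric_prod (chart_metric A) x v w) has_derivative (\<lambda>u. metric_deriv (chart_metric A) x u v w)) (at x)"
    using has_derivative_metric_prod[OF smooth_metric_coord_metric[OF A] has_derivative_ident has_derivative_const[of v] has_derivative_const[of w]]
    by (simp add: metric_prod_def)
  have 2: "((\<lambda>x. metric_prod (chart_metric A) x v w) has_derivative
     (\<lambda>u. killing_polar ?P (A (0, u)) (A (0, v)) (A (0, w)) / killing_disc ?P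
    - killing_form ?P (A (0, v)) (A (0, w)) * disc_deriv ?P (A (0, u)) / (killing_disc ?P)\<^sup>2)) (at x)"
    unfolding coord_metric_prod[OF A]
    by (rule has_derivative_eq_rhs[OF has_derivative_divide'[OF killing_form_frame_has_derivative[OF A] d nz]])
      (use nz in \<open>simp add: fun_eq_iff field_simps power2_eq_square\<close>)
  from has_derivative_unique[OF 1 2] show ?thesis by (rule fun_cong)
qed

text \<open>
  Differentiating the Gram determinant of the frame \<open>b, c, n\<close> in the direction \<open>n\<close>, which by
  \<open>gram_det_eq\<close> is a constant multiple of the discriminant.
\<close>

lemma trace_killing_polar:
  assumes p: "p \<noteq> 0" and bn: "killing_form p b n = 0" "killing_form p c n = 0"
    and nn: "killing_form p n n = killing_disc p"
    and ind: "killing_form p b b * killing_form p c c - (killing_form p b c)\<^sup>2 \<noteq> 0"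
  shows "killing_form p c c * killing_polar p n b b - 2 * killing_form p b c * killing_polar p n b c
      + killing_form p b b * killing_polar p n c c
    = (killing_form p b b * killing_form p c c - (killing_form p b c)\<^sup>2) * disc_deriv p n / killing_disc p"
proof -
  define k where "k = (vol4 p b c n)\<^sup>2"
  let ?K = "\<lambda>t. killing_form (p + t *\<^sub>R n)" and ?E = "killing_polar p n" and ?D = "killing_disc p"
  have nz: "?D \<noteq> 0" using killing_disc_pos[OF p] by simp
  \<comment> \<open>Moving \<open>p\<close> along \<open>n\<close> adds to one row of
    \<open>vol4\<close> a multiple of another, so \<open>k\<close> does not depend on
    \<open>t\<close>.\<close>
  have eq: "gram_det (p + t *\<^sub>R n) b c n = killing_disc (p + t *\<^sub>R n) * k" for t
    unfolding gram_det_eq vol4_shift k_def ..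
  have "?D * (killing_form p b b * killing_form p c c - (killing_form p b c)\<^sup>2) = ?D * k"
    using eq[of 0] by (simp add: sdet3_def bn nn algebra_simps)
  then have k: "killing_form p b b * killing_form p c c - (killing_form p b c)\<^sup>2 = k"
    using nz by simp
  have d: "((\<lambda>t. killing_disc (p + t *\<^sub>R n)) has_real_derivative disc_deriv p n) (at 0)"
  proof -
    have "((\<lambda>t. p + t *\<^sub>R n) has_derivative (\<lambda>t. t *\<^sub>R n)) (at 0)"
      by (auto intro!: derivative_eq_intros)
    from diff_chain_at[OF this, of killing_disc "disc_deriv p"] killing_disc_has_derivative
    have "((\<lambda>t. killing_disc (p + t *\<^sub>R n)) has_derivative (\<lambda>t. disc_deriv p (t *\<^sub>R n))) (at 0)"
      by (simp add: o_def)
    moreover have "linear (disc_deriv p)"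
      using killing_disc_has_derivative by (rule has_derivative_linear)
    ultimately show ?thesis
      by (simp add: has_field_derivative_def linear_scale mult_commute_abs)
  qed
  \<comment> \<open>The entries pairing \<open>n\<close> with \<open>b\<close> and \<open>c\<close>
    vanish at \<open>t = 0\<close> and occur in the determinant only in products of two, so their
    derivatives do not contribute. The entry of \<open>n\<close> with itself is constant by
    \<open>killing_polar_diagonal\<close>. Only the block of \<open>b\<close> and \<open>c\<close>
    is differentiated.\<close>
  have "((\<lambda>t. gram_det (p + t *\<^sub>R n) b c n) has_real_derivative
     ?E b b * killing_form p c c * ?D + killing_form p b b * ?E c c * ?D
     - 2 * ?D * killing_form p b c * ?E b c) (at 0)"
    unfolding sdet3_def
    by (rule derivative_eq_intros killing_polar_has_derivative refl)+
      (simp add: bn nn killing_polar_diagonal algebra_simps)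
  moreover have "((\<lambda>t. gram_det (p + t *\<^sub>R n) b c n) has_real_derivative disc_deriv p n * k) (at 0)"
    unfolding eq by (rule DERIV_cmult_right[OF d])
  ultimately have "?E b b * killing_form p c c * ?D + killing_form p b b * ?E c c * ?D
     - 2 * ?D * killing_form p b c * ?E b c = disc_deriv p n * k"
    by (rule DERIV_unique)
  then show ?thesis unfolding k using nz by (simp add: field_simps)
qed

text \<open>In Koszul's formula the products with the normal vanish, and the cyclic Killing identity
  turns the two tangential derivatives into minus the normal one. The first summand is the effect of
  the conformal factor, the second that of the Killing form.\<close>

lemma connection_normal_component:
  assumes A: "affine_frame A"
    and u: "metric_prod (chart_metric A) x u \<nu> = 0" and v: "metric_prod (chart_metric A) x v \<nu> = 0"
  shows "metric_prod (chart_metric A) x (connection (chart_metric A) x u v) \<nu> =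
    metric_prod (chart_metric A) x u v * disc_deriv (A (1, x)) (A (0, \<nu>)) / (2 * killing_disc (A (1, x)))
    - killing_polar (A (1, x)) (A (0, \<nu>)) (A (0, u)) (A (0, v)) / killing_disc (A (1, x))"
proof -
  let ?P = "A (1, x)" and ?U = "A (0, u)" and ?V = "A (0, v)" and ?N = "A (0, \<nu>)"
  have nz: "killing_disc ?P \<noteq> 0" using killing_disc_pos[OF frame_point_nonzero[OF A]] by (metis less_irrefl)
  have 0: "killing_form ?P ?U ?N = 0" "killing_form ?P ?V ?N = 0"
    using u v nz by (auto simp: coord_metric_prod[OF A])
  have cyc: "killing_polar ?P ?U ?V ?N + killing_polar ?P ?V ?U ?N = - killing_polar ?P ?N ?U ?V"
    using killing_polar_cyclic[of ?P ?U ?V ?N] by (simp add: killing_polar_commute[of ?P ?V ?U ?N])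
  have "2 * metric_prod (chart_metric A) x (connection (chart_metric A) x u v) \<nu> =
    (killing_polar ?P ?U ?V ?N + killing_polar ?P ?V ?U ?N) / killing_disc ?P - killing_polar ?P ?N ?U ?V / killing_disc ?P
    + killing_form ?P ?U ?V * disc_deriv ?P ?N / (killing_disc ?P)\<^sup>2"
    unfolding connection_koszul[OF smooth_metric_coord_metric[OF A]] chart_metric_deriv[OF A]
    by (simp add: 0 add_divide_distrib)
  then show ?thesis
    unfolding cyc coord_metric_prod[OF A, of x u v] using nz by (simp add: field_simps power2_eq_square)
qed

lemma matrix_inv_2:
  fixes M :: "real^2^2"
  assumes M: "M $ 1 $ 2 = M $ 2 $ 1" and d: "M $ 1 $ 1 * M $ 2 $ 2 - (M $ 1 $ 2)\<^sup>2 \<noteq> 0"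
  defines "D \<equiv> M $ 1 $ 1 * M $ 2 $ 2 - (M $ 1 $ 2)\<^sup>2"
  shows "matrix_inv M $ 1 $ 1 = M $ 2 $ 2 / D" "matrix_inv M $ 2 $ 2 = M $ 1 $ 1 / D"
    "matrix_inv M $ 1 $ 2 = - M $ 1 $ 2 / D" "matrix_inv M $ 2 $ 1 = - M $ 1 $ 2 / D"
proof -
  define N :: "real^2^2" where "N = vector [vector [M $ 2 $ 2 / D, - M $ 1 $ 2 / D], vector [- M $ 1 $ 2 / D, M $ 1 $ 1 / D]]"
  have "M ** N = mat 1"
    using d unfolding D_def[symmetric]
    by (simp add: vec_eq_iff forall_2 matrix_matrix_mult_def sum_2 N_def mat_def M[symmetric] diff_divide_distrib[symmetric])
      (simp add: D_def power2_eq_square mult.commute)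
  then have "matrix_inv M = N" by (rule matrix_inv_unique)
  then show "matrix_inv M $ 1 $ 1 = M $ 2 $ 2 / D" "matrix_inv M $ 2 $ 2 = M $ 1 $ 1 / D"
    "matrix_inv M $ 1 $ 2 = - M $ 1 $ 2 / D" "matrix_inv M $ 2 $ 1 = - M $ 1 $ 2 / D"
    by (simp_all add: N_def)
qed

text \<open>A level set of a linear function in a chart lies on a hyperplane, so second derivatives of a
  parametrization are tangent and the second fundamental form only sees the connection.\<close>

lemma mean_curvature_plane_patch:
  fixes Y :: "real^2 \<Rightarrow> real^3"
  assumes A: "affine_frame A" and V: "open V" and Y: "smooth_on Y V"
    and inj: "\<forall>u\<in>V. inj (frechet_derivative Y (at u))"
    and n: "n \<noteq> 0" "\<And>u. u \<in> V \<Longrightarrow> n \<bullet> Y u = c" and u: "u \<in> V"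
    and \<nu>: "unit_normal (chart_metric A) Y u \<nu>"
  shows "mean_curvature (chart_metric A) Y u \<nu> = 0"
proof -
  let ?G = "chart_metric A" and ?x = "Y u"
  note G = smooth_metric_coord_metric[OF A]
  define y where "y a = partial a Y u" for a
  have tang: "n \<bullet> partial a Y z = 0" if z: "z \<in> V" for a z
  proof -
    have "((\<lambda>z. n \<bullet> Y z) has_derivative (\<lambda>h. n \<bullet> dirderiv Y z h)) (at z)"
      by (rule has_derivative_inner_right[OF smooth_on_has_derivative[OF Y z]])
    then have "((\<lambda>z. c) has_derivative (\<lambda>h. n \<bullet> dirderiv Y z h)) (at z)"
      by (rule has_derivative_transform_within_open[OF _ V z]) (simp add: n)
    then have "(\<lambda>h. n \<bullet> dirderiv Y z h) = (\<lambda>h. 0)"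
      using has_derivative_const has_derivative_unique by blast
    then show ?thesis by (metis partial_def)
  qed
  have tang2: "n \<bullet> partial a (partial b Y) u = 0" for a b
  proof -
    have sm: "smooth_on (partial b Y) V"
      unfolding partial_def[abs_def] by (rule smooth_on_dirderiv[OF Y])
    have "((\<lambda>z. n \<bullet> partial b Y z) has_derivative (\<lambda>h. n \<bullet> dirderiv (partial b Y) u h)) (at u)"
      by (rule has_derivative_inner_right[OF smooth_on_has_derivative[OF sm u]])
    then have "((\<lambda>z. 0) has_derivative (\<lambda>h. n \<bullet> dirderiv (partial b Y) u h)) (at u)"
      by (rule has_derivative_transform_within_open[OF _ V u]) (simp add: tang)
    then have "(\<lambda>h. n \<bullet> dirderiv (partial b Y) u h) = (\<lambda>h. 0)"
      using has_derivative_const has_derivative_unique by blast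
    then show ?thesis by (metis partial_def)
  qed
  have linY: "linear (dirderiv Y u)" by (intro dirderiv_linear smooth_on_differentiable[OF Y u])
  have comb: "dirderiv Y u w = w $ 1 *\<^sub>R y 1 + w $ 2 *\<^sub>R y 2" for w
    unfolding linear_sum_axis[OF linY, of w] by (simp add: sum_2 y_def partial_def)
  have indep: "w = 0" if "w $ 1 *\<^sub>R y 1 + w $ 2 *\<^sub>R y 2 = 0" for w :: "real^2"
  proof -
    have "dirderiv Y u w = 0" using comb that by simp
    then show ?thesis using inj u linY linear_injective_0 by blast
  qed
  have ynu: "metric_prod ?G ?x (y a) \<nu> = 0" "metric_prod ?G ?x \<nu> \<nu> = 1" for a
    using \<nu> by (auto simp: unit_normal_def y_def)
  have span: "z \<in> range (dirderiv Y u)" if "n \<bullet> z = 0" for z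
  proof -
    have sub: "range (dirderiv Y u) \<subseteq> {z. n \<bullet> z = 0}"
      using tang[OF u] by (auto simp: comb y_def inner_add_right)
    \<comment> \<open>The differential is injective on a space of dimension 2 and its image lies in
      a plane, hence fills it.\<close>
    have "dim (range (dirderiv Y u)) = dim (UNIV :: (real^2) set)"
      using dim_image_eq[OF linY, of UNIV] inj u by (simp add: span_UNIV)
    also have "\<dots> = dim {z. n \<bullet> z = 0}"
      using dim_hyperplane[OF n(1)] by (simp add: DIM_cart dim_UNIV)
    finally have "range (dirderiv Y u) = {z. n \<bullet> z = 0}"
      using sub linY by (intro subspace_dim_equal linear_subspace_image subspace_UNIV subspace_hyperplane) auto
    then show ?thesis using that by blast
  qed
  have tangential: "metric_prod ?G ?x z \<nu> = 0" if z: "n \<bullet> z = 0" for z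
  proof -
    obtain w :: "real^2" where "z = w $ 1 *\<^sub>R y 1 + w $ 2 *\<^sub>R y 2" using span[OF z] comb by auto
    then show ?thesis using ynu by (simp add: metric_prod_def inner_add_left)
  qed
  let ?P = "A (1, ?x)" and ?N = "A (0, \<nu>)"
  let ?D = "killing_disc ?P"
  have D: "?D > 0" by (intro killing_disc_pos frame_point_nonzero A)
  have II: "second_fundamental_form ?G Y u \<nu> $ a $ b =
    metric_prod ?G ?x (y a) (y b) * disc_deriv ?P ?N / (2 * ?D) - killing_polar ?P ?N (A (0, y a)) (A (0, y b)) / ?D" for a b
  proof -
    have "cov_deriv ?G Y u a b = partial a (partial b Y) u + connection ?G ?x (y a) (y b)"
      by (simp add: cov_deriv_def connection_def vec_eq_iff y_def)
    then have "second_fundamental_form ?G Y u \<nu> $ a $ b = metric_prod ?G ?x (connection ?G ?x (y a) (y b)) \<nu>"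
      using tangential[OF tang2[of a b]]
      by (simp add: second_fundamental_form_def metric_prod_def inner_add_left)
    then show ?thesis by (simp add: connection_normal_component[OF A ynu(1) ynu(1)])
  qed
  let ?I = "first_fundamental_form ?G Y u"
  have I: "?I $ a $ b = metric_prod ?G ?x (y a) (y b)" for a b
    by (simp add: first_fundamental_form_def y_def)
  have Isym: "?I $ 1 $ 2 = ?I $ 2 $ 1" unfolding I by (rule metric_prod_commute[OF G])
  let ?p = "metric_prod ?G ?x (y 1) (y 1)" and ?q = "metric_prod ?G ?x (y 1) (y 2)" and ?r = "metric_prod ?G ?x (y 2) (y 2)"
  have detI: "?p * ?r - ?q\<^sup>2 > 0"
  proof -
    have "y 1 \<noteq> 0"
    proof
      assume "y 1 = 0"
      then have "(axis 1 1 :: real^2) = 0" by (intro indep) (simp add: axis_def)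
      then show False by simp
    qed
    then have p: "?p > 0" by (rule metric_pos[OF G])
    \<comment> \<open>A multiple of the component of \<open>y 2\<close> orthogonal to
      \<open>y 1\<close>; its squared length is \<open>?p\<close> times the determinant, which is
      therefore positive.\<close>
    let ?z = "?p *\<^sub>R y 2 - ?q *\<^sub>R y 1"
    have "?z \<noteq> 0"
    proof
      assume "?z = 0"
      then have "(vector [- ?q, ?p] :: real^2) = 0" by (intro indep) simp
      then show False using p by (auto simp: vec_eq_iff forall_2)
    qed
    then have "0 < metric_prod ?G ?x ?z ?z" by (rule metric_pos[OF G])
    also have "metric_prod ?G ?x ?z ?z = ?p * (?p * ?r - ?q\<^sup>2)"
      using metric_prod_commute[OF G, of ?x "y 2" "y 1"]
      by (simp add: metric_prod_def inner_diff_left matrix_vector_mult_diff_distrib inner_diff_right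
          matrix_vector_mult_scaleR power2_eq_square algebra_simps)
    finally show ?thesis using p by (simp add: zero_less_mult_iff)
  qed
  have K: "killing_form ?P (A (0, v)) (A (0, w)) = ?D * metric_prod ?G ?x v w" for v w
    using D by (simp add: coord_metric_prod[OF A])
  let ?E = "\<lambda>a b. killing_polar ?P ?N (A (0, y a)) (A (0, y b))"
  \<comment> \<open>\<open>trace_killing_polar\<close> is about the Killing form, which is
    \<open>?D\<close> times the metric; this accounts for the powers of \<open>?D\<close> and for
    its normalization of the unit normal.\<close>
  have "?D * ?r * ?E 1 1 - 2 * (?D * ?q) * ?E 1 2 + ?D * ?p * ?E 2 2
      = ?D\<^sup>2 * (?p * ?r - ?q\<^sup>2) * disc_deriv ?P ?N / ?D"
  proof -
    have "?D * ?p * (?D * ?r) - (?D * ?q)\<^sup>2 = ?D\<^sup>2 * (?p * ?r - ?q\<^sup>2)"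
      by (simp add: power2_eq_square algebra_simps)
    moreover from this have "?D * ?p * (?D * ?r) - (?D * ?q)\<^sup>2 \<noteq> 0" using detI D by simp
    ultimately show ?thesis
      using trace_killing_polar[OF frame_point_nonzero[OF A], of ?x "A (0, y 1)" ?N "A (0, y 2)"]
      unfolding K by (simp add: ynu)
  qed
  moreover have "r * a - 2 * q * b + p * c = m * s"
    if "D * r * a - 2 * (D * q) * b + D * p * c = D\<^sup>2 * m * s / D" "D \<noteq> 0" for D r a q b p c m s :: real
  proof -
    have "D * (r * a - 2 * q * b + p * c) = D * (m * s)"
      using that by (simp add: power2_eq_square algebra_simps)
    then show ?thesis using that(2) by simp
  qed
  ultimately have tr: "?r * ?E 1 1 - 2 * ?q * ?E 1 2 + ?p * ?E 2 2 = (?p * ?r - ?q\<^sup>2) * disc_deriv ?P ?N"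
    using D by (metis less_irrefl)
  have E21: "?E 2 1 = ?E 1 2" and q21: "metric_prod ?G ?x (y 2) (y 1) = ?q"
    by (rule killing_polar_commute, rule metric_prod_commute[OF G])
  have dI: "?I $ 1 $ 1 * ?I $ 2 $ 2 - (?I $ 1 $ 2)\<^sup>2 \<noteq> 0" using detI unfolding I by simp
  have inv_sum: "M * ((r / M * X + - q / M * Y) + (- q / M * Y + p / M * Z)) = r * X - 2 * q * Y + p * Z"
    if "M \<noteq> 0" for M r X q Y p Z :: real
    using that by (simp add: field_simps)
  have scal: "r * (p * s / (2 * D) - a / D) - 2 * q * (q * s / (2 * D) - b / D) + p * (r * s / (2 * D) - c / D)
     = ((p * r - q\<^sup>2) * s - (r * a - 2 * q * b + p * c)) / D" if "D \<noteq> 0" for D p q r s a b c :: real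
    using that by (simp add: field_simps power2_eq_square)
  \<comment> \<open>Multiplication by the determinant of the first fundamental form clears the
    inverse matrix. The conformal part enters with a factor 1/2 in each of two tangent directions;
    their sum is one full derivative of the discriminant, exactly what \<open>tr\<close>
    cancels.\<close>
  have "(?p * ?r - ?q\<^sup>2) * mean_curvature ?G Y u \<nu> =
     ?r * (?p * disc_deriv ?P ?N / (2 * ?D) - ?E 1 1 / ?D)
     - 2 * ?q * (?q * disc_deriv ?P ?N / (2 * ?D) - ?E 1 2 / ?D)
     + ?p * (?r * disc_deriv ?P ?N / (2 * ?D) - ?E 2 2 / ?D)"
    unfolding mean_curvature_def sum_2 matrix_inv_2[OF Isym dI] II E21 q21 unfolding I
    by (rule inv_sum) (use detI in simp)
  also have "\<dots> = ((?p * ?r - ?q\<^sup>2) * disc_deriv ?P ?N - (?r * ?E 1 1 - 2 * ?q * ?E 1 2 + ?p * ?E 2 2)) / ?D"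
    by (rule scal) (use D in simp)
  also have "\<dots> = 0" unfolding tr by simp
  finally show ?thesis using detI by simp
qed

subsection \<open>Points of the projective space\<close>

lemma antipodal_class_eq_iff:
  assumes "norm p = 1" "norm q = 1"
  shows "antipodal_class p = antipodal_class q \<longleftrightarrow> p = q \<or> p = - q"
  using Quotient3_rel[OF Quotient3_rp3, of p q] assms by auto

lemma antipodal_class_cases: obtains p where "norm p = 1" "P = antipodal_class p"
  by (induct P rule: rp3.abs_induct) auto

lemma norm_affine_lift: "affine_frame A \<Longrightarrow> norm (affine_lift A x) = 1"
  by (simp add: affine_lift_def norm_sgn frame_point_nonzero)

lemma affine_param_in_equator:
  assumes A: "affine_frame A"
  shows "affine_param A x \<in> equator v \<longleftrightarrow> A (1, x) \<bullet> v = 0"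
proof -
  have "affine_param A x \<in> equator v \<longleftrightarrow> affine_lift A x \<bullet> v = 0"
  proof
    assume "affine_param A x \<in> equator v"
    then obtain q where "norm q = 1" "q \<bullet> v = 0" "antipodal_class (affine_lift A x) = antipodal_class q"
      by (auto simp: equator_def affine_param_def)
    then show "affine_lift A x \<bullet> v = 0"
      using norm_affine_lift[OF A, of x] by (auto simp: antipodal_class_eq_iff)
  next
    assume "affine_lift A x \<bullet> v = 0"
    then show "affine_param A x \<in> equator v"
      using norm_affine_lift[OF A, of x] by (auto simp: equator_def affine_param_def)
  qed
  also have "\<dots> \<longleftrightarrow> A (1, x) \<bullet> v = 0"
    using frame_point_nonzero[OF A] by (simp add: affine_lift_eq)
  finally show ?thesis .
qed

definition std_frame :: frame where
  "std_frame = (\<lambda>(t, x). vector [t, x $ 1, x $ 2, x $ 3])"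

lemma std_frame_nth [simp]:
  "std_frame (t, x) $ 1 = t" "std_frame (t, x) $ 2 = x $ 1" "std_frame (t, x) $ 3 = x $ 2" "std_frame (t, x) $ 4 = x $ 3"
  by (simp_all add: std_frame_def vector_def)

lemma affine_frame_std: "affine_frame std_frame"
  unfolding affine_frame_def
proof
  show "linear std_frame" by (rule linearI) (auto simp: vec_eq_iff forall_4)
  show "bij std_frame"
  proof (rule o_bij)
    let ?g = "\<lambda>p :: real^4. (p $ 1, vector [p $ 2, p $ 3, p $ 4] :: real^3)"
    show "?g \<circ> std_frame = id" by (auto simp: fun_eq_iff vec_eq_iff forall_3)
    show "std_frame \<circ> ?g = id" by (auto simp: fun_eq_iff vec_eq_iff forall_4)
  qed
qed

lemma frame_through:
  assumes p: "norm p = 1"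
  obtains f where "orthogonal_transformation f" "affine_frame (f \<circ> std_frame)" "(f \<circ> std_frame) (1, 0) = p"
proof -
  obtain f :: "real^4 \<Rightarrow> real^4" where f: "orthogonal_transformation f" "f (axis 1 1) = p"
    using orthogonal_transformation_exists_1[of "axis 1 1" p] p by auto
  have "affine_frame (f \<circ> std_frame)"
    using affine_frame_std orthogonal_transformation_linear[OF f(1)] orthogonal_transformation_bij[OF f(1)]
    unfolding affine_frame_def by (auto intro: linear_compose bij_comp)
  moreover have "std_frame (1, 0) = axis 1 1" by (simp add: vec_eq_iff forall_4 axis_def)
  ultimately show ?thesis using that f by simp
qed

lemma affine_param_origin:
  "affine_frame A \<Longrightarrow> norm (A (1, 0)) = 1 \<Longrightarrow> affine_param A 0 = antipodal_class (A (1, 0))"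
  by (simp add: affine_param_def affine_lift_eq)

lemma frame_inner:
  assumes A: "affine_frame A" shows "A (0, x) \<bullet> v = (\<chi> i. A (0, axis i 1) \<bullet> v) \<bullet> x"
proof -
  have "A (0, x) \<bullet> v = (\<Sum>i\<in>UNIV. x $ i * (A (0, axis i 1) \<bullet> v))"
    by (subst linear_sum_axis[OF frame_linear_part[OF A]]) (simp add: inner_sum_left)
  then show ?thesis by (simp add: inner_vec_def[of "\<chi> i. A (0, axis i 1) \<bullet> v"] mult.commute)
qed

lemma minimal_surface_equator:
  assumes v: "v \<in> sphere 0 1" shows "minimal_surface equator_metric (equator v)"
  unfolding minimal_surface_def
proof (intro conjI ballI allI impI)
  fix P assume "P \<in> equator v"
  then obtain p where p: "norm p = 1" "p \<bullet> v = 0" "P = antipodal_class p" by (auto simp: equator_def)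
  obtain f where f: "orthogonal_transformation f" "affine_frame (f \<circ> std_frame)" "(f \<circ> std_frame) (1, 0) = p"
    using frame_through[OF p(1)] .
  let ?A = "f \<circ> std_frame"
  define w :: "real^3" where "w = (\<chi> i. ?A (0, axis i 1) \<bullet> v)"
  have Aw: "?A (0, x) \<bullet> v = w \<bullet> x" for x
    unfolding w_def by (rule frame_inner[OF f(2)])
  \<comment> \<open>In this chart the equator is the plane orthogonal to \<open>w\<close> through
    the origin, since the origin represents \<open>p\<close>. Rotating the third axis to the
    direction of \<open>w\<close> gives a linear parametrization of it.\<close>
  obtain h :: "real^3 \<Rightarrow> real^3" where h: "orthogonal_transformation h" "h (norm w *\<^sub>R axis 3 1) = w"
    using orthogonal_transformation_exists[of "norm w *\<^sub>R axis 3 1" w] by auto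
  define Y where "Y z = h (vector [z $ 1, z $ 2, 0])" for z :: "real^2"
  have emb: "linear (\<lambda>z::real^2. vector [z $ 1, z $ 2, 0] :: real^3)"
    by (rule linearI) (auto simp: vec_eq_iff forall_3)
  have linY: "linear Y"
    unfolding Y_def using linear_compose[OF emb orthogonal_transformation_linear[OF h(1)]] by (simp add: o_def)
  have injY: "inj Y"
  proof (rule injI)
    fix a b assume "Y a = Y b"
    then have "(vector [a $ 1, a $ 2, 0] :: real^3) = vector [b $ 1, b $ 2, 0]"
      unfolding Y_def by (rule injD[OF orthogonal_transformation_inj[OF h(1)]])
    then show "a = b" by (simp add: vec_eq_iff forall_2 forall_3)
  qed
  have wY: "w \<bullet> Y z = 0" for z
  proof -
    have "w \<bullet> Y z = (norm w *\<^sub>R axis 3 1) \<bullet> (vector [z $ 1, z $ 2, 0] :: real^3)"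
      unfolding Y_def by (metis h orthogonal_transformation_def)
    then show ?thesis by (simp add: inner_axis')
  qed
  have dY: "frechet_derivative Y (at u) = Y" for u
    using frechet_derivative_at[OF linear_imp_has_derivative[OF linY]] by metis
  have "affine_param ?A (Y z) \<in> equator v" for z
    unfolding affine_param_in_equator[OF f(2)] frame_affine[OF f(2), of "Y z"] inner_add_left Aw wY
    using f p by simp
  then have "surface_patch (equator v) ?A UNIV Y"
    unfolding surface_patch_def using f(2) linY injY
    by (auto simp: dY intro!: smooth_on_bounded_linear linear_conv_bounded_linear[THEN iffD1])
  moreover have "P \<in> affine_param ?A ` Y ` UNIV"
  proof -
    have "Y 0 = 0" by (rule linear_0[OF linY])
    moreover have "affine_param ?A 0 = P" using affine_param_origin[OF f(2)] f(3) p by simp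
    ultimately show ?thesis by (metis imageI UNIV_I)
  qed
  ultimately show "\<exists>A V Y. surface_patch (equator v) A V Y \<and> P \<in> affine_param A ` Y ` V" by blast
next
  fix A V Y u \<nu>
  assume patch: "surface_patch (equator v) A V Y" and u: "u \<in> V" and \<nu>: "unit_normal (chart_metric A) Y u \<nu>"
  have A: "affine_frame A" using patch by (simp add: surface_patch_def)
  define w :: "real^3" where "w = (\<chi> i. A (0, axis i 1) \<bullet> v)"
  have Aw: "A (0, x) \<bullet> v = w \<bullet> x" for x
    unfolding w_def by (rule frame_inner[OF A])
  have eq: "w \<bullet> Y z = - (A (1, 0) \<bullet> v)" if "z \<in> V" for z
  proof -
    have "affine_param A (Y z) \<in> equator v" using patch that by (auto simp: surface_patch_def)
    then show ?thesis
      unfolding affine_param_in_equator[OF A] frame_affine[OF A, of "Y z"] inner_add_left Aw by simp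
  qed
  \<comment> \<open>If \<open>w\<close> were 0, then the point of the patch at \<open>u\<close>
    would make \<open>A (1, 0)\<close> orthogonal to \<open>v\<close> as well, and \<open>v\<close>
    would be orthogonal to the whole range of \<open>A\<close>.\<close>
  have "w \<noteq> 0"
  proof
    assume "w = 0"
    then have "A (0, x) \<bullet> v = 0" "A (1, 0) \<bullet> v = 0" for x using Aw eq[OF u] by auto
    then have "A (t, x) \<bullet> v = 0" for t x
      by (subst frame_split[OF A]) (simp add: inner_add_left)
    moreover obtain t x where "A (t, x) = v" using frame_bij[OF A] by (metis bij_pointE surj_pair)
    ultimately have "v \<bullet> v = 0" by metis
    then show False using v by auto
  qed
  then show "mean_curvature (chart_metric A) Y u \<nu> = 0"
    using patch u eq \<nu> unfolding surface_patch_def by (intro mean_curvature_plane_patch[OF A, of V Y w]) auto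
qed

section \<open>Curvature in the standard chart\<close>

text \<open>
  The polynomials below were found with a computer algebra system: the connection of the metric in
  the standard chart is \<open>conn_num / std_disc\<close>, its Ricci tensor is \<open>ricci_num / std_disc\<^sup>2\<close>, and
  its inverse coefficient matrix is \<open>std_cometric\<close>.
\<close>

definition std_disc :: "real^3 \<Rightarrow> real" where
  "std_disc x = 1 + 5 * (x$3)^2 + 4 * (x$2)^2 + 3 * (x$1)^2 + 6 * (x$3)^4 + 9 * (x$2)^2 * (x$3)^2 + 3 * (x$2)^4 + 8 * (x$1)^2 * (x$3)^2 + 5 * (x$1)^2 * (x$2)^2 + 2 * (x$1)^4"

definition std_disc_deriv :: "real^3 \<Rightarrow> real^3 \<Rightarrow> real" where
  "std_disc_deriv x w = (6 * x$1 + 16 * x$1 * (x$3)^2 + 10 * x$1 * (x$2)^2 + 8 * (x$1)^3) * w$1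
     + (8 * x$2 + 18 * x$2 * (x$3)^2 + 12 * (x$2)^3 + 10 * (x$1)^2 * x$2) * w$2
     + (10 * x$3 + 24 * (x$3)^3 + 18 * (x$2)^2 * x$3 + 16 * (x$1)^2 * x$3) * w$3"

definition conn_num :: "real^3 \<Rightarrow> real^3 \<Rightarrow> real^3 \<Rightarrow> real^3" where
  "conn_num x u v = vector [
       (- 3 * x$1 - 6 * x$1 * (x$3)^2 - 3 * x$1 * (x$2)^2 - 4 * (x$1)^3) * u$1 * v$1
       + (- 3 * x$2 - 6 * x$2 * (x$3)^2 - 3 * (x$2)^3 - 4 * (x$1)^2 * x$2) * (u$1 * v$2 + u$2 * v$1)
       + (- 3 * x$3 - 6 * (x$3)^3 - 3 * (x$2)^2 * x$3 - 4 * (x$1)^2 * x$3) * (u$1 * v$3 + u$3 * v$1)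
       + (x$1 + 3 * x$1 * (x$3)^2 + (x$1)^3) * u$2 * v$2
       + (- x$1 - 3 * x$1 * (x$2)^2 - 2 * (x$1)^3) * u$3 * v$3,
       (2 * x$2 + 4 * x$2 * (x$3)^2 + 2 * (x$2)^3) * u$1 * v$1
       + (- 2 * x$1 - 6 * x$1 * (x$3)^2 - 4 * x$1 * (x$2)^2 - 2 * (x$1)^3) * (u$1 * v$2 + u$2 * v$1)
       + (- 4 * x$2 - 12 * x$2 * (x$3)^2 - 6 * (x$2)^3 - 4 * (x$1)^2 * x$2) * u$2 * v$2
       + (- 2 * x$3 - 6 * (x$3)^3 - 2 * (x$1)^2 * x$3) * (u$2 * v$3 + u$3 * v$2)
       + (- 2 * x$2 - 6 * (x$2)^3 - 4 * (x$1)^2 * x$2) * u$3 * v$3,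
       (x$3 + 2 * (x$3)^3 + (x$2)^2 * x$3) * u$1 * v$1
       + (- x$1 - 4 * x$1 * (x$3)^2 - 3 * x$1 * (x$2)^2 - 2 * (x$1)^3) * (u$1 * v$3 + u$3 * v$1)
       + (- x$3 - 3 * (x$3)^3 - (x$1)^2 * x$3) * u$2 * v$2
       + (- x$2 - 3 * (x$2)^3 - 2 * (x$1)^2 * x$2) * (u$2 * v$3 + u$3 * v$2)
       + (- 5 * x$3 - 12 * (x$3)^3 - 15 * (x$2)^2 * x$3 - 10 * (x$1)^2 * x$3) * u$3 * v$3]"

definition conn_num_deriv :: "real^3 \<Rightarrow> real^3 \<Rightarrow> real^3 \<Rightarrow> real^3 \<Rightarrow> real^3" where
  "conn_num_deriv x w u v = vector [
       ((- 3 - 6 * (x$3)^2 - 3 * (x$2)^2 - 12 * (x$1)^2) * w$1 + (- 6 * x$1 * x$2) * w$2 + (- 12 * x$1 * x$3) * w$3) * u$1 * v$1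
       + ((- 8 * x$1 * x$2) * w$1 + (- 3 - 6 * (x$3)^2 - 9 * (x$2)^2 - 4 * (x$1)^2) * w$2 + (- 12 * x$2 * x$3) * w$3) * (u$1 * v$2 + u$2 * v$1)
       + ((- 8 * x$1 * x$3) * w$1 + (- 6 * x$2 * x$3) * w$2 + (- 3 - 18 * (x$3)^2 - 3 * (x$2)^2 - 4 * (x$1)^2) * w$3) * (u$1 * v$3 + u$3 * v$1)
       + ((1 + 3 * (x$3)^2 + 3 * (x$1)^2) * w$1 + (6 * x$1 * x$3) * w$3) * u$2 * v$2
       + ((- 1 - 3 * (x$2)^2 - 6 * (x$1)^2) * w$1 + (- 6 * x$1 * x$2) * w$2) * u$3 * v$3,
       ((2 + 4 * (x$3)^2 + 6 * (x$2)^2) * w$2 + (8 * x$2 * x$3) * w$3) * u$1 * v$1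
       + ((- 2 - 6 * (x$3)^2 - 4 * (x$2)^2 - 6 * (x$1)^2) * w$1 + (- 8 * x$1 * x$2) * w$2 + (- 12 * x$1 * x$3) * w$3) * (u$1 * v$2 + u$2 * v$1)
       + ((- 8 * x$1 * x$2) * w$1 + (- 4 - 12 * (x$3)^2 - 18 * (x$2)^2 - 4 * (x$1)^2) * w$2 + (- 24 * x$2 * x$3) * w$3) * u$2 * v$2
       + ((- 4 * x$1 * x$3) * w$1 + (- 2 - 18 * (x$3)^2 - 2 * (x$1)^2) * w$3) * (u$2 * v$3 + u$3 * v$2)
       + ((- 8 * x$1 * x$2) * w$1 + (- 2 - 18 * (x$2)^2 - 4 * (x$1)^2) * w$2) * u$3 * v$3,
       ((2 * x$2 * x$3) * w$2 + (1 + 6 * (x$3)^2 + (x$2)^2) * w$3) * u$1 * v$1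
       + ((- 1 - 4 * (x$3)^2 - 3 * (x$2)^2 - 6 * (x$1)^2) * w$1 + (- 6 * x$1 * x$2) * w$2 + (- 8 * x$1 * x$3) * w$3) * (u$1 * v$3 + u$3 * v$1)
       + ((- 2 * x$1 * x$3) * w$1 + (- 1 - 9 * (x$3)^2 - (x$1)^2) * w$3) * u$2 * v$2
       + ((- 4 * x$1 * x$2) * w$1 + (- 1 - 9 * (x$2)^2 - 2 * (x$1)^2) * w$2) * (u$2 * v$3 + u$3 * v$2)
       + ((- 20 * x$1 * x$3) * w$1 + (- 30 * x$2 * x$3) * w$2 + (- 5 - 36 * (x$3)^2 - 15 * (x$2)^2 - 10 * (x$1)^2) * w$3) * u$3 * v$3]"

definition ricci_num :: "real^3 \<Rightarrow> real^3^3" where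
  "ricci_num x = vector [
     vector [
       6 + 36 * (x$3)^2 + 18 * (x$2)^2 + 16 * (x$1)^2 + 72 * (x$3)^4 + 72 * (x$2)^2 * (x$3)^2 + 18 * (x$2)^4 + 52 * (x$1)^2 * (x$3)^2 + 32 * (x$1)^2 * (x$2)^2 + 12 * (x$1)^4 + 48 * (x$3)^6 + 72 * (x$2)^2 * (x$3)^4 + 36 * (x$2)^4 * (x$3)^2 + 6 * (x$2)^6 + 32 * (x$1)^2 * (x$3)^4 + 36 * (x$1)^2 * (x$2)^2 * (x$3)^2 + 8 * (x$1)^2 * (x$2)^4 + 16 * (x$1)^4 * (x$3)^2 + 4 * (x$1)^4 * (x$2)^2,
       - 2 * x$1 * x$2 - 8 * x$1 * x$2 * (x$3)^2 - 4 * (x$1)^3 * x$2 - 12 * x$1 * x$2 * (x$3)^4 - 12 * x$1 * (x$2)^3 * (x$3)^2 - 6 * x$1 * (x$2)^5 - 8 * (x$1)^3 * (x$2)^3 - 4 * (x$1)^5 * x$2,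
       - 8 * x$1 * x$3 - 36 * x$1 * (x$3)^3 - 16 * x$1 * (x$2)^2 * x$3 - 20 * (x$1)^3 * x$3 - 48 * x$1 * (x$3)^5 - 60 * x$1 * (x$2)^2 * (x$3)^3 - 24 * x$1 * (x$2)^4 * x$3 - 32 * (x$1)^3 * (x$3)^3 - 36 * (x$1)^3 * (x$2)^2 * x$3 - 16 * (x$1)^5 * x$3],
     vector [
       - 2 * x$1 * x$2 - 8 * x$1 * x$2 * (x$3)^2 - 4 * (x$1)^3 * x$2 - 12 * x$1 * x$2 * (x$3)^4 - 12 * x$1 * (x$2)^3 * (x$3)^2 - 6 * x$1 * (x$2)^5 - 8 * (x$1)^3 * (x$2)^3 - 4 * (x$1)^5 * x$2,
       4 + 36 * (x$3)^2 + 8 * (x$2)^2 + 12 * (x$1)^2 + 108 * (x$3)^4 + 78 * (x$2)^2 * (x$3)^2 + 12 * (x$2)^4 + 72 * (x$1)^2 * (x$3)^2 + 18 * (x$1)^2 * (x$2)^2 + 12 * (x$1)^4 + 108 * (x$3)^6 + 144 * (x$2)^2 * (x$3)^4 + 54 * (x$2)^4 * (x$3)^2 + 108 * (x$1)^2 * (x$3)^4 + 96 * (x$1)^2 * (x$2)^2 * (x$3)^2 + 6 * (x$1)^2 * (x$2)^4 + 36 * (x$1)^4 * (x$3)^2 + 8 * (x$1)^4 * (x$2)^2 + 4 * (x$1)^6,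
       - 18 * x$2 * x$3 - 84 * x$2 * (x$3)^3 - 48 * (x$2)^3 * x$3 - 48 * (x$1)^2 * x$2 * x$3 - 108 * x$2 * (x$3)^5 - 144 * (x$2)^3 * (x$3)^3 - 54 * (x$2)^5 * x$3 - 96 * (x$1)^2 * x$2 * (x$3)^3 - 84 * (x$1)^2 * (x$2)^3 * x$3 - 36 * (x$1)^4 * x$2 * x$3],
     vector [
       - 8 * x$1 * x$3 - 36 * x$1 * (x$3)^3 - 16 * x$1 * (x$2)^2 * x$3 - 20 * (x$1)^3 * x$3 - 48 * x$1 * (x$3)^5 - 60 * x$1 * (x$2)^2 * (x$3)^3 - 24 * x$1 * (x$2)^4 * x$3 - 32 * (x$1)^3 * (x$3)^3 - 36 * (x$1)^3 * (x$2)^2 * x$3 - 16 * (x$1)^5 * x$3,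
       - 18 * x$2 * x$3 - 84 * x$2 * (x$3)^3 - 48 * (x$2)^3 * x$3 - 48 * (x$1)^2 * x$2 * x$3 - 108 * x$2 * (x$3)^5 - 144 * (x$2)^3 * (x$3)^3 - 54 * (x$2)^5 * x$3 - 96 * (x$1)^2 * x$2 * (x$3)^3 - 84 * (x$1)^2 * (x$2)^3 * x$3 - 36 * (x$1)^4 * x$2 * x$3,
       2 + 8 * (x$3)^2 + 18 * (x$2)^2 + 12 * (x$1)^2 + 12 * (x$3)^4 + 96 * (x$2)^2 * (x$3)^2 + 54 * (x$2)^4 + 36 * (x$1)^2 * (x$3)^2 + 72 * (x$1)^2 * (x$2)^2 + 24 * (x$1)^4 + 108 * (x$2)^2 * (x$3)^4 + 144 * (x$2)^4 * (x$3)^2 + 54 * (x$2)^6 + 48 * (x$1)^2 * (x$3)^4 + 156 * (x$1)^2 * (x$2)^2 * (x$3)^2 + 108 * (x$1)^2 * (x$2)^4 + 32 * (x$1)^4 * (x$3)^2 + 72 * (x$1)^4 * (x$2)^2 + 16 * (x$1)^6]]"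

definition std_cometric :: "real^3 \<Rightarrow> real^3^3" where
  "std_cometric x = vector [
     vector [
       1 + 3 * (x$3)^2 + 3 * (x$2)^2 + 3 * (x$1)^2 + 6 * (x$1)^2 * (x$3)^2 + 3 * (x$1)^2 * (x$2)^2 + 2 * (x$1)^4,
       x$1 * x$2 + 6 * x$1 * x$2 * (x$3)^2 + 3 * x$1 * (x$2)^3 + 2 * (x$1)^3 * x$2,
       2 * x$1 * x$3 + 6 * x$1 * (x$3)^3 + 3 * x$1 * (x$2)^2 * x$3 + 2 * (x$1)^3 * x$3],
     vector [
       x$1 * x$2 + 6 * x$1 * x$2 * (x$3)^2 + 3 * x$1 * (x$2)^3 + 2 * (x$1)^3 * x$2,
       1 + 2 * (x$3)^2 + 4 * (x$2)^2 + 2 * (x$1)^2 + 6 * (x$2)^2 * (x$3)^2 + 3 * (x$2)^4 + 2 * (x$1)^2 * (x$2)^2,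
       3 * x$2 * x$3 + 6 * x$2 * (x$3)^3 + 3 * (x$2)^3 * x$3 + 2 * (x$1)^2 * x$2 * x$3],
     vector [
       2 * x$1 * x$3 + 6 * x$1 * (x$3)^3 + 3 * x$1 * (x$2)^2 * x$3 + 2 * (x$1)^3 * x$3,
       3 * x$2 * x$3 + 6 * x$2 * (x$3)^3 + 3 * (x$2)^3 * x$3 + 2 * (x$1)^2 * x$2 * x$3,
       1 + 5 * (x$3)^2 + (x$2)^2 + (x$1)^2 + 6 * (x$3)^4 + 3 * (x$2)^2 * (x$3)^2 + 2 * (x$1)^2 * (x$3)^2]]"

section \<open>Verification of the polynomial formulas for connection, Ricci tensor and scalar
  curvature\<close>

abbreviation std_metric :: "real^3 \<Rightarrow> real^3^3" where
  "std_metric \<equiv> chart_metric std_frame"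

lemma std_disc_eq: "killing_disc (std_frame (1, x)) = std_disc x"
  by (simp add: killing_disc_def std_disc_def algebra_simps)

lemma std_disc_pos: "std_disc x > 0"
  unfolding std_disc_eq[symmetric] by (intro killing_disc_pos frame_point_nonzero affine_frame_std)

lemma std_disc_has_derivative: "(std_disc has_derivative std_disc_deriv x) (at x)"
proof -
  note nth = bounded_linear.has_derivative[OF bounded_linear_vec_nth has_derivative_ident]
  show ?thesis
    unfolding std_disc_def[abs_def]
    by (rule has_derivative_eq_rhs, (rule derivative_intros nth)+)
      (simp add: fun_eq_iff std_disc_deriv_def power2_eq_square power3_eq_cube power4_eq_xxxx algebra_simps)
qed

lemma std_disc_deriv_eq: "disc_deriv (std_frame (1, x)) (std_frame (0, w)) = std_disc_deriv x w"
proof -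
  have "((\<lambda>x. killing_disc (std_frame (1, x))) has_derivative (\<lambda>w. disc_deriv (std_frame (1, x)) (std_frame (0, w)))) (at x)"
    using diff_chain_at[OF frame_has_derivative[OF affine_frame_std] killing_disc_has_derivative] by (simp add: o_def)
  from has_derivative_unique[OF this[unfolded std_disc_eq] std_disc_has_derivative] show ?thesis
    by (rule fun_cong)
qed

lemma bilinear_conn_num: "bilinear (conn_num x)"
  unfolding bilinear_def
  by (intro conjI allI linearI; simp add: vec_eq_iff forall_3 conn_num_def algebra_simps)

text \<open>Koszul's formula for the candidate connection with all denominators cleared, which makes
  it a polynomial identity in the coordinates.\<close>

lemma std_koszul:
  "2 * killing_form (std_frame (1, x)) (std_frame (0, conn_num x u v)) (std_frame (0, w)) =
    std_disc x * (killing_polar (std_frame (1, x)) (std_frame (0, u)) (std_frame (0, v)) (std_frame (0, w))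
      + killing_polar (std_frame (1, x)) (std_frame (0, v)) (std_frame (0, u)) (std_frame (0, w))
      - killing_polar (std_frame (1, x)) (std_frame (0, w)) (std_frame (0, u)) (std_frame (0, v)))
    - (killing_form (std_frame (1, x)) (std_frame (0, v)) (std_frame (0, w)) * std_disc_deriv x u
      + killing_form (std_frame (1, x)) (std_frame (0, u)) (std_frame (0, w)) * std_disc_deriv x v
      - killing_form (std_frame (1, x)) (std_frame (0, u)) (std_frame (0, v)) * std_disc_deriv x w)"
  unfolding killing_form_def killing_polar_def minor2_def conn_num_def std_disc_deriv_def
      std_disc_def std_frame_nth vector_3 vector_add_component by algebra
lemma std_connection:
  "connection std_metric x u v = (1 / std_disc x) *\<^sub>R conn_num x u v"
proof -
  note G = smooth_metric_coord_metric[OF affine_frame_std]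
  have d: "std_disc x \<noteq> 0" using std_disc_pos[of x] by simp
  show ?thesis
  proof (rule connection_unique[OF G])
    fix w :: "real^3"
    have lin: "killing_form p (std_frame (0, c *\<^sub>R z)) q = c * killing_form p (std_frame (0, z)) q" for p q c z
      using linear_scale[OF frame_linear_part[OF affine_frame_std], of c z]
      by (simp add: bilinear_lmul[OF bilinear_killing_form])
    have arith: "2 * (1 / D * a / D) = (p1 / D - k1 * d1 / D\<^sup>2) + (p2 / D - k2 * d2 / D\<^sup>2) - (p3 / D - k3 * d3 / D\<^sup>2)"
      if "2 * a = D * (p1 + p2 - p3) - (k1 * d1 + k2 * d2 - k3 * d3)" "D \<noteq> 0" for a D p1 p2 p3 k1 k2 k3 d1 d2 d3 :: real
    proof -
      have "2 * (1 / D * a / D) = (2 * a) / D\<^sup>2" by (simp add: power2_eq_square)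
      also have "\<dots> = (D * (p1 + p2 - p3)) / D\<^sup>2 - (k1 * d1 + k2 * d2 - k3 * d3) / D\<^sup>2"
        unfolding that(1) by (simp add: diff_divide_distrib)
      also have "(D * (p1 + p2 - p3)) / D\<^sup>2 = (p1 + p2 - p3) / D"
        using that(2) by (simp add: power2_eq_square)
      finally show ?thesis by (simp add: add_divide_distrib diff_divide_distrib)
    qed
    show "2 * metric_prod std_metric x ((1 / std_disc x) *\<^sub>R conn_num x u v) w =
      metric_deriv std_metric x u v w + metric_deriv std_metric x v u w
      - metric_deriv std_metric x w u v"
      unfolding coord_metric_prod[OF affine_frame_std] chart_metric_deriv[OF affine_frame_std]
        std_disc_eq std_disc_deriv_eq lin
      by (rule arith[OF std_koszul d])
  qed
qed

lemma conn_num_has_derivative: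
  "((\<lambda>x. conn_num x u v) has_derivative (\<lambda>w. conn_num_deriv x w u v)) (at x)"
proof -
  note nth = bounded_linear.has_derivative[OF bounded_linear_vec_nth has_derivative_ident]
  have "((\<lambda>x. conn_num x u v $ k) has_derivative (\<lambda>w. conn_num_deriv x w u v $ k)) (at x)" for k
    by (insert exhaust_3[of k], elim disjE; hypsubst; simp only: conn_num_def conn_num_deriv_def vector_3;
        rule has_derivative_eq_rhs, (rule derivative_intros nth)+,
        simp add: fun_eq_iff power2_eq_square power3_eq_cube algebra_simps)
  then show ?thesis
    unfolding has_derivative_componentwise_within[of "\<lambda>x. conn_num x u v"]
    by (auto simp: Basis_vec_def inner_axis)
qed

lemma std_connection_deriv:
  "connection_deriv std_metric x w u v =
    (1 / (std_disc x)\<^sup>2) *\<^sub>R (std_disc x *\<^sub>R conn_num_deriv x w u v - std_disc_deriv x w *\<^sub>R conn_num x u v)"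
  unfolding connection_deriv_def std_connection
proof (rule dirderivI)
  have d: "std_disc x \<noteq> 0" using std_disc_pos[of x] by simp
  show "((\<lambda>y. (1 / std_disc y) *\<^sub>R conn_num y u v) has_derivative (\<lambda>w. (1 / (std_disc x)\<^sup>2) *\<^sub>R
     (std_disc x *\<^sub>R conn_num_deriv x w u v - std_disc_deriv x w *\<^sub>R conn_num x u v))) (at x)"
    by (rule has_derivative_eq_rhs[OF has_derivative_scaleR[OF has_derivative_divide'[OF has_derivative_const
              std_disc_has_derivative d] conn_num_has_derivative]])
      (use d in \<open>simp add: fun_eq_iff vec_eq_iff field_simps power2_eq_square\<close>)
qed

text \<open>Derivatives and products of the connection both have denominator \<open>std_disc\<close>
  squared; clearing it reduces \<open>std_ricci\<close> to a polynomial identity.\<close>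

lemma std_ricci_sum:
  "(std_disc x)\<^sup>2 * ricci std_metric x u v = (\<Sum>k\<in>UNIV.
     std_disc x * conn_num_deriv x (axis k 1) u v $ k - std_disc_deriv x (axis k 1) * conn_num x u v $ k
     - (std_disc x * conn_num_deriv x v u (axis k 1) $ k - std_disc_deriv x v * conn_num x u (axis k 1) $ k)
     + conn_num x (axis k 1) (conn_num x u v) $ k - conn_num x v (conn_num x u (axis k 1)) $ k)"
proof -
  have d: "std_disc x \<noteq> 0" using std_disc_pos[of x] by simp
  have "(std_disc x)\<^sup>2 * riemann std_metric x u v w $ k =
     std_disc x * conn_num_deriv x w u v $ k - std_disc_deriv x w * conn_num x u v $ k
     - (std_disc x * conn_num_deriv x v u w $ k - std_disc_deriv x v * conn_num x u w $ k)
     + conn_num x w (conn_num x u v) $ k - conn_num x v (conn_num x u w) $ k" for w k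
    unfolding riemann_def std_connection_deriv std_connection
    using d by (simp add: bilinear_rmul[OF bilinear_conn_num] field_simps power2_eq_square)
  then show ?thesis
    by (simp add: ricci_def trace_def matrix_def sum_distrib_left)
qed

lemma axis_3_nth:
  "(axis 1 1 :: real^3) $ 1 = 1" "(axis 1 1 :: real^3) $ 2 = 0" "(axis 1 1 :: real^3) $ 3 = 0"
  "(axis 2 1 :: real^3) $ 1 = 0" "(axis 2 1 :: real^3) $ 2 = 1" "(axis 2 1 :: real^3) $ 3 = 0"
  "(axis 3 1 :: real^3) $ 1 = 0" "(axis 3 1 :: real^3) $ 2 = 0" "(axis 3 1 :: real^3) $ 3 = 1"
  by (simp_all add: axis_def)

lemma std_ricci: "(std_disc x)\<^sup>2 * ricci std_metric x u v = u \<bullet> (ricci_num x *v v)"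
  unfolding std_ricci_sum
  unfolding sum_3 inner_vec_def matrix_vector_mult_def vec_lambda_beta inner_real_def
    conn_num_def conn_num_deriv_def std_disc_def std_disc_deriv_def ricci_num_def vector_3 axis_3_nth
  by algebra

lemma std_metric_entry:
  "std_disc x * std_metric x $ i $ j =
    killing_form (std_frame (1, x)) (std_frame (0, axis i 1)) (std_frame (0, axis j 1))"
  using std_disc_pos[of x] by (simp add: coord_metric_entry[OF affine_frame_std] std_disc_eq)

text \<open>Tested on pairs of vectors, the inverse relation has the single denominator
  \<open>std_disc\<close> and becomes a polynomial identity.\<close>

lemma std_metric_inverse: "matrix_inv (std_metric x) = std_cometric x"
proof (rule matrix_inv_unique)
  have "killing_form (std_frame (1, x)) (std_frame (0, u)) (std_frame (0, std_cometric x *v v)) = std_disc x * (u \<bullet> v)" for u v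
    unfolding killing_form_def minor2_def std_cometric_def std_disc_def matrix_vector_mult_def vec_lambda_beta sum_3
      std_frame_nth vector_3 inner_vec_def inner_real_def by algebra
  then have "u \<bullet> (std_metric x *v (std_cometric x *v v)) = u \<bullet> v" for u v
    using std_disc_pos[of x]
    by (simp add: coord_metric_prod[OF affine_frame_std, unfolded metric_prod_def] std_disc_eq)
  then have "std_metric x *v (std_cometric x *v v) = v" for v
    by (metis vector_eq_ldot)
  then show "std_metric x ** std_cometric x = mat 1"
    by (simp add: matrix_eq flip: matrix_vector_mul_assoc)
qed

lemma std_ricci_matrix: "(std_disc x)\<^sup>2 * ricci_matrix std_metric x $ i $ j = ricci_num x $ i $ j"
  by (simp add: ricci_matrix_def std_ricci inner_axis' matrix_vector_mult_basis column_def)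

text \<open>One factor \<open>std_disc\<close> divides the contraction of
  \<open>std_cometric\<close> with \<open>ricci_num\<close>. The remaining numerator is a positive
  combination of even monomials containing all three squares, so the curvature is below 12 away from
  the origin.\<close>

lemma std_scalar_curvature:
  "std_disc x * (12 - scalar_curvature std_metric x) =
     4 * (x$1)^2 + 16 * (x$2)^2 + 4 * (x$3)^2 + 4 * (x$1)^2 * (x$2)^2 + 12 * (x$2)^2 * (x$3)^2 + 32 * (x$1)^2 * (x$3)^2"
    (is "_ = ?N")
proof -
  let ?S = "\<Sum>i\<in>UNIV. \<Sum>k\<in>UNIV. std_cometric x $ i $ k * ricci_num x $ k $ i"
  have "(std_disc x)\<^sup>2 * scalar_curvature std_metric x =
      (\<Sum>i\<in>UNIV. \<Sum>k\<in>UNIV. std_cometric x $ i $ k * ((std_disc x)\<^sup>2 * ricci_matrix std_metric x $ k $ i))"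
    unfolding scalar_curvature_def std_metric_inverse trace_def matrix_matrix_mult_def
    by (simp add: sum_distrib_left mult_ac)
  then have 1: "(std_disc x)\<^sup>2 * scalar_curvature std_metric x = ?S" unfolding std_ricci_matrix .
  have "?S = std_disc x * (12 * std_disc x - ?N)"
    unfolding sum_3 std_cometric_def ricci_num_def std_disc_def vector_3 by algebra
  then have "std_disc x * (std_disc x * (12 - scalar_curvature std_metric x)) = std_disc x * ?N"
    using 1 by (simp add: algebra_simps power2_eq_square)
  then show ?thesis using std_disc_pos[of x] by simp
qed

lemma std_scalar_curvature_eq_iff: "scalar_curvature std_metric x = 12 \<longleftrightarrow> x = 0"
proof
  assume "scalar_curvature std_metric x = 12"
  then have "4 * (x$1)^2 + 16 * (x$2)^2 + 4 * (x$3)^2 + 4 * (x$1)^2 * (x$2)^2 + 12 * (x$2)^2 * (x$3)^2 + 32 * (x$1)^2 * (x$3)^2 = 0"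
    using std_scalar_curvature[of x] by simp
  moreover have "0 \<le> 4 * (x$1)^2 * (x$2)^2" "0 \<le> 12 * (x$2)^2 * (x$3)^2" "0 \<le> 32 * (x$1)^2 * (x$3)^2" by simp_all
  ultimately have "(x$1)^2 + (x$2)^2 + (x$3)^2 \<le> 0"
    using zero_le_power2[of "x$1"] zero_le_power2[of "x$2"] zero_le_power2[of "x$3"] by linarith
  then have "(x$1)^2 = 0 \<and> (x$2)^2 = 0 \<and> (x$3)^2 = 0"
    using zero_le_power2[of "x$1"] zero_le_power2[of "x$2"] zero_le_power2[of "x$3"] by linarith
  then show "x = 0" by (simp add: vec_eq_iff forall_3)
next
  assume "x = 0"
  then show "scalar_curvature std_metric x = 12"
    using std_scalar_curvature[of x] std_disc_pos[of x] by simp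
qed

definition diag3 :: "real \<Rightarrow> real \<Rightarrow> real \<Rightarrow> real^3^3" where
  "diag3 a b c = vector [vector [a, 0, 0], vector [0, b, 0], vector [0, 0, c]]"

lemma std_disc_0: "std_disc 0 = 1"
  by (simp add: std_disc_def)

text \<open>At the first basis vector only the minors with index 1 survive, and their weights are
  all 1. Hence orthogonality at the origin is the Euclidean one.\<close>

lemma std_metric_0: "std_metric 0 = mat 1"
proof -
  have "std_metric 0 $ i $ j = (mat 1 :: real^3^3) $ i $ j" for i j
    using std_metric_entry[of 0 i j]
    by (insert exhaust_3[of i] exhaust_3[of j], elim disjE; hypsubst;
        simp add: std_disc_0 killing_form_def minor2_def axis_3_nth mat_def)
  then show ?thesis by (simp add: vec_eq_iff)
qed

lemma std_ricci_matrix_0: "ricci_matrix std_metric 0 = diag3 6 4 2"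
  using std_ricci_matrix[of 0] by (simp add: vec_eq_iff forall_3 std_disc_0 ricci_num_def diag3_def)

subsection \<open>Sign changes\<close>

definition sign_change :: "(3 \<Rightarrow> real) \<Rightarrow> real^3 \<Rightarrow> real^3" where
  "sign_change s x = (\<chi> i. s i * x $ i)"

lemma linear_sign_change: "linear (sign_change s)"
  by (rule linearI) (simp_all add: sign_change_def vec_eq_iff algebra_simps)

text \<open>Because the curvature tensor is diagonal, each minor occurs paired with itself and its
  sign cancels; the discriminant contains only even powers.\<close>

lemma std_metric_sign_change:
  assumes "\<And>i. s i = 1 \<or> s i = -1"
  shows "metric_prod std_metric (sign_change s x) (sign_change s v) (sign_change s w) = metric_prod std_metric x v w"
proof -
  have "killing_form (std_frame (1, sign_change s x)) (std_frame (0, sign_change s v)) (std_frame (0, sign_change s w))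
      = killing_form (std_frame (1, x)) (std_frame (0, v)) (std_frame (0, w))"
    using assms[of 1] assms[of 2] assms[of 3]
    by (elim disjE) (simp_all add: killing_form_def minor2_def sign_change_def algebra_simps)
  moreover have "std_disc (sign_change s x) = std_disc x"
    using assms[of 1] assms[of 2] assms[of 3]
    by (elim disjE) (simp_all add: std_disc_def sign_change_def)
  ultimately show ?thesis by (simp add: coord_metric_prod[OF affine_frame_std] std_disc_eq)
qed

text \<open>The hypotheses say that \<open>L\<close> is orthogonal and commutes with a diagonal
  matrix. Distinct eigenvalues make \<open>L\<close> diagonal, and orthogonality makes its entries
  signs.\<close>

lemma orthogonal_diag3_commute:
  assumes L: "transpose L ** L = mat 1" "transpose L ** diag3 a b c ** L = diag3 a b c"
    and abc: "a \<noteq> b" "a \<noteq> c" "b \<noteq> c"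
  obtains s where "\<And>i. s i = 1 \<or> s i = -1" "\<And>x. L *v x = sign_change s x"
proof -
  have L': "L ** transpose L = mat 1" using L(1) by (simp add: matrix_left_right_inverse)
  have "L ** (transpose L ** diag3 a b c ** L) = (L ** transpose L) ** diag3 a b c ** L"
    by (simp add: matrix_mul_assoc)
  then have comm: "L ** diag3 a b c = diag3 a b c ** L" by (simp add: L L')
  have off: "L $ 1 $ 2 = 0" "L $ 1 $ 3 = 0" "L $ 2 $ 1 = 0" "L $ 2 $ 3 = 0" "L $ 3 $ 1 = 0" "L $ 3 $ 2 = 0"
    using comm abc by (simp_all add: vec_eq_iff forall_3 matrix_matrix_mult_def sum_3 diag3_def mult.commute)
  have diag: "(L $ i $ i)^2 = 1" for i
    using L(1) exhaust_3[of i]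
    by (auto simp: vec_eq_iff forall_3 matrix_matrix_mult_def sum_3 transpose_def mat_def off power2_eq_square)
  have 1: "L $ i $ i = 1 \<or> L $ i $ i = -1" for i
    using diag[of i] by (simp add: power2_eq_1_iff)
  have 2: "L *v x = sign_change (\<lambda>i. L $ i $ i) x" for x
    by (simp add: vec_eq_iff forall_3 matrix_vector_mult_def sum_3 sign_change_def off)
  from that[OF 1 2] show ?thesis .
qed

section \<open>Topology of the projective space\<close>

lemma continuous_affine_lift: "affine_frame A \<Longrightarrow> continuous_on UNIV (affine_lift A)"
  using affine_lift_partial[of A]
  by (metis continuous_at_imp_continuous_on differentiable_imp_continuous_within)

lemma continuous_affine_param:
  assumes A: "affine_frame A" shows "continuous_on UNIV (affine_param A)"
  unfolding continuous_on_open_vimage[OF open_UNIV]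
proof (intro allI impI)
  fix U :: "rp3 set" assume "open U"
  then obtain W where W: "open W" "{p \<in> sphere 0 1. antipodal_class p \<in> U} = sphere 0 1 \<inter> W"
    unfolding open_rp3_def openin_open by blast
  have "affine_param A x \<in> U \<longleftrightarrow> affine_lift A x \<in> W" for x
    using W(2) norm_affine_lift[OF A, of x] unfolding affine_param_def by (auto simp: set_eq_iff)
  then have "affine_param A -` U \<inter> UNIV = affine_lift A -` W \<inter> UNIV" by auto
  then show "open (affine_param A -` U \<inter> UNIV)"
    using continuous_affine_lift[OF A] W(1) by (simp add: continuous_on_open_vimage[OF open_UNIV])
qed

text \<open>\<open>inv A p\<close> gives homogeneous coordinates of the line through
  \<open>p\<close>, and dividing by the first one inverts the chart. Neither the condition nor the
  quotient depends on the sign of \<open>p\<close>.\<close>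

lemma antipodal_class_in_image_iff:
  assumes A: "affine_frame A" and p: "norm p = 1"
  shows "antipodal_class p \<in> affine_param A ` W \<longleftrightarrow>
    fst (inv A p) \<noteq> 0 \<and> (1 / fst (inv A p)) *\<^sub>R snd (inv A p) \<in> W"
proof
  assume "antipodal_class p \<in> affine_param A ` W"
  then obtain x where x: "x \<in> W" "antipodal_class p = antipodal_class (affine_lift A x)"
    by (auto simp: affine_param_def)
  let ?r = "inverse (norm (A (1, x)))"
  have r: "?r \<noteq> 0" using frame_point_nonzero[OF A] by simp
  have "p = affine_lift A x \<or> p = - affine_lift A x"
    using x(2) p norm_affine_lift[OF A] by (simp add: antipodal_class_eq_iff)
  then obtain t where t: "t \<noteq> 0" "p = t *\<^sub>R A (1, x)"
  proof
    assume "p = affine_lift A x" then show ?thesis using that[of ?r] r by (simp add: affine_lift_eq)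
  next
    assume "p = - affine_lift A x" then show ?thesis using that[of "- ?r"] r by (simp add: affine_lift_eq)
  qed
  have "p = A (t *\<^sub>R (1, x))" unfolding t(2) by (simp only: linear_scale[OF frame_linear[OF A]])
  then have "inv A p = t *\<^sub>R (1, x)" using frame_bij[OF A] by (simp add: bij_is_inj)
  then show "fst (inv A p) \<noteq> 0 \<and> (1 / fst (inv A p)) *\<^sub>R snd (inv A p) \<in> W" using t x by simp
next
  let ?t = "fst (inv A p)" and ?x = "(1 / fst (inv A p)) *\<^sub>R snd (inv A p)"
  assume t: "?t \<noteq> 0 \<and> ?x \<in> W"
  have "p = A (inv A p)" using frame_bij[OF A] by (simp add: bij_is_surj surj_f_inv_f)
  also have "inv A p = ?t *\<^sub>R (1, ?x)" using t by (simp add: prod_eq_iff)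
  finally have pt: "p = ?t *\<^sub>R A (1, ?x)" by (simp only: linear_scale[OF frame_linear[OF A]])
  have "sgn p = p" using p by (simp add: sgn_div_norm)
  moreover have "sgn p = sgn ?t *\<^sub>R affine_lift A ?x"
    by (subst pt) (simp only: sgn_scaleR affine_lift_def)
  moreover have "sgn ?t = 1 \<or> sgn ?t = -1" using t by (simp add: sgn_real_def)
  ultimately have "p = affine_lift A ?x \<or> p = - affine_lift A ?x" by auto
  then have "antipodal_class p = affine_param A ?x"
    using p norm_affine_lift[OF A, of ?x] unfolding affine_param_def by (simp add: antipodal_class_eq_iff)
  then show "antipodal_class p \<in> affine_param A ` W" using t by blast
qed

lemma open_affine_param_image:
  assumes A: "affine_frame A" and W: "open W" shows "open (affine_param A ` W)"
proof -
  have linB: "linear (inv A)"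
    using frame_bij[OF A]
    by (intro linearI; intro inv_f_eq bij_is_inj)
      (simp_all add: linear_add[OF frame_linear[OF A]] linear_scale[OF frame_linear[OF A]] bij_is_surj surj_f_inv_f)
  have contB: "continuous_on S (inv A)" for S by (rule linear_continuous_on[OF linear_conv_bounded_linear[THEN iffD1, OF linB]])
  define T where "T = {p. fst (inv A p) \<noteq> 0}"
  have T: "open T" unfolding T_def
    by (intro open_Collect_neq continuous_on_fst contB continuous_on_const)
  have "continuous_on T (\<lambda>p. (1 / fst (inv A p)) *\<^sub>R snd (inv A p))"
    by (intro continuous_intros contB) (auto simp: T_def)
  then have O: "open (T \<inter> (\<lambda>p. (1 / fst (inv A p)) *\<^sub>R snd (inv A p)) -` W)"
    by (rule continuous_open_preimage[OF _ T W])
  have "{p \<in> sphere 0 1. antipodal_class p \<in> affine_param A ` W}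
      = sphere 0 1 \<inter> (T \<inter> (\<lambda>p. (1 / fst (inv A p)) *\<^sub>R snd (inv A p)) -` W)"
  proof (rule set_eqI)
    fix r show "r \<in> {p \<in> sphere 0 1. antipodal_class p \<in> affine_param A ` W} \<longleftrightarrow>
        r \<in> sphere 0 1 \<inter> (T \<inter> (\<lambda>p. (1 / fst (inv A p)) *\<^sub>R snd (inv A p)) -` W)"
      by (cases "norm r = 1") (simp_all add: antipodal_class_in_image_iff[OF A] T_def)
  qed
  then show ?thesis unfolding open_rp3_def using O by (auto simp: openin_open)
qed

lemma open_range_affine_param: "affine_frame A \<Longrightarrow> open (range (affine_param A))"
  by (intro open_affine_param_image open_UNIV)

lemma affine_param_inj:
  assumes A: "affine_frame A" shows "inj (affine_param A)"
proof (rule injI)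
  fix x y assume "affine_param A x = affine_param A y"
  then have "antipodal_class (affine_lift A x) \<in> affine_param A ` {y}" by (simp flip: affine_param_def)
  then have y: "(1 / fst (inv A (affine_lift A x))) *\<^sub>R snd (inv A (affine_lift A x)) = y"
    unfolding antipodal_class_in_image_iff[OF A norm_affine_lift[OF A]] by simp
  have "antipodal_class (affine_lift A x) \<in> affine_param A ` {x}" by (simp add: affine_param_def)
  then have "(1 / fst (inv A (affine_lift A x))) *\<^sub>R snd (inv A (affine_lift A x)) = x"
    unfolding antipodal_class_in_image_iff[OF A norm_affine_lift[OF A]] by simp
  with y show "x = y" by simp
qed

lemma frame_containing:
  obtains A where "affine_frame A" "P \<in> range (affine_param A)"
proof -
  obtain p where p: "norm p = 1" "P = antipodal_class p" by (rule antipodal_class_cases)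
  obtain f where f: "affine_frame (f \<circ> std_frame)" "(f \<circ> std_frame) (1, 0) = p"
    using frame_through[OF p(1)] by blast
  have "affine_param (f \<circ> std_frame) 0 = P" using affine_param_origin[OF f(1)] f(2) p by simp
  then show ?thesis using that f(1) by blast
qed

instance rp3 :: t2_space
proof
  fix P Q :: rp3 assume ne: "P \<noteq> Q"
  obtain p where p: "norm p = 1" "P = antipodal_class p" by (rule antipodal_class_cases)
  obtain q where q: "norm q = 1" "Q = antipodal_class q" by (rule antipodal_class_cases)
  \<comment> \<open>The lines making a smaller angle with \<open>a\<close> than with
    \<open>b\<close>: squares ignore the choice of sign, and the strict comparison makes
    \<open>S p q\<close> and \<open>S q p\<close> disjoint.\<close>
  define S where "S a b = antipodal_class ` {r \<in> sphere 0 1. (r \<bullet> b)\<^sup>2 < (r \<bullet> a)\<^sup>2}" for a b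
  have mem: "antipodal_class r \<in> S a b \<longleftrightarrow> (r \<bullet> b)\<^sup>2 < (r \<bullet> a)\<^sup>2" if "norm r = 1" for r a b
    unfolding S_def using that by (auto simp: antipodal_class_eq_iff)
  have opn: "open (S a b)" for a b
  proof -
    have "{r \<in> sphere 0 1. antipodal_class r \<in> S a b} = sphere 0 1 \<inter> {r. (r \<bullet> b)\<^sup>2 < (r \<bullet> a)\<^sup>2}"
      by (auto simp: mem)
    moreover have "open {r :: real^4. (r \<bullet> b)\<^sup>2 < (r \<bullet> a)\<^sup>2}"
      by (intro open_Collect_less continuous_intros)
    ultimately show ?thesis unfolding open_rp3_def by (auto simp: openin_open)
  qed
  have pq: "p \<noteq> q" "p \<noteq> - q" using ne p q by (auto simp: antipodal_class_eq_iff)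
  have "(p \<bullet> q)\<^sup>2 < 1"
  proof -
    have "\<bar>p \<bullet> q\<bar> \<le> 1" using Cauchy_Schwarz_ineq2[of p q] p q by simp
    moreover have "\<bar>p \<bullet> q\<bar> \<noteq> 1"
      using pq norm_cauchy_schwarz_abs_eq[of p q] p q by auto
    ultimately show ?thesis by (simp add: abs_square_less_1)
  qed
  then have "P \<in> S p q" "Q \<in> S q p"
    using p q by (auto simp: mem dot_square_norm inner_commute)
  moreover have "S p q \<inter> S q p = {}"
  proof -
    have "R \<notin> S q p" if R: "R \<in> S p q" for R
    proof -
      obtain r where r: "norm r = 1" "R = antipodal_class r" by (rule antipodal_class_cases)
      then show ?thesis using R by (simp add: mem)
    qed
    then show ?thesis by blast
  qed
  ultimately show "\<exists>U V. open U \<and> open V \<and> P \<in> U \<and> Q \<in> V \<and> U \<inter> V = {}"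
    using opn[of p q] opn[of q p] by (intro exI[of _ "S p q"] exI[of _ "S q p"]) simp
qed

text \<open>The standard chart is dense: it misses only lines with first coordinate 0, and a small
  move along the first axis returns to it. Separated values at a missing point would persist
  nearby.\<close>

lemma continuous_eq_on_std_chart:
  fixes F H :: "rp3 \<Rightarrow> rp3"
  assumes F: "continuous_on UNIV F" and H: "continuous_on UNIV H"
    and eq: "\<And>x. F (affine_param std_frame x) = H (affine_param std_frame x)"
  shows "F = H"
proof (rule ccontr)
  assume "F \<noteq> H"
  then obtain P where P: "F P \<noteq> H P" by auto
  obtain p where p: "norm p = 1" "P = antipodal_class p" by (rule antipodal_class_cases)
  obtain U V where UV: "open U" "open V" "F P \<in> U" "H P \<in> V" "U \<inter> V = {}"
    using hausdorff[OF P] by blast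
  have "open (F -` U \<inter> H -` V)"
    using F H UV by (intro open_Int) (auto simp: continuous_on_open_vimage[OF open_UNIV])
  then obtain W where W: "open W" "{r \<in> sphere 0 1. antipodal_class r \<in> F -` U \<inter> H -` V} = sphere 0 1 \<inter> W"
    unfolding open_rp3_def openin_open by blast
  define c where "c t = sgn (p + t *\<^sub>R axis 1 1)" for t :: real
  have p0: "p \<noteq> 0" using p by auto
  have "((\<lambda>t. p + t *\<^sub>R axis 1 1) \<longlongrightarrow> p + 0 *\<^sub>R axis 1 1) (at_right 0)"
    by (intro tendsto_intros)
  then have lim: "((\<lambda>t. p + t *\<^sub>R axis 1 1) \<longlongrightarrow> p) (at_right 0)" by simp
  then have "(c \<longlongrightarrow> sgn p) (at_right 0)"
    unfolding c_def[abs_def] using p0 by (rule tendsto_sgn)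
  moreover have sp: "sgn p = p" using p by (simp add: sgn_div_norm)
  moreover have "p \<in> W" using W(2) p UV by auto
  ultimately have "\<forall>\<^sub>F t in at_right 0. c t \<in> W" using W(1) by (auto intro: topological_tendstoD)
  moreover have "\<forall>\<^sub>F t in at_right 0. p + t *\<^sub>R axis 1 1 \<noteq> 0"
    by (rule tendsto_imp_eventually_ne[OF lim p0])
  \<comment> \<open>Keeps the first coordinate \<open>p $ 1 + t\<close> nonzero, so that the
    perturbed point is in the standard chart.\<close>
  moreover have "\<forall>\<^sub>F t in at_right 0. t \<noteq> - p $ 1"
  proof (cases "p $ 1 = 0")
    case True then show ?thesis by (auto simp: eventually_at_right_less intro: eventually_mono[OF eventually_at_right_less])
  next
    case False then show ?thesis by (intro tendsto_imp_eventually_ne[OF tendsto_ident_at]) auto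
  qed
  ultimately have "\<forall>\<^sub>F t in at_right 0. c t \<in> W \<and> p + t *\<^sub>R axis 1 1 \<noteq> 0 \<and> t \<noteq> - p $ 1"
    by eventually_elim blast
  from eventually_happens'[OF trivial_limit_at_right_real this]
  obtain t where t: "c t \<in> W" "p + t *\<^sub>R axis 1 1 \<noteq> 0" "t \<noteq> - p $ 1"
    by blast
  have n: "norm (c t) = 1" using t(2) by (simp add: c_def norm_sgn)
  have c1: "c t $ 1 \<noteq> 0" using t(2,3) by (simp add: c_def sgn_div_norm axis_def)
  have "inv std_frame (c t) = (c t $ 1, vector [c t $ 2, c t $ 3, c t $ 4])"
    by (rule inv_f_eq[OF bij_is_inj[OF frame_bij[OF affine_frame_std]]]) (simp add: vec_eq_iff forall_4)
  then have "antipodal_class (c t) \<in> range (affine_param std_frame)"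
    using c1 by (simp add: antipodal_class_in_image_iff[OF affine_frame_std n])
  then have "F (antipodal_class (c t)) = H (antipodal_class (c t))" using eq by auto
  moreover have "antipodal_class (c t) \<in> F -` U \<inter> H -` V" using W(2) n t(1) by (auto simp: set_eq_iff)
  ultimately show False using UV by auto
qed

section \<open>Isometries are isolated\<close>

lemma isometry_continuous: "isometry g F \<Longrightarrow> continuous_on UNIV F"
  by (simp add: isometry_def smooth_rp3_def)

lemma isometry_open_domain:
  assumes F: "isometry g F" and A: "affine_frame A" "affine_frame B"
  shows "open {x. F (affine_param A x) \<in> range (affine_param B)}"
proof -
  have "continuous_on UNIV (\<lambda>x. F (affine_param A x))"
    using continuous_on_compose2[OF isometry_continuous[OF F] continuous_affine_param[OF A(1)]] by simp
  then have "open ((\<lambda>x. F (affine_param A x)) -` range (affine_param B) \<inter> UNIV)"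
    using open_range_affine_param[OF A(2)] unfolding continuous_on_open_vimage[OF open_UNIV] by blast
  then show ?thesis by (simp add: vimage_def)
qed

lemma isometry_local:
  assumes F: "isometry equator_metric F" and A: "affine_frame A" "affine_frame B"
  shows "local_isometry (chart_metric A) (chart_metric B) (coord_rep A B F)
     {x. F (affine_param A x) \<in> range (affine_param B)}"
  unfolding local_isometry_def
  using isometry_open_domain[OF F A] F A by (auto simp: isometry_def smooth_rp3_def)

lemma affine_param_coord_rep:
  "F (affine_param A x) \<in> range (affine_param B) \<Longrightarrow> affine_param B (coord_rep A B F x) = F (affine_param A x)"
  by (simp add: coord_rep_def f_inv_into_f)

lemma local_isometry_precompose:
  assumes h: "local_isometry G H h U" and L: "linear L"
    and inv: "\<And>x v w. metric_prod G (L x) (L v) (L w) = metric_prod G x v w"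
  shows "local_isometry G H (\<lambda>x. h (L x)) (L -` U)"
    "\<And>x v. L x \<in> U \<Longrightarrow> dirderiv (\<lambda>x. h (L x)) x v = dirderiv h (L x) (L v)"
proof -
  note bL = linear_conv_bounded_linear[THEN iffD1, OF L]
  have U: "open U" "smooth_on h U" using h by (auto simp: local_isometry_def)
  show d: "dirderiv (\<lambda>x. h (L x)) x v = dirderiv h (L x) (L v)" if "L x \<in> U" for x v
    using dirderivI[OF diff_chain_at[OF bounded_linear_imp_has_derivative[OF bL] smooth_on_has_derivative[OF U(2) that]]]
    by (simp add: o_def)
  show "local_isometry G H (\<lambda>x. h (L x)) (L -` U)"
    unfolding local_isometry_def
  proof (intro conjI ballI allI)
    show "open (L -` U)" by (rule open_vimage[OF U(1) linear_continuous_on[OF bL]])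
    show "smooth_on (\<lambda>x. h (L x)) (L -` U)" by (rule smooth_on_precompose_linear[OF bL U])
    show "metric_prod H (h (L x)) (dirderiv (\<lambda>x. h (L x)) x v) (dirderiv (\<lambda>x. h (L x)) x w) = metric_prod G x v w"
      if "x \<in> L -` U" for x v w
      using that h inv by (simp add: d local_isometry_def)
  qed
qed

text \<open>By local rigidity, the interior of the coincidence set is closed as well as open.\<close>

lemma isometry_rigid:
  assumes F: "isometry equator_metric F" and H: "isometry equator_metric H" and B: "affine_frame B"
    and s: "\<And>i. s i = 1 \<or> s i = -1"
    and 0: "F (affine_param std_frame 0) = H (affine_param std_frame 0)"
      "F (affine_param std_frame 0) \<in> range (affine_param B)"
    and d: "\<And>v. dirderiv (coord_rep std_frame B F) 0 v = dirderiv (coord_rep std_frame B H) 0 (sign_change s v)"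
  shows "F (affine_param std_frame x) = H (affine_param std_frame (sign_change s x))"
proof -
  let ?p = "affine_param std_frame" and ?L = "sign_change s"
  note A = affine_frame_std and lin = linear_sign_change[of s]
  note inv = std_metric_sign_change[OF s]
  note bL = linear_conv_bounded_linear[THEN iffD1, OF lin]
  define T where "T = interior {x. F (?p x) = H (?p (?L x))}"
  have near: "x \<in> T" if C: "affine_frame C" and x: "F (?p x) = H (?p (?L x))" "F (?p x) \<in> range (affine_param C)"
    and dx: "\<And>v. dirderiv (coord_rep std_frame C F) x v = dirderiv (\<lambda>y. coord_rep std_frame C H (?L y)) x v" for x C
  proof -
    let ?f = "coord_rep std_frame C F" and ?h = "\<lambda>y. coord_rep std_frame C H (?L y)"
    let ?U = "{x. F (?p x) \<in> range (affine_param C)}" and ?V = "{x. H (?p x) \<in> range (affine_param C)}"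
    note lf = isometry_local[OF F A C]
    note lh = local_isometry_precompose(1)[OF isometry_local[OF H A C] lin inv]
    have op: "open (?U \<inter> ?L -` ?V)" using lf lh by (auto simp: local_isometry_def)
    have xin: "x \<in> ?U \<inter> ?L -` ?V" using x by auto
    have fx: "?f x = ?h x" using x(1) by (simp add: coord_rep_def)
    obtain r where r: "r > 0" "ball x r \<subseteq> ?U \<inter> ?L -` ?V" "\<And>y. y \<in> ball x r \<Longrightarrow> ?f y = ?h y"
      using isom_eq_near[OF smooth_metric_coord_metric[OF A] smooth_metric_coord_metric[OF C]
          local_isometry_subset[OF lf Int_lower1 op] local_isometry_subset[OF lh Int_lower2 op] xin fx ext[OF dx]]
      by blast
    have "F (?p y) = H (?p (?L y))" if y: "y \<in> ball x r" for y
    proof -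
      have "F (?p y) \<in> range (affine_param C)" "H (?p (?L y)) \<in> range (affine_param C)" using r(2) y by auto
      then have "F (?p y) = affine_param C (?f y)" "H (?p (?L y)) = affine_param C (?h y)"
        by (simp_all add: affine_param_coord_rep)
      then show ?thesis using r(3)[OF y] by simp
    qed
    then show ?thesis unfolding T_def using r(1) by (auto simp: mem_interior)
  qed
  have contF: "continuous_on UNIV (\<lambda>x. F (?p x))"
    using continuous_on_compose2[OF isometry_continuous[OF F] continuous_affine_param[OF A]] by simp
  have contH: "continuous_on UNIV (\<lambda>x. H (?p (?L x)))"
    using continuous_on_compose2[OF continuous_on_compose2[OF isometry_continuous[OF H] continuous_affine_param[OF A]]
        linear_continuous_on[OF bL]] by simp
  have cl: "closed {x. F (?p x) = H (?p (?L x))}" by (rule closed_Collect_eq[OF contF contH])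
  have closure_sub: "closure T \<subseteq> T"
  proof
    fix x assume x: "x \<in> closure T"
    have Tsub: "T \<subseteq> {x. F (?p x) = H (?p (?L x))}" unfolding T_def by (rule interior_subset)
    then have x1: "F (?p x) = H (?p (?L x))"
      using x closure_minimal[OF Tsub cl] by blast
    \<comment> \<open>The image of \<open>F\<close> need not stay in one chart, so each limit point
      gets its own target frame.\<close>
    obtain C where C: "affine_frame C" "F (?p x) \<in> range (affine_param C)" by (rule frame_containing)
    let ?f = "coord_rep std_frame C F" and ?h = "\<lambda>y. coord_rep std_frame C H (?L y)"
    let ?U = "{x. F (?p x) \<in> range (affine_param C)}" and ?V = "{x. H (?p x) \<in> range (affine_param C)}"
    note lf = isometry_local[OF F A C(1)]
    note lh = local_isometry_precompose(1)[OF isometry_local[OF H A C(1)] lin inv]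
    define W where "W = ?U \<inter> ?L -` ?V"
    have op: "open W" unfolding W_def using lf lh by (auto simp: local_isometry_def)
    have xW: "x \<in> W" using x1 C by (auto simp: W_def)
    have sf: "smooth_on ?f W" "smooth_on ?h W"
      using lf lh unfolding local_isometry_def W_def by (auto intro: smooth_on_subset)
    have eqT: "dirderiv ?f y v = dirderiv ?h y v" if y: "y \<in> T \<inter> W" for y v
    proof -
      have "open (T \<inter> W)" using op by (simp add: T_def open_Int)
      moreover have "?f z = ?h z" if "z \<in> T \<inter> W" for z using that Tsub by (auto simp: coord_rep_def)
      moreover have "?f differentiable (at y)" using sf(1) y by (auto intro: smooth_on_differentiable)
      ultimately show ?thesis using dirderiv_cong_open(2)[of "T \<inter> W" y ?f ?h] y by auto
    qed
    \<comment> \<open>The differentials agree on \<open>T\<close> near \<open>x\<close>, and by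
      continuity also at the limit point \<open>x\<close>; with equality of values this is the 1-jet
      condition of \<open>near\<close>.\<close>
    have "dirderiv ?f x v = dirderiv ?h x v" for v
    proof -
      have "continuous_on W (\<lambda>y. dirderiv ?f y v - dirderiv ?h y v)"
        by (intro continuous_on_diff smooth_on_continuous_on smooth_on_dirderiv sf)
      then have "closedin (top_of_set W) (W \<inter> (\<lambda>y. dirderiv ?f y v - dirderiv ?h y v) -` {0})"
        by (rule continuous_closedin_preimage) simp
      then obtain K where K: "closed K" "W \<inter> (\<lambda>y. dirderiv ?f y v - dirderiv ?h y v) -` {0} = W \<inter> K"
        by (auto simp: closedin_closed)
      have "T \<inter> W \<subseteq> K" using eqT K(2) by fastforce
      then have "closure (T \<inter> W) \<subseteq> K" by (rule closure_minimal[OF _ K(1)])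
      moreover have "x \<in> closure (T \<inter> W)"
        using open_Int_closure_subset[OF op, of T] x xW by (auto simp: Int_commute)
      ultimately have "x \<in> K" by blast
      then show ?thesis using K(2) xW by auto
    qed
    then show "x \<in> T" by (rule near[OF C(1) x1 C(2)])
  qed
  have "0 \<in> T"
  proof (rule near[OF B])
    show "F (?p 0) = H (?p (?L 0))" "F (?p 0) \<in> range (affine_param B)"
      using 0 by (simp_all add: linear_0[OF lin])
    show "dirderiv (coord_rep std_frame B F) 0 v = dirderiv (\<lambda>y. coord_rep std_frame B H (?L y)) 0 v" for v
      using d[of v] local_isometry_precompose(2)[OF isometry_local[OF H A B] lin inv, of 0 v] 0
      by (simp add: linear_0[OF lin])
  qed
  moreover have "open T" by (simp add: T_def)
  moreover have "closed T" using closure_sub by (simp add: closure_subset_eq)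
  ultimately have "T = UNIV" using clopen[of T] by auto
  then show ?thesis using interior_subset[of "{x. F (?p x) = H (?p (?L x))}"] unfolding T_def by auto
qed

text \<open>Scalar curvature locates the point that \<open>H\<close> sends to the value of
  \<open>F\<close> at the origin, Ricci and metric restrict the differential to sign changes, and
  \<open>F1\<close> selects the sign. The two hypotheses on \<open>F\<close> are open conditions on
  its values at two points.\<close>

lemma isometry_isolated:
  assumes F: "isometry equator_metric F" and H: "isometry equator_metric H"
    and F0: "F (affine_param std_frame 0) \<in> H ` range (affine_param std_frame)"
    and F1: "F (affine_param std_frame 1) \<in> H ` affine_param std_frame ` {x. \<forall>i. x $ i > 0}"
  shows "F = H"
proof -
  let ?p = "affine_param std_frame"
  note A = affine_frame_std
  obtain x where x: "F (?p 0) = H (?p x)" using F0 by auto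
  obtain B where B: "affine_frame B" "F (?p 0) \<in> range (affine_param B)" by (rule frame_containing)
  note sA = smooth_metric_coord_metric[OF A] and sB = smooth_metric_coord_metric[OF B(1)]
  note lF = isometry_local[OF F A B(1)] and lH = isometry_local[OF H A B(1)]
  let ?f = "coord_rep std_frame B F" and ?h = "coord_rep std_frame B H"
  have in0: "0 \<in> {x. F (?p x) \<in> range (affine_param B)}" "x \<in> {x. H (?p x) \<in> range (affine_param B)}"
    using B x by auto
  have fh: "?f 0 = ?h x" using x by (simp add: coord_rep_def)
  have "scalar_curvature std_metric x = scalar_curvature (chart_metric B) (?h x)"
    by (rule isom_scalar_curvature[OF sA sB lH in0(2), symmetric])
  also have "\<dots> = scalar_curvature std_metric 0"
    unfolding fh[symmetric] by (rule isom_scalar_curvature[OF sA sB lF in0(1)])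
  also have "\<dots> = 12" by (simp add: std_scalar_curvature_eq_iff)
  finally have "x = 0" by (simp add: std_scalar_curvature_eq_iff)
  note x = x[unfolded this] and in0 = in0[unfolded this] and fh = fh[unfolded this]
  let ?Mf = "matrix (dirderiv ?f 0)" and ?Mh = "matrix (dirderiv ?h 0)"
  note pf = isom_pullback[OF sA sB lF in0(1), unfolded std_metric_0 std_ricci_matrix_0]
  note ph = isom_pullback[OF sA sB lH in0(2), unfolded std_metric_0 std_ricci_matrix_0]
  obtain N where N: "?Mh ** N = mat 1" "N ** ?Mh = mat 1"
    using isom_matrix_inverse[OF sA sB lH in0(2)] .
  \<comment> \<open>The matrix of the differential of \<open>?f\<close> followed by the inverse of
    that of \<open>?h\<close>: a linear map of the tangent space at the origin.\<close>
  define L where "L = N ** ?Mf"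
  have tN: "transpose N ** transpose ?Mh = mat 1" by (simp add: N flip: matrix_transpose_mul)
  \<comment> \<open>Both maps pull the same tensor at the common image point back to the same tensor
    at the origin, so \<open>L\<close> preserves the latter.\<close>
  have conj: "transpose L ** Y ** L = Y" if X: "transpose ?Mf ** X ** ?Mf = Y" "transpose ?Mh ** X ** ?Mh = Y" for X Y
  proof -
    have "transpose L ** Y ** L = transpose ?Mf ** (transpose N ** transpose ?Mh) ** X ** (?Mh ** N) ** ?Mf"
      unfolding L_def by (simp add: matrix_transpose_mul matrix_mul_assoc flip: X(2))
    then show ?thesis by (simp add: tN N X(1))
  qed
  have LL: "transpose L ** L = mat 1"
    using conj[OF pf(1)] ph(1) fh by (simp add: matrix_mul_rid)
  have LR: "transpose L ** diag3 6 4 2 ** L = diag3 6 4 2"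
    using conj[OF pf(2)] ph(2) fh by simp
  obtain s where s: "\<And>i. s i = 1 \<or> s i = -1" "\<And>x. L *v x = sign_change s x"
    using orthogonal_diag3_commute[OF LL LR] by auto
  have MfL: "?Mf = ?Mh ** L" unfolding L_def by (simp add: matrix_mul_assoc N)
  have lin: "linear (dirderiv ?f 0)" "linear (dirderiv ?h 0)"
    by (rule isom_linear[OF sA sB lF in0(1)], rule isom_linear[OF sA sB lH in0(2)])
  have d: "dirderiv ?f 0 v = dirderiv ?h 0 (sign_change s v)" for v
  proof -
    have "dirderiv ?f 0 v = ?Mf *v v" using fun_cong[OF matrix_vector_mul(2)[OF lin(1)], of v] by simp
    also have "\<dots> = ?Mh *v sign_change s v" unfolding MfL by (simp add: s(2) flip: matrix_vector_mul_assoc)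
    also have "\<dots> = dirderiv ?h 0 (sign_change s v)"
      using fun_cong[OF matrix_vector_mul(2)[OF lin(2)], of "sign_change s v"] by simp
    finally show ?thesis .
  qed
  have rigid: "F (?p y) = H (?p (sign_change s y))" for y
    by (rule isometry_rigid[OF F H B(1) s(1) x B(2) d])
  obtain z where z: "F (?p 1) = H (?p z)" "\<And>i. z $ i > 0" using F1 by auto
  have "inj H" using H by (simp add: isometry_def bij_is_inj)
  then have "sign_change s 1 = z"
    using rigid[of 1] z(1) affine_param_inj[OF A] by (metis injD)
  then have "s i > 0" for i using z(2)[of i] by (auto simp: sign_change_def)
  then have "s i = 1" for i using s(1)[of i] by (metis less_minus_one_simps(1) less_asym)
  then have "sign_change s y = y" for y by (simp add: sign_change_def vec_eq_iff)
  then show ?thesis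
    using rigid by (intro continuous_eq_on_std_chart isometry_continuous[OF F] isometry_continuous[OF H]) simp
qed

lemma isometry_open_image:
  assumes H: "isometry g H" and U: "open U" shows "open (H ` U)"
proof -
  have "continuous_on UNIV (inv H)" "bij H" using H by (auto simp: isometry_def smooth_rp3_def)
  moreover have "H ` U = inv H -` U \<inter> UNIV" using \<open>bij H\<close> by (auto simp: bij_vimage_eq_inv_image inv_inv_eq bij_is_inj bij_imp_bij_inv)
  ultimately show ?thesis using U by (simp only: continuous_on_open_vimage[OF open_UNIV])
qed

lemma openin_compact_open: "compact K \<Longrightarrow> open U \<Longrightarrow> openin compact_open_topology {F. F ` K \<subseteq> U}"
  unfolding compact_open_topology_def by (rule topology_generated_by_Basis) blast

lemma isometry_group_discrete:
  "isometry_group_topology equator_metric = discrete_topology {F. isometry equator_metric F}"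
proof -
  let ?I = "{F. isometry equator_metric F}" and ?p = "affine_param std_frame"
  have "openin (isometry_group_topology equator_metric) {H}" if H: "isometry equator_metric H" for H
  proof -
    \<comment> \<open>Two subbasic sets whose compact parts are single points. Their target sets are
      open since charts are open maps and \<open>H\<close> has a continuous inverse.\<close>
    let ?O = "{F. F ` {?p 0} \<subseteq> H ` range ?p} \<inter> {F. F ` {?p 1} \<subseteq> H ` ?p ` {x. \<forall>i. x $ i > 0}}"
    have "open {x :: real^3. \<forall>i. x $ i > 0}"
      by (simp add: Collect_all_eq) (intro open_INT ballI open_Collect_less continuous_intros finite)
    then have "openin compact_open_topology ?O"
      using H affine_frame_std
      by (intro openin_Int openin_compact_open isometry_open_image[OF H] open_affine_param_image open_UNIV) auto
    moreover have "{H} = ?O \<inter> ?I"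
      using isometry_isolated[OF _ H] H by (auto simp: one_vec_def)
    ultimately show ?thesis
      unfolding isometry_group_topology_def openin_subtopology by blast
  qed
  moreover have "topspace (isometry_group_topology equator_metric) = ?I"
    \<comment> \<open>With empty compact set and empty target the subbasic set contains every map,
      so the compact-open topology has all functions as its carrier.\<close>
    using openin_subset[OF openin_compact_open[of "{}" "{}"]]
    by (auto simp: isometry_group_topology_def)
  ultimately show ?thesis by (metis discrete_topology_unique mem_Collect_eq)
qed

theorem theoremD:
  shows "\<exists>g. riemannian_metric g \<and>
    (\<forall>v\<in>sphere 0 1. minimal_surface g (equator v)) \<and>
    isometry_group_topology g = discrete_topology {F. isometry g F}"
  using riemannian_metric_equator_metric minimal_surface_equator isometry_group_discrete by blast

end
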